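(* Let $k\ge 1$ and $1\le m\le d$ be integers. Let $D\subset\mathbb{R}^d$ be open and bounded, and let $M\subset D$ be a bounded and closed $m$-dimensional $C^{k+1}$-submanifold of $\mathbb{R}^d$ (with or without boundary). Let $J$ be a real-valued shape function, defined on a set $\Xi$ of closed and bounded $m$-dimensional $C^k$-submanifolds (with or without boundary) of $\mathbb{R}^d$ contained in $D$, with $M\in\Xi$. Suppose that $J$ is shape differentiable at $M$ and that $dJ(M)$ is of order $k$. Then there exist continuous linear functionals $h:C^k(M,\mathbb{R}^d)\to\mathbb{R}$ and $g:C^k(\partial M)\to\mathbb{R}$ such that $$dJ(M)(X)=h(X^\bot)+g(X|_{\partial M}\cdot\nu)\qquad\text{for all }X\in C^k_c(D,\mathbb{R}^d),$$ where $X^\bot$ is the pointwise normal part of $X|_M$, i.e. $X^\bot_p$ is the orthogonal projection of $X(p)$ onto $(T_pM)^\bot$ for $p\in M$, and $\nu$ is the unique outward-pointing unit vector field along $\partial M$.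
   Context: Submanifolds: an $m$-dimensional $C^k$-submanifold $M$ of $\mathbb{R}^d$ (with boundary) is a subset such that for each $p\in M$ there are open sets $U\ni p$ and $V$ in $\mathbb{R}^d$ and a $C^k$-diffeomorphism $\varphi:U\to V$ with $\varphi(U\cap M)=V\cap(\bar{\mathbb{H}}^m\times\{0\})$ or (at points that are not boundary points) $\varphi(U\cap M)=V\cap(\mathbb{R}^m\times\{0\})$, where $\bar{\mathbb{H}}^m=\mathbb{R}^{m-1}\times[0,\infty)$. The boundary $\partial M$ is the set of points mapped into $\mathbb{R}^{m-1}\times\{0\}\subset\bar{\mathbb{H}}^m$ by a chart of the first kind; it may be empty. $T_pM\subset\mathbb{R}^d$ is the $m$-dimensional tangent space (also at boundary points). For $p\in\partial M$, $\nu(p)$ is the unit vector in $T_pM$ which is orthogonal to $T_p(\partial M)$ (Euclidean inner product) and points out of $M$. Eulerian semi-derivative: let $k\ge1$ and let $C^k_c(D,\mathbb{R}^d)$ be the space of $C^k$ vector fields with compact support in $D$. For $X\in C^k_c(D,\mathbb{R}^d)$, $\Phi_t$ denotes the flow of $X$: $\frac{d}{dt}\Phi_t(x)=X(\Phi_t(x))$, $\Phi_0(x)=x$. For a function $J:\Xi\to\mathbb{R}$ on a set $\Xi$ of subsets of $D$, and $\Omega\in\Xi$, $X\in C^k_c(D,\mathbb{R}^d)$ such that $\Phi_t(\Omega)\in\Xi$ for all sufficiently small $t>0$, the Eulerian semi-derivative of $J$ at $\Omega$ in direction $X$ is $$dJ(\Omega)(X):=\lim_{t\searrow0}\frac{J(\Phi_t(\Omega))-J(\Omega)}{t}.$$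 $J$ is shape differentiable at $\Omega$ if $dJ(\Omega)(X)$ exists for all $X\in C^\infty_c(D,\mathbb{R}^d)$ and $X\mapsto dJ(\Omega)(X)$ is linear and continuous on $C^\infty_c(D,\mathbb{R}^d)$. The order of $dJ(\Omega)$ is the smallest integer $k\ge0$ for which $X\mapsto dJ(\Omega)(X)$ is continuous with respect to the $C^k_c(D,\mathbb{R}^d)$-topology, i.e. the topology given by the seminorms $\|f\|_{K,\alpha}=\sup_{x\in K}|\partial^\alpha f(x)|$, $K\subset D$ compact, $|\alpha|\le k$. $C^k(M,\mathbb{R}^d)$ and $C^k(\partial M)$ carry their usual $C^k$-norm topologies. If $\partial M=\emptyset$ the term with $g$ is absent (zero).
   Formalization: "dJ(M) is of order k" is taken to include that the Eulerian semi-derivative dJ(M)(X) exists for all X in C^k_c(D,R^d) and is continuous there; with continuity only on smooth fields the claim fails for some C^{k+1} curves. *)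

theory Defs
  imports "HOL-Analysis.Analysis" "HOL-Library.Extended_Nat"
begin

section \<open>Functions of class \<open>C\<^sup>k\<close>\<close>

text \<open>
  Iterated partial derivatives relative to \<open>S\<close>, for a list of directions.  For functions of
  class \<open>C\<^sup>k\<close> the order of the directions is irrelevant, so the lists of length at most \<open>k\<close> play the
  role of the multi-indices \<open>\<alpha>\<close> with \<open>\<bar>\<alpha>\<bar> \<le> k\<close>.  Below, \<open>S\<close> is an open set or a relatively open subset of a
  coordinate plane or half-plane, and the directions lie in that plane. The derivative in these
  directions is then unique, even where the full Frechet derivative within \<open>S\<close> is not.
\<close>

primrec partials :: "'a::euclidean_space set \<Rightarrow> 'a list \<Rightarrow> ('a \<Rightarrow> 'b::real_normed_vector) \<Rightarrow> 'a \<Rightarrow> 'b"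
  where
    "partials S [] f = f"
  | "partials S (b # bs) f = (\<lambda>x. frechet_derivative (partials S bs f) (at x within S) b)"

definition Ck_on :: "enat \<Rightarrow> 'a::euclidean_space set \<Rightarrow> 'a set \<Rightarrow> ('a \<Rightarrow> 'b::real_normed_vector) \<Rightarrow> bool"
  where "Ck_on k B S f \<longleftrightarrow>
    (\<forall>bs. set bs \<subseteq> B \<and> enat (length bs) \<le> k \<longrightarrow>
       continuous_on S (partials S bs f) \<and>
       (enat (length bs) < k \<longrightarrow> partials S bs f differentiable_on S))"


section \<open>Linear functionals on function spaces topologised by seminorms\<close>

text \<open>
  A function space is a set \<open>V\<close> of total functions that is closed under pointwise linear
  combinations; functions on a subset of the ambient space are extended by zero.
\<close>

definition seminorm_topology ::
    "('a \<Rightarrow> 'b::real_normed_vector) set \<Rightarrow> (('a \<Rightarrow> 'b) \<Rightarrow> real) set \<Rightarrow> ('a \<Rightarrow> 'b) topology"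
  where "seminorm_topology V P =
    topology_generated_by
      (insert V {{g \<in> V. p (\<lambda>x. g x - f x) < r} |f p r. f \<in> V \<and> p \<in> P \<and> 0 < r})"

definition linear_functional_on ::
    "('a \<Rightarrow> 'b::real_normed_vector) set \<Rightarrow> (('a \<Rightarrow> 'b) \<Rightarrow> real) \<Rightarrow> bool"
  where "linear_functional_on V T \<longleftrightarrow>
    (\<forall>f\<in>V. \<forall>g\<in>V. \<forall>a b. T (\<lambda>x. a *\<^sub>R f x + b *\<^sub>R g x) = a * T f + b * T g)"

definition continuous_functional_on ::
    "('a \<Rightarrow> 'b::real_normed_vector) set \<Rightarrow> (('a \<Rightarrow> 'b) \<Rightarrow> real) set \<Rightarrow> (('a \<Rightarrow> 'b) \<Rightarrow> real) \<Rightarrow> bool"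
  where "continuous_functional_on V P T \<longleftrightarrow> continuous_map (seminorm_topology V P) euclideanreal T"


section \<open>Submanifolds of Euclidean space\<close>

text \<open>An enumeration of the standard basis, to speak about the first \<open>m\<close> coordinates.\<close>

definition ebasis :: "nat \<Rightarrow> 'a::euclidean_space"
  where "ebasis = (SOME e. bij_betw e {..<DIM('a)} Basis)"

definition coord_plane :: "nat \<Rightarrow> 'a::euclidean_space set"
  where "coord_plane m = {x. \<forall>i. m \<le> i \<and> i < DIM('a) \<longrightarrow> x \<bullet> ebasis i = 0}"

definition half_plane :: "nat \<Rightarrow> 'a::euclidean_space set"
  where "half_plane m = {x \<in> coord_plane m. x \<bullet> ebasis (m - 1) \<ge> 0}"

text \<open>
  The case \<open>m = 0\<close> (no half-space) is needed for boundaries of curves.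
\<close>

definition model_space :: "nat \<Rightarrow> 'a::euclidean_space set \<Rightarrow> bool"
  where "model_space m H \<longleftrightarrow> H = coord_plane m \<or> (1 \<le> m \<and> H = half_plane m)"

definition chart ::
    "enat \<Rightarrow> 'a::euclidean_space set \<Rightarrow> 'a set \<Rightarrow> 'a set \<Rightarrow> 'a set \<Rightarrow> ('a \<Rightarrow> 'a) \<Rightarrow> ('a \<Rightarrow> 'a) \<Rightarrow> bool"
  where "chart r M H U V \<phi> \<psi> \<longleftrightarrow>
    open U \<and> open V \<and> homeomorphism U V \<phi> \<psi> \<and> Ck_on r Basis U \<phi> \<and> Ck_on r Basis V \<psi> \<and>
    \<phi> ` (U \<inter> M) = V \<inter> H"

definition submanifold :: "enat \<Rightarrow> nat \<Rightarrow> 'a::euclidean_space set \<Rightarrow> bool"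
  where "submanifold r m M \<longleftrightarrow>
    (\<forall>p\<in>M. \<exists>H U V \<phi> \<psi>. model_space m H \<and> chart r M H U V \<phi> \<psi> \<and> p \<in> U)"

definition mfd_boundary :: "enat \<Rightarrow> nat \<Rightarrow> 'a::euclidean_space set \<Rightarrow> 'a set"
  where "mfd_boundary r m M =
    {p \<in> M. \<exists>U V \<phi> \<psi>. chart r M (half_plane m) U V \<phi> \<psi> \<and> p \<in> U \<and> \<phi> p \<bullet> ebasis (m - 1) = 0}"

definition tangent_space :: "enat \<Rightarrow> nat \<Rightarrow> 'a::euclidean_space set \<Rightarrow> 'a \<Rightarrow> 'a set"
  where "tangent_space r m M p =
    {frechet_derivative \<psi> (at (\<phi> p)) w |H U V \<phi> \<psi> w.
       model_space m H \<and> chart r M H U V \<phi> \<psi> \<and> p \<in> U \<inter> M \<and> w \<in> coord_plane m}"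

definition points_outward :: "enat \<Rightarrow> nat \<Rightarrow> 'a::euclidean_space set \<Rightarrow> 'a \<Rightarrow> 'a \<Rightarrow> bool"
  where "points_outward r m M p v \<longleftrightarrow>
    (\<exists>U V \<phi> \<psi>. chart r M (half_plane m) U V \<phi> \<psi> \<and> p \<in> U \<and> \<phi> p \<bullet> ebasis (m - 1) = 0 \<and>
       frechet_derivative \<phi> (at p) v \<bullet> ebasis (m - 1) < 0)"

definition outward_normal :: "enat \<Rightarrow> nat \<Rightarrow> 'a::euclidean_space set \<Rightarrow> 'a \<Rightarrow> 'a"
  where "outward_normal r m M p =
    (THE v. norm v = 1 \<and> v \<in> tangent_space r m M p \<and>
       (\<forall>w \<in> tangent_space r (m - 1) (mfd_boundary r m M) p. orthogonal v w) \<and>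
       points_outward r m M p v)"

definition orth_projection :: "'a::euclidean_space set \<Rightarrow> 'a \<Rightarrow> 'a"
  where "orth_projection W x = (THE y. y \<in> W \<and> (\<forall>w\<in>W. orthogonal (x - y) w))"

definition normal_part :: "enat \<Rightarrow> nat \<Rightarrow> 'a::euclidean_space set \<Rightarrow> ('a \<Rightarrow> 'a) \<Rightarrow> 'a \<Rightarrow> 'a"
  where "normal_part r m M X =
    (\<lambda>p. if p \<in> M then orth_projection ((tangent_space r m M p)\<^sup>\<bottom>) (X p) else 0)"

definition boundary_flux :: "enat \<Rightarrow> nat \<Rightarrow> 'a::euclidean_space set \<Rightarrow> ('a \<Rightarrow> 'a) \<Rightarrow> 'a \<Rightarrow> real"
  where "boundary_flux r m M X =
    (\<lambda>p. if p \<in> mfd_boundary r m M then X p \<bullet> outward_normal r m M p else 0)"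

text \<open>
  The space \<open>C\<^sup>k(M)\<close> for an \<open>m\<close>-dimensional submanifold \<open>M\<close> of class \<open>C\<^sup>r\<close>, \<open>k \<le> r\<close>, and the seminorms
  defining its topology: suprema of the partial derivatives of local representatives over compact
  parts of chart domains.  For compact \<open>M\<close> finitely many of these seminorms, taken from a finite
  atlas, already generate the topology, which is thus that of the usual \<open>C\<^sup>k\<close>-norm.
\<close>

definition Ck_mfd ::
    "enat \<Rightarrow> nat \<Rightarrow> 'a::euclidean_space set \<Rightarrow> enat \<Rightarrow> ('a \<Rightarrow> 'b::real_normed_vector) set"
  where "Ck_mfd r m M k =
    {f. (\<forall>x. x \<notin> M \<longrightarrow> f x = 0) \<and>
        (\<forall>H U V \<phi> \<psi>. model_space m H \<and> chart r M H U V \<phi> \<psi> \<longrightarrow>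
           Ck_on k (ebasis ` {..<m}) (V \<inter> H) (f \<circ> \<psi>))}"

definition Ck_mfd_seminorms ::
    "enat \<Rightarrow> nat \<Rightarrow> 'a::euclidean_space set \<Rightarrow> enat \<Rightarrow> (('a \<Rightarrow> 'b::real_normed_vector) \<Rightarrow> real) set"
  where "Ck_mfd_seminorms r m M k =
    {(\<lambda>f. SUP x\<in>K. norm (partials (V \<inter> H) bs (f \<circ> \<psi>) x)) |H U V \<phi> \<psi> K bs.
       model_space m H \<and> chart r M H U V \<phi> \<psi> \<and>
       compact K \<and> K \<noteq> {} \<and> K \<subseteq> V \<inter> H \<and>
       set bs \<subseteq> ebasis ` {..<m} \<and> enat (length bs) \<le> k}"


section \<open>Shape derivatives\<close>

definition Ckc :: "'a::euclidean_space set \<Rightarrow> enat \<Rightarrow> ('a \<Rightarrow> 'a) set"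
  where "Ckc D k =
    {X. Ck_on k Basis UNIV X \<and> (\<exists>K. compact K \<and> K \<subseteq> D \<and> (\<forall>x. x \<notin> K \<longrightarrow> X x = 0))}"

definition Ckc_seminorms :: "'a::euclidean_space set \<Rightarrow> enat \<Rightarrow> (('a \<Rightarrow> 'a) \<Rightarrow> real) set"
  where "Ckc_seminorms D k =
    {(\<lambda>f. SUP x\<in>K. norm (partials UNIV bs f x)) |K bs.
       compact K \<and> K \<noteq> {} \<and> K \<subseteq> D \<and> set bs \<subseteq> Basis \<and> enat (length bs) \<le> k}"

text \<open>
  \<open>\<Phi> t x\<close> is \<open>\<Phi>\<^sub>t(x)\<close>.  For \<open>X\<close> in \<open>Ckc D k\<close> with \<open>k \<ge> 1\<close> the field is globally Lipschitz, so there is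
  exactly one such \<open>\<Phi>\<close>.
\<close>

definition is_flow :: "('a::euclidean_space \<Rightarrow> 'a) \<Rightarrow> (real \<Rightarrow> 'a \<Rightarrow> 'a) \<Rightarrow> bool"
  where "is_flow X \<Phi> \<longleftrightarrow>
    (\<forall>x. \<Phi> 0 x = x \<and> (\<forall>t. ((\<lambda>s. \<Phi> s x) has_vector_derivative X (\<Phi> t x)) (at t)))"

definition has_eulerian_semiderivative ::
    "'a::euclidean_space set set \<Rightarrow> ('a set \<Rightarrow> real) \<Rightarrow> 'a set \<Rightarrow> ('a \<Rightarrow> 'a) \<Rightarrow> real \<Rightarrow> bool"
  where "has_eulerian_semiderivative \<Xi> J \<Omega> X L \<longleftrightarrow>
    (\<exists>\<Phi>. is_flow X \<Phi> \<and>
       (\<forall>\<^sub>F t in at_right 0. \<Phi> t ` \<Omega> \<in> \<Xi>) \<and>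
       ((\<lambda>t. (J (\<Phi> t ` \<Omega>) - J \<Omega>) / t) \<longlongrightarrow> L) (at_right 0))"

definition eulerian_semiderivative ::
    "'a::euclidean_space set set \<Rightarrow> ('a set \<Rightarrow> real) \<Rightarrow> 'a set \<Rightarrow> ('a \<Rightarrow> 'a) \<Rightarrow> real"
  where "eulerian_semiderivative \<Xi> J \<Omega> X = (THE L. has_eulerian_semiderivative \<Xi> J \<Omega> X L)"

definition shape_differentiable ::
    "'a::euclidean_space set \<Rightarrow> 'a set set \<Rightarrow> ('a set \<Rightarrow> real) \<Rightarrow> 'a set \<Rightarrow> bool"
  where "shape_differentiable D \<Xi> J \<Omega> \<longleftrightarrow>
    (\<forall>X \<in> Ckc D \<infinity>. \<exists>L. has_eulerian_semiderivative \<Xi> J \<Omega> X L) \<and>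
    linear_functional_on (Ckc D \<infinity>) (eulerian_semiderivative \<Xi> J \<Omega>) \<and>
    continuous_functional_on (Ckc D \<infinity>) (Ckc_seminorms D \<infinity>) (eulerian_semiderivative \<Xi> J \<Omega>)"

text \<open>
  The shape derivative is of order \<open>k\<close> (for \<open>k \<ge> 1\<close>): it is continuous for the \<open>C\<^sup>k\<^sub>c\<close>-topology but not
  for the \<open>C\<^sup>j\<^sub>c\<close>-topology with \<open>j < k\<close>.  Continuity for \<open>k\<close> is understood for \<open>X \<mapsto> dJ(\<Omega>)(X)\<close> as a map on
  \<open>C\<^sup>k\<^sub>c(D)\<close>, so the semi-derivative has to exist for all fields of class \<open>C\<^sup>k\<^sub>c\<close>.  It does not suffice to extend
  \<open>dJ(\<Omega>)\<close> from smooth fields by density: such an extension need not be the semi-derivative, and need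
  not vanish on tangential fields when \<open>\<Omega>\<close> has only finite smoothness.  The negative part is the
  weaker requirement of discontinuity on smooth fields, which is meaningful for \<open>j = 0\<close> also.
\<close>

definition shape_derivative_of_order ::
    "'a::euclidean_space set \<Rightarrow> 'a set set \<Rightarrow> ('a set \<Rightarrow> real) \<Rightarrow> 'a set \<Rightarrow> nat \<Rightarrow> bool"
  where "shape_derivative_of_order D \<Xi> J \<Omega> k \<longleftrightarrow>
    (\<forall>X \<in> Ckc D (enat k). \<exists>L. has_eulerian_semiderivative \<Xi> J \<Omega> X L) \<and>
    continuous_functional_on (Ckc D (enat k)) (Ckc_seminorms D (enat k))
      (eulerian_semiderivative \<Xi> J \<Omega>) \<and>
    (\<forall>j<k. \<not> continuous_functional_on (Ckc D \<infinity>) (Ckc_seminorms D (enat j))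
              (eulerian_semiderivative \<Xi> J \<Omega>))"

end

theory Submission
  imports Defs "HOL-Computational_Algebra.Polynomial"
begin

text \<open>
  If \<open>Z\<close> is tangential to \<open>M\<close> and to its boundary, its flow maps \<open>M\<close> onto itself, so the difference
  quotients of \<open>J\<close> vanish and so does the shape derivative \<open>L Z\<close>; this uses that \<open>L\<close> is the actual
  semi-derivative for every field of class \<open>C\<^sup>k\<close>, and its linearity there, which follows from density of
  the smooth fields.  Now let \<open>E\<close> be a bounded linear extension operator from \<open>C\<^sup>k(M)\<close> to \<open>C\<^sup>k\<^sub>c(D)\<close>
  (Hestenes reflection in half-plane charts), and let \<open>G f\<close> be a field that is tangential to \<open>M\<close> and
  equals \<open>f\<close> times the outward normal on the boundary.  Put \<open>h = L \<circ> E\<close> and \<open>g = L \<circ> G\<close>: the field \<open>X\<close> minus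
  \<open>E\<close> of its normal part minus \<open>G\<close> of its flux is tangential to \<open>M\<close> and to the boundary, hence \<open>L X = h(X\<^sup>\<bottom>) + g(X \<bullet> \<nu>)\<close>.
\<close>

section \<open>Partial derivatives relative to a set\<close>

text \<open>The fields are one order less smooth than \<open>M\<close>. Tangent frames are first
  derivatives of charts, so normal parts and fluxes are again C^k, and a tangential field read in a
  chart is C^1, hence locally Lipschitz. Its flow is studied there: the squared distance to the
  model space obeys a Gronwall estimate, which treats interior and boundary points alike.

  The obstacle is calculus on half-planes inside a larger space. On such thin sets a total
  derivative is not unique, and only its values along short rays inside the set are meaningful;
  hence the predicate \<open>ray_set\<close>. Across the edge a function is continued by
  extrapolation: binomial weights reproduce polynomials up to degree \<open>k\<close>, so that all
  derivatives up to order \<open>k\<close> match.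

  Continuity of \<open>h\<close> and \<open>g\<close> is obtained by explicit constants.
  \<open>jet\<close> sums the norms of all partial derivatives at a point, and every operator is
  bounded by finitely many seminorms. Local operators are glued one ball at a time with the weight 1
  - (1 - \<theta>)(1 - \<eta>), so no partition of unity appears. Independence of charts for tangent
  spaces and boundaries comes from curves that run into \<open>M\<close>.\<close>

text \<open>One-sided rays suffice to determine directional derivatives, and they are all that is
  available at the edge of a half-plane, where the last coordinate vector points inward.\<close>

definition ray_set :: "'a::real_normed_vector set \<Rightarrow> 'a set \<Rightarrow> bool" where
  "ray_set S B \<longleftrightarrow> (\<forall>x\<in>S. \<forall>b\<in>B. \<exists>d>0. \<forall>t. 0 \<le> t \<and> t < d \<longrightarrow> x + t *\<^sub>R b \<in> S)"

lemma ray_set_open: "open S \<Longrightarrow> ray_set S B"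
  unfolding ray_set_def
proof (intro ballI)
  fix x b assume S: "open S" "x \<in> S" "b \<in> B"
  then obtain e where e: "e > 0" "ball x e \<subseteq> S" by (meson openE)
  show "\<exists>d>0. \<forall>t. 0 \<le> t \<and> t < d \<longrightarrow> x + t *\<^sub>R b \<in> S"
  proof (intro exI[of _ "e / (norm b + 1)"] conjI allI impI)
    show "e / (norm b + 1) > 0" using e by (simp add: add_nonneg_pos)
    fix t assume t: "0 \<le> t \<and> t < e / (norm b + 1)"
    then have "t * (norm b + 1) < e" by (simp add: pos_less_divide_eq add_nonneg_pos)
    then have "t * norm b < e" using t by (simp add: algebra_simps)
    then have "x + t *\<^sub>R b \<in> ball x e" using t by (simp add: dist_norm)
    then show "x + t *\<^sub>R b \<in> S" using e by blast
  qed
qed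

lemma ray_set_Int_open:
  assumes "ray_set S B" "open T"
  shows "ray_set (S \<inter> T) B"
  unfolding ray_set_def
proof (intro ballI)
  fix x b assume x: "x \<in> S \<inter> T" "b \<in> B"
  obtain d where d: "d > 0" "\<And>t. 0 \<le> t \<and> t < d \<Longrightarrow> x + t *\<^sub>R b \<in> S"
    using assms(1) x unfolding ray_set_def by blast
  obtain e where e: "e > 0" "\<And>t. 0 \<le> t \<and> t < e \<Longrightarrow> x + t *\<^sub>R b \<in> T"
    using ray_set_open[OF assms(2)] x unfolding ray_set_def by blast
  show "\<exists>d>0. \<forall>t. 0 \<le> t \<and> t < d \<longrightarrow> x + t *\<^sub>R b \<in> S \<inter> T"
    using d e by (intro exI[of _ "min d e"]) auto
qed

text \<open>Restriction to a short segment from \<open>x\<close> in direction \<open>b\<close> turns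
  both derivatives into derivatives of one curve on a compact interval, where uniqueness holds also
  at an end point.\<close>

lemma has_derivative_ray_unique:
  fixes f :: "'a::real_normed_vector \<Rightarrow> 'b::real_normed_vector"
  assumes S: "ray_set S B" "x \<in> S" "b \<in> B"
    and f: "(f has_derivative f') (at x within S)" "(f has_derivative f'') (at x within S)"
  shows "f' b = f'' b"
proof -
  obtain d where d: "d > 0" "\<And>t. 0 \<le> t \<and> t < d \<Longrightarrow> x + t *\<^sub>R b \<in> S"
    using S unfolding ray_set_def by blast
  let ?I = "{0..d/2}"
  let ?g = "\<lambda>t. x + t *\<^sub>R b"
  have sub: "?g ` ?I \<subseteq> S" using d by auto
  have g: "(?g has_derivative (\<lambda>t. t *\<^sub>R b)) (at 0 within ?I)"
    by (auto intro!: derivative_eq_intros)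
  have *: "((\<lambda>t. f (?g t)) has_vector_derivative D b) (at 0 within ?I)"
    if D: "(f has_derivative D) (at x within S)" for D
  proof -
    have "(f has_derivative D) (at (?g 0) within ?g ` ?I)"
      using has_derivative_subset[OF D sub] by simp
    from has_derivative_in_compose[OF g this]
    have "((\<lambda>t. f (?g t)) has_derivative (\<lambda>t. D (t *\<^sub>R b))) (at 0 within ?I)" .
    moreover have "(\<lambda>t. D (t *\<^sub>R b)) = (\<lambda>t. t *\<^sub>R D b)"
      using has_derivative_linear[OF D] by (simp add: linear_cmul fun_eq_iff)
    ultimately show ?thesis by (simp add: has_vector_derivative_def)
  qed
  show ?thesis
    using vector_derivative_unique_within[OF _ *[OF f(1)] *[OF f(2)]] d(1)
    by (simp add: trivial_limit_within islimpt_Icc)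
qed

abbreviation pd :: "'a::euclidean_space set \<Rightarrow> 'a \<Rightarrow> ('a \<Rightarrow> 'b::real_normed_vector) \<Rightarrow> 'a \<Rightarrow> 'b"
  where "pd S b f \<equiv> (\<lambda>x. frechet_derivative f (at x within S) b)"

text \<open>\<open>frechet_derivative\<close> picks one of possibly many derivatives within
  \<open>S\<close>; in an admissible direction its value can nevertheless be read off from any
  derivative that has been found.\<close>

lemma pd_eq:
  assumes "ray_set S B" "x \<in> S" "b \<in> B" "(f has_derivative f') (at x within S)"
  shows "pd S b f x = f' b"
  using assms has_derivative_ray_unique[OF assms(1-3)]
  by (metis differentiableI frechet_derivative_works)

text \<open>The recursion of \<open>partials\<close> adds derivatives on the outside. Inductions
  need the innermost one peeled off, so that the claim for order \<open>n\<close> can be applied to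
  \<open>pd S b f\<close>.\<close>

lemma partials_snoc: "partials S (bs @ [b]) f = partials S bs (pd S b f)"
  by (induction bs) simp_all

text \<open>Holds for every \<open>f\<close>, differentiable or not: both sides choose from the same
  set of derivatives, since filters and function values agree near \<open>x\<close>.\<close>

lemma frechet_derivative_local:
  assumes "open T" "x \<in> S" "x \<in> T" "\<And>y. y \<in> S \<inter> T \<Longrightarrow> f y = g y"
  shows "frechet_derivative f (at x within S) = frechet_derivative g (at x within S \<inter> T)"
proof -
  have eq: "at x within S = at x within S \<inter> T"
    by (rule at_within_nhd[of _ T]) (use assms in auto)
  have "(f has_derivative f') (at x within S) \<longleftrightarrow> (g has_derivative f') (at x within S \<inter> T)" for f'
    unfolding eq
    by (rule iffI; erule has_derivative_transform[rotated 2]) (use assms in auto)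
  then show ?thesis by (simp add: frechet_derivative_def)
qed

lemma differentiable_local:
  assumes "open T" "x \<in> S" "x \<in> T" "\<And>y. y \<in> S \<inter> T \<Longrightarrow> f y = g y"
  shows "f differentiable (at x within S) \<longleftrightarrow> g differentiable (at x within S \<inter> T)"
proof -
  have eq: "at x within S = at x within S \<inter> T"
    by (rule at_within_nhd[of _ T]) (use assms in auto)
  show ?thesis
    unfolding eq differentiable_def
    by (rule iffI; elim exE; rule exI; erule has_derivative_transform[rotated 2]) (use assms in auto)
qed

lemma continuous_local:
  assumes "open T" "x \<in> S" "x \<in> T" "\<And>y. y \<in> S \<inter> T \<Longrightarrow> f y = g y"
  shows "continuous (at x within S) f \<longleftrightarrow> continuous (at x within S \<inter> T) g"
proof -
  have eq: "at x within S = at x within S \<inter> T"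
    by (rule at_within_nhd[of _ T]) (use assms in auto)
  have "eventually (\<lambda>y. y \<in> S \<inter> T) (at x within S \<inter> T)"
    by (simp add: eventually_at_filter)
  then have "eventually (\<lambda>y. f y = g y) (at x within S \<inter> T)"
    by eventually_elim (use assms in auto)
  then show ?thesis
    unfolding eq continuous_within using assms by (simp add: filterlim_cong)
qed

lemma partials_local:
  assumes "open T" "\<And>y. y \<in> S \<inter> T \<Longrightarrow> f y = g y"
  shows "x \<in> S \<inter> T \<Longrightarrow> partials S bs f x = partials (S \<inter> T) bs g x"
proof (induction bs arbitrary: x)
  case (Cons b bs)
  show ?case
    using frechet_derivative_local[OF assms(1), of x S "partials S bs f" "partials (S \<inter> T) bs g"] Cons
    by simp
qed (use assms in auto)

lemma partials_cong:
  assumes "\<And>y. y \<in> S \<Longrightarrow> f y = g y" "x \<in> S"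
  shows "partials S bs f x = partials S bs g x"
  using partials_local[of UNIV S f g x bs] assms by simp

lemma partials_open:
  assumes "open S" "x \<in> S"
  shows "partials S bs f x = partials UNIV bs f x"
  using partials_local[of S UNIV f f x bs] assms by simp

text \<open>Allows a function given by different formulas near different points, such as an
  extension cut off to zero, to be recognised as C^k.\<close>

lemma Ck_on_local:
  assumes "\<And>x. x \<in> S \<Longrightarrow> \<exists>T g. open T \<and> x \<in> T \<and> (\<forall>y\<in>S \<inter> T. f y = g y) \<and> Ck_on k B (S \<inter> T) g"
  shows "Ck_on k B S f"
  unfolding Ck_on_def
proof (intro allI impI conjI)
  fix bs assume bs: "set bs \<subseteq> B \<and> enat (length bs) \<le> k"
  show "continuous_on S (partials S bs f)"
    unfolding continuous_on_eq_continuous_within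
  proof
    fix x assume x: "x \<in> S"
    obtain T g where T: "open T" "x \<in> T" "\<forall>y\<in>S \<inter> T. f y = g y" "Ck_on k B (S \<inter> T) g"
      using assms[OF x] by blast
    show "continuous (at x within S) (partials S bs f)"
      apply (subst continuous_local[OF T(1) x T(2), of _ "partials (S \<inter> T) bs g"])
       apply (rule partials_local) using T bs x unfolding Ck_on_def continuous_on_eq_continuous_within by auto
  qed
next
  fix bs assume bs: "set bs \<subseteq> B \<and> enat (length bs) \<le> k" "enat (length bs) < k"
  show "partials S bs f differentiable_on S"
    unfolding differentiable_on_def
  proof
    fix x assume x: "x \<in> S"
    obtain T g where T: "open T" "x \<in> T" "\<forall>y\<in>S \<inter> T. f y = g y" "Ck_on k B (S \<inter> T) g"
      using assms[OF x] by blast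
    show "partials S bs f differentiable (at x within S)"
      apply (subst differentiable_local[OF T(1) x T(2), of _ "partials (S \<inter> T) bs g"])
       apply (rule partials_local) using T bs x unfolding Ck_on_def differentiable_on_def by auto
  qed
qed

lemma Ck_on_cong:
  assumes "Ck_on k B S g" "\<And>y. y \<in> S \<Longrightarrow> f y = g y"
  shows "Ck_on k B S f"
  by (rule Ck_on_local) (use assms in \<open>auto intro!: exI[of _ UNIV] exI[of _ g]\<close>)

lemma Ck_on_Int_open:
  assumes "Ck_on k B S f" "open T"
  shows "Ck_on k B (S \<inter> T) f"
  unfolding Ck_on_def
proof (intro allI impI conjI)
  fix bs assume bs: "set bs \<subseteq> B \<and> enat (length bs) \<le> k"
  have eq: "partials S bs f x = partials (S \<inter> T) bs f x" if "x \<in> S \<inter> T" for x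
    by (rule partials_local) (use assms that in auto)
  have "continuous_on (S \<inter> T) (partials S bs f)"
    using assms bs unfolding Ck_on_def by (meson continuous_on_subset inf_le1)
  then show "continuous_on (S \<inter> T) (partials (S \<inter> T) bs f)"
    by (rule continuous_on_eq) (use eq in auto)
  assume l: "enat (length bs) < k"
  show "partials (S \<inter> T) bs f differentiable_on S \<inter> T"
    unfolding differentiable_on_def
  proof
    fix x assume x: "x \<in> S \<inter> T"
    have "partials S bs f differentiable (at x within S)"
      using assms(1) bs l x unfolding Ck_on_def differentiable_on_def by auto
    then show "partials (S \<inter> T) bs f differentiable at x within S \<inter> T"
      using differentiable_local[of T x S "partials S bs f" "partials (S \<inter> T) bs f"] eq x assms(2) by auto
  qed
qed

lemma Ck_on_open_subset:
  assumes "Ck_on k B S f" "open T" "T \<subseteq> S"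
  shows "Ck_on k B T f"
  using Ck_on_Int_open[OF assms(1,2)] assms(3) by (simp add: Int_absorb1)

lemma Ck_on_mono:
  assumes "Ck_on k B S f" "k' \<le> k" "B' \<subseteq> B"
  shows "Ck_on k' B' S f"
  unfolding Ck_on_def
proof (intro allI impI)
  fix bs assume bs: "set bs \<subseteq> B' \<and> enat (length bs) \<le> k'"
  then have "set bs \<subseteq> B \<and> enat (length bs) \<le> k" using assms by auto
  then show "continuous_on S (partials S bs f) \<and>
       (enat (length bs) < k' \<longrightarrow> partials S bs f differentiable_on S)"
    using assms(1,2) unfolding Ck_on_def by (meson order_less_le_trans)
qed

lemma Ck_on_0: "Ck_on (enat 0) B S f \<longleftrightarrow> continuous_on S f"
  by (auto simp: Ck_on_def)

text \<open>Recursive form of the definition. Most later C^k proofs are inductions along it with the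
  function left arbitrary.\<close>

lemma Ck_on_Suc:
  "Ck_on (enat (Suc n)) B S f \<longleftrightarrow>
    continuous_on S f \<and> f differentiable_on S \<and> (\<forall>b\<in>B. Ck_on (enat n) B S (pd S b f))"
    (is "?L \<longleftrightarrow> ?R")
proof
  assume L: ?L
  have "Ck_on (enat n) B S (pd S b f)" if b: "b \<in> B" for b
    unfolding Ck_on_def partials_snoc[symmetric]
    using L[unfolded Ck_on_def, rule_format, of "_ @ [b]"] b by auto
  moreover have "continuous_on S f" "f differentiable_on S"
    using L[unfolded Ck_on_def, rule_format, of "[]"] by auto
  ultimately show ?R by blast
next
  assume R: ?R
  show ?L unfolding Ck_on_def
  proof (rule allI)
    fix bs :: "'a list"
    show "set bs \<subseteq> B \<and> enat (length bs) \<le> enat (Suc n) \<longrightarrow>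
          continuous_on S (partials S bs f) \<and>
          (enat (length bs) < enat (Suc n) \<longrightarrow> partials S bs f differentiable_on S)"
    proof (cases bs rule: rev_cases)
      case Nil
      then show ?thesis using R by simp
    next
      case (snoc as b)
      show ?thesis
      proof (cases "b \<in> B")
        case True
        then have "Ck_on (enat n) B S (pd S b f)" using R by blast
        then show ?thesis
          unfolding snoc partials_snoc Ck_on_def by auto
      qed (use snoc in auto)
    qed
  qed
qed

lemma Ck_on_enat: "Ck_on k B S f \<longleftrightarrow> (\<forall>n. enat n \<le> k \<longrightarrow> Ck_on (enat n) B S f)"
proof
  assume R: "\<forall>n. enat n \<le> k \<longrightarrow> Ck_on (enat n) B S f"
  show "Ck_on k B S f"
  proof (cases k)
    case (enat n) then show ?thesis using R by auto
  next
    case infinity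
    have *: "Ck_on (enat (Suc (length bs))) B S f" for bs :: "'a list" using R infinity by simp
    show ?thesis unfolding Ck_on_def
    proof (intro allI impI)
      fix bs assume bs: "set bs \<subseteq> B \<and> enat (length bs) \<le> k"
      show "continuous_on S (partials S bs f) \<and> (enat (length bs) < k \<longrightarrow> partials S bs f differentiable_on S)"
        using *[of bs, unfolded Ck_on_def, rule_format, of bs] bs by auto
    qed
  qed
qed (auto intro: Ck_on_mono)

lemma Ck_onI: "(\<And>n. enat n \<le> k \<Longrightarrow> Ck_on (enat n) B S f) \<Longrightarrow> Ck_on k B S f"
  using Ck_on_enat by blast

lemma Ck_on_continuous: "Ck_on k B S f \<Longrightarrow> continuous_on S f"
  unfolding Ck_on_def by (elim allE[of _ "[]"]) (simp add: zero_enat_def[symmetric])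

lemma Ck_on_differentiable:
  assumes "Ck_on k B S f" "1 \<le> k" shows "f differentiable_on S"
proof -
  have "enat 0 < k" using assms(2) by (metis enat_ord_simps(2) less_one one_enat_def order_less_le_trans)
  then show ?thesis using assms(1)[unfolded Ck_on_def, rule_format, of "[]"] by simp
qed

lemma Ck_on_has_derivative:
  assumes "Ck_on k B S f" "1 \<le> k" "x \<in> S"
  shows "(f has_derivative frechet_derivative f (at x within S)) (at x within S)"
  using Ck_on_differentiable[OF assms(1,2)] assms(3)
  by (simp add: differentiable_on_def frechet_derivative_works[symmetric])

text \<open>The case in mind is a half-plane piece inside an open set, which is not relatively open.
  The rays of the smaller set still determine the directional values, so the iterated derivatives
  agree.\<close>

lemma Ck_on_restrict:
  assumes "ray_set S B" "ray_set T B" "S \<subseteq> T"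
  shows "Ck_on (enat n) B T f \<Longrightarrow> Ck_on (enat n) B S f"
    and "Ck_on (enat n) B T f \<Longrightarrow> set bs \<subseteq> B \<Longrightarrow> length bs \<le> n \<Longrightarrow> x \<in> S \<Longrightarrow>
      partials S bs f x = partials T bs f x"
proof -
  have "Ck_on (enat n) B T f \<Longrightarrow> Ck_on (enat n) B S f \<and> (\<forall>bs x. set bs \<subseteq> B \<longrightarrow> length bs \<le> n \<longrightarrow> x \<in> S \<longrightarrow>
      partials S bs f x = partials T bs f x)"
  proof (induction n arbitrary: f)
    case 0
    then show ?case using assms(3) by (auto simp: Ck_on_0 continuous_on_subset)
  next
    case (Suc n)
    then have f: "f differentiable_on T" "continuous_on T f" by (auto simp: Ck_on_Suc)
    have eq: "pd S b f x = pd T b f x" if "b \<in> B" "x \<in> S" for b x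
    proof (rule pd_eq[OF assms(1) that(2,1)])
      show "(f has_derivative frechet_derivative f (at x within T)) (at x within S)"
      proof -
        have "f differentiable (at x within T)" using f assms(3) that by (auto simp: differentiable_on_def)
        then show ?thesis
          using has_derivative_subset[OF _ assms(3)] by (simp add: frechet_derivative_works)
      qed
    qed
    have IH: "Ck_on (enat n) B S (pd T b f) \<and> (\<forall>bs x. set bs \<subseteq> B \<longrightarrow> length bs \<le> n \<longrightarrow> x \<in> S \<longrightarrow>
      partials S bs (pd T b f) x = partials T bs (pd T b f) x)" if "b \<in> B" for b
      using Suc.IH[of "pd T b f"] Suc.prems that by (auto simp: Ck_on_Suc)
    have C: "Ck_on (enat (Suc n)) B S f"
      unfolding Ck_on_Suc
    proof (intro conjI ballI)
      show "continuous_on S f" "f differentiable_on S"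
        using f assms(3) by (auto intro: continuous_on_subset differentiable_on_subset)
      fix b assume "b \<in> B"
      then show "Ck_on (enat n) B S (pd S b f)" using IH eq Ck_on_cong[of "enat n" B S "pd T b f" "pd S b f"] by blast
    qed
    have P: "partials S bs f x = partials T bs f x"
      if bs: "set bs \<subseteq> B" "length bs \<le> Suc n" "x \<in> S" for bs x
    proof (cases bs rule: rev_cases)
      case (snoc as b)
      then have "partials S as (pd S b f) x = partials S as (pd T b f) x"
        using bs eq by (intro partials_cong) auto
      then show ?thesis using snoc bs IH by (auto simp: partials_snoc)
    qed simp
    from C P show ?case by blast
  qed
  then show "Ck_on (enat n) B T f \<Longrightarrow> Ck_on (enat n) B S f"
    and "Ck_on (enat n) B T f \<Longrightarrow> set bs \<subseteq> B \<Longrightarrow> length bs \<le> n \<Longrightarrow> x \<in> S \<Longrightarrow>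
      partials S bs f x = partials T bs f x" by auto
qed

section \<open>Jets as a pointwise measure of C^n size\<close>

text \<open>One number controlling all partial derivatives up to order \<open>n\<close>. Estimates
  on it pass through inductions for products and compositions without explicit Leibniz or Faa di
  Bruno formulas.\<close>

definition jet :: "'a::euclidean_space set \<Rightarrow> 'a set \<Rightarrow> nat \<Rightarrow> ('a \<Rightarrow> 'b::real_normed_vector) \<Rightarrow> 'a \<Rightarrow> real"
  where "jet S B n f x = (\<Sum>bs\<in>{bs. set bs \<subseteq> B \<and> length bs \<le> n}. norm (partials S bs f x))"

lemma jet_nonneg: "0 \<le> jet S B n f x"
  unfolding jet_def by (rule sum_nonneg) simp

lemma partials_le_jet:
  assumes "finite B" "set bs \<subseteq> B" "length bs \<le> n"
  shows "norm (partials S bs f x) \<le> jet S B n f x"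
  unfolding jet_def
  by (rule member_le_sum[of bs _ "\<lambda>bs. norm (partials S bs f x)"]) (use assms finite_lists_length_le in auto)

lemma jet_0: "jet S B 0 f x = norm (f x)"
proof -
  have "{bs. set bs \<subseteq> B \<and> length bs \<le> 0} = {[]}" by auto
  then show ?thesis by (simp add: jet_def)
qed

text \<open>A list of directions is empty or has a last entry; splitting off the last entry matches
  the recursion \<open>Ck_on_Suc\<close>.\<close>

lemma jet_Suc:
  assumes "finite B"
  shows "jet S B (Suc n) f x = norm (f x) + (\<Sum>b\<in>B. jet S B n (pd S b f) x)"
proof -
  let ?L = "\<lambda>n. {bs. set bs \<subseteq> B \<and> length bs \<le> n}"
  have eq: "?L (Suc n) = insert [] ((\<lambda>(b,bs). bs @ [b]) ` (B \<times> ?L n))"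
  proof (intro set_eqI iffI)
    fix bs assume "bs \<in> ?L (Suc n)"
    then show "bs \<in> insert [] ((\<lambda>(b,bs). bs @ [b]) ` (B \<times> ?L n))"
      by (cases bs rule: rev_cases) (auto intro!: image_eqI[of _ _ "(_,_)"])
  qed auto
  have fin: "finite (?L n)" for n using finite_lists_length_le[OF assms] by simp
  have inj: "inj_on (\<lambda>(b,bs). bs @ [b]) (B \<times> ?L n)" by (auto simp: inj_on_def)
  have "jet S B (Suc n) f x = norm (f x) + (\<Sum>(b,bs)\<in>B \<times> ?L n. norm (partials S (bs @ [b]) f x))"
    unfolding jet_def eq
    apply (subst sum.insert)
    using fin assms apply auto[1]
     apply auto[1]
    by (subst sum.reindex[OF inj]) (simp add: case_prod_beta)
  also have "\<dots> = norm (f x) + (\<Sum>b\<in>B. jet S B n (pd S b f) x)"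
    by (simp add: jet_def partials_snoc sum.cartesian_product)
  finally show ?thesis .
qed

lemma norm_le_jet: "finite B \<Longrightarrow> norm (f x) \<le> jet S B n f x"
  using partials_le_jet[of B "[]" n S f x] by simp

lemma jet_mono_Suc:
  assumes "finite B" shows "jet S B n f x \<le> jet S B (Suc n) f x"
  unfolding jet_def
  by (rule sum_mono2) (use finite_lists_length_le[OF assms] in auto)

lemma jet_pd_le:
  assumes "finite B" "b \<in> B" shows "jet S B n (pd S b f) x \<le> jet S B (Suc n) f x"
proof -
  have "jet S B n (pd S b f) x \<le> (\<Sum>b\<in>B. jet S B n (pd S b f) x)"
    by (rule member_le_sum) (use assms jet_nonneg in auto)
  then show ?thesis using assms by (simp add: jet_Suc add_increasing)
qed

lemma jet_cong:
  assumes "\<And>y. y \<in> S \<Longrightarrow> f y = g y" "x \<in> S"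
  shows "jet S B n f x = jet S B n g x"
  unfolding jet_def using partials_cong[OF assms] by simp

lemma jet_local:
  assumes "open T" "\<And>y. y \<in> S \<inter> T \<Longrightarrow> f y = g y" "x \<in> S \<inter> T"
  shows "jet S B n f x = jet (S \<inter> T) B n g x"
  unfolding jet_def using partials_local[OF assms] by simp

lemma jet_open:
  assumes "open S" "x \<in> S"
  shows "jet S B n f x = jet UNIV B n f x"
  unfolding jet_def using partials_open[OF assms] by (intro sum.cong refl arg_cong[of _ _ norm]) blast

lemma Ck_on_enatD: "Ck_on k B S f \<Longrightarrow> enat n \<le> k \<Longrightarrow> Ck_on (enat n) B S f"
  by (erule Ck_on_mono) auto

lemma Ck_on_SucD: "Ck_on (enat (Suc n)) B S f \<Longrightarrow> Ck_on (enat n) B S f"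
  by (erule Ck_on_mono) auto

lemma Ck_on_pdD: "Ck_on (enat (Suc n)) B S f \<Longrightarrow> b \<in> B \<Longrightarrow> Ck_on (enat n) B S (pd S b f)"
  by (simp add: Ck_on_Suc)

lemma has_derivative_frechet_within:
  "f differentiable_on S \<Longrightarrow> x \<in> S \<Longrightarrow> (f has_derivative frechet_derivative f (at x within S)) (at x within S)"
  by (simp add: differentiable_on_def frechet_derivative_works[symmetric])

section \<open>C^k under linear, bilinear and composed operations, with jet bounds\<close>

lemma Ck_on_bounded_linear_aux:
  fixes h :: "'b::real_normed_vector \<Rightarrow> 'c::real_normed_vector"
  assumes h: "bounded_linear h" and S: "ray_set S B"
  shows "Ck_on (enat n) B S f \<Longrightarrow> Ck_on (enat n) B S (\<lambda>x. h (f x)) \<and>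
    (\<forall>bs x. set bs \<subseteq> B \<longrightarrow> length bs \<le> n \<longrightarrow> x \<in> S \<longrightarrow>
      partials S bs (\<lambda>x. h (f x)) x = h (partials S bs f x))"
proof (induction n arbitrary: f)
  case 0
  then show ?case by (auto simp: Ck_on_0 intro!: continuous_intros bounded_linear.continuous_on[OF h])
next
  case (Suc n)
  then have f: "f differentiable_on S" "continuous_on S f" by (auto simp: Ck_on_Suc)
  have D: "((\<lambda>x. h (f x)) has_derivative (\<lambda>v. h (frechet_derivative f (at x within S) v))) (at x within S)"
    if "x \<in> S" for x
    using bounded_linear.has_derivative[OF h has_derivative_frechet_within[OF f(1) that]] .
  have eq: "pd S b (\<lambda>x. h (f x)) x = h (pd S b f x)" if "b \<in> B" "x \<in> S" for b x
    by (rule pd_eq[OF S that(2,1) D[OF that(2)]])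
  have IH: "Ck_on (enat n) B S (\<lambda>x. h (pd S b f x)) \<and>
    (\<forall>bs x. set bs \<subseteq> B \<longrightarrow> length bs \<le> n \<longrightarrow> x \<in> S \<longrightarrow>
      partials S bs (\<lambda>x. h (pd S b f x)) x = h (partials S bs (pd S b f) x))" if "b \<in> B" for b
    using Suc.IH[of "pd S b f"] Suc.prems that by (auto simp: Ck_on_Suc)
  have C: "Ck_on (enat (Suc n)) B S (\<lambda>x. h (f x))"
    unfolding Ck_on_Suc
  proof (intro conjI ballI)
    show "continuous_on S (\<lambda>x. h (f x))"
      using f by (intro bounded_linear.continuous_on[OF h])
    show "(\<lambda>x. h (f x)) differentiable_on S"
      unfolding differentiable_on_def using D differentiableI by blast
    fix b assume b: "b \<in> B"
    show "Ck_on (enat n) B S (pd S b (\<lambda>x. h (f x)))"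
      using Ck_on_cong[of "enat n" B S "\<lambda>x. h (pd S b f x)" "pd S b (\<lambda>x. h (f x))"] IH[OF b] eq[OF b] by blast
  qed
  have P: "partials S bs (\<lambda>x. h (f x)) x = h (partials S bs f x)"
    if bs: "set bs \<subseteq> B" "length bs \<le> Suc n" "x \<in> S" for bs x
  proof (cases bs rule: rev_cases)
    case (snoc as b)
    then have "partials S as (pd S b (\<lambda>x. h (f x))) x = partials S as (\<lambda>x. h (pd S b f x)) x"
      using bs eq by (intro partials_cong) auto
    then show ?thesis using snoc bs IH by (auto simp: partials_snoc)
  qed simp
  from C P show ?case by blast
qed

lemma Ck_on_bounded_linear:
  assumes "bounded_linear h" "ray_set S B" "Ck_on k B S f"
  shows "Ck_on k B S (\<lambda>x. h (f x))"
  by (rule Ck_onI) (rule Ck_on_bounded_linear_aux[OF assms(1,2) Ck_on_enatD[OF assms(3)], THEN conjunct1])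

lemma partials_bounded_linear:
  assumes "bounded_linear h" "ray_set S B" "Ck_on (enat n) B S f" "set bs \<subseteq> B" "length bs \<le> n" "x \<in> S"
  shows "partials S bs (\<lambda>x. h (f x)) x = h (partials S bs f x)"
  using Ck_on_bounded_linear_aux[OF assms(1-3), THEN conjunct2, rule_format, OF assms(4-6)] .

lemma Ck_on_add_aux:
  fixes f g :: "'a::euclidean_space \<Rightarrow> 'c::real_normed_vector"
  assumes S: "ray_set S B"
  shows "Ck_on (enat n) B S f \<Longrightarrow> Ck_on (enat n) B S g \<Longrightarrow> Ck_on (enat n) B S (\<lambda>x. f x + g x) \<and>
    (\<forall>bs x. set bs \<subseteq> B \<longrightarrow> length bs \<le> n \<longrightarrow> x \<in> S \<longrightarrow>
      partials S bs (\<lambda>x. f x + g x) x = partials S bs f x + partials S bs g x)"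
proof (induction n arbitrary: f g)
  case 0
  then show ?case by (auto simp: Ck_on_0 intro!: continuous_intros)
next
  case (Suc n)
  then have f: "f differentiable_on S" "continuous_on S f" "g differentiable_on S" "continuous_on S g"
    by (auto simp: Ck_on_Suc)
  have D: "((\<lambda>x. f x + g x) has_derivative (\<lambda>v. frechet_derivative f (at x within S) v + frechet_derivative g (at x within S) v)) (at x within S)"
    if "x \<in> S" for x
    using has_derivative_add[OF has_derivative_frechet_within[OF f(1) that] has_derivative_frechet_within[OF f(3) that]] .
  have eq: "pd S b (\<lambda>x. f x + g x) x = pd S b f x + pd S b g x" if "b \<in> B" "x \<in> S" for b x
    by (rule pd_eq[OF S that(2,1) D[OF that(2)]])
  have IH: "Ck_on (enat n) B S (\<lambda>x. pd S b f x + pd S b g x) \<and>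
    (\<forall>bs x. set bs \<subseteq> B \<longrightarrow> length bs \<le> n \<longrightarrow> x \<in> S \<longrightarrow>
      partials S bs (\<lambda>x. pd S b f x + pd S b g x) x = partials S bs (pd S b f) x + partials S bs (pd S b g) x)" if "b \<in> B" for b
    using Suc.IH[of "pd S b f" "pd S b g"] Suc.prems that by (auto simp: Ck_on_Suc)
  have C: "Ck_on (enat (Suc n)) B S (\<lambda>x. f x + g x)"
    unfolding Ck_on_Suc
  proof (intro conjI ballI)
    show "continuous_on S (\<lambda>x. f x + g x)"
      using f by (intro continuous_intros)
    show "(\<lambda>x. f x + g x) differentiable_on S"
      using f by (intro differentiable_on_add)
    fix b assume b: "b \<in> B"
    show "Ck_on (enat n) B S (pd S b (\<lambda>x. f x + g x))"
      using Ck_on_cong[of "enat n" B S "\<lambda>x. pd S b f x + pd S b g x" "pd S b (\<lambda>x. f x + g x)"] IH[OF b] eq[OF b] by blast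
  qed
  have P: "partials S bs (\<lambda>x. f x + g x) x = partials S bs f x + partials S bs g x"
    if bs: "set bs \<subseteq> B" "length bs \<le> Suc n" "x \<in> S" for bs x
  proof (cases bs rule: rev_cases)
    case (snoc as b)
    then have "partials S as (pd S b (\<lambda>x. f x + g x)) x = partials S as (\<lambda>x. pd S b f x + pd S b g x) x"
      using bs eq by (intro partials_cong) auto
    then show ?thesis using snoc bs IH by (auto simp: partials_snoc)
  qed simp
  from C P show ?case by blast
qed

lemma Ck_on_add:
  assumes "ray_set S B" "Ck_on k B S f" "Ck_on k B S g"
  shows "Ck_on k B S (\<lambda>x. f x + g x)"
  by (rule Ck_onI) (rule Ck_on_add_aux[OF assms(1) Ck_on_enatD[OF assms(2)] Ck_on_enatD[OF assms(3)], THEN conjunct1])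

lemma partials_add:
  assumes "ray_set S B" "Ck_on (enat n) B S f" "Ck_on (enat n) B S g" "set bs \<subseteq> B" "length bs \<le> n" "x \<in> S"
  shows "partials S bs (\<lambda>x. f x + g x) x = partials S bs f x + partials S bs g x"
  using Ck_on_add_aux[OF assms(1-3), THEN conjunct2, rule_format, OF assms(4-6)] .

lemma Ck_on_const: "ray_set S B \<Longrightarrow> Ck_on k B S (\<lambda>x. c)"
proof (rule Ck_onI)
  fix n assume S: "ray_set S B"
  show "Ck_on (enat n) B S (\<lambda>x. c)"
  proof (induction n arbitrary: c)
    case (Suc n)
    have eq: "pd S b (\<lambda>x. c) x = 0" if "b \<in> B" "x \<in> S" for b x
      using pd_eq[OF S that(2,1) has_derivative_const] .
    show ?case unfolding Ck_on_Suc
    proof (intro conjI ballI)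
      fix b assume b: "b \<in> B"
      show "Ck_on (enat n) B S (pd S b (\<lambda>x. c))"
        by (rule Ck_on_cong[OF Suc.IH[of 0]]) (use eq b in auto)
    qed auto
  qed (simp add: Ck_on_0)
qed

lemma partials_zero:
  assumes "ray_set S B" "set bs \<subseteq> B" "x \<in> S"
  shows "partials S bs (\<lambda>x. 0) x = 0"
  using partials_bounded_linear[OF bounded_linear_zero assms(1) Ck_on_const[OF assms(1), of "enat (length bs)" 0] assms(2) _ assms(3)]
  by simp

lemma Ck_on_scaleR_const: "ray_set S B \<Longrightarrow> Ck_on k B S f \<Longrightarrow> Ck_on k B S (\<lambda>x. a *\<^sub>R f x)"
  by (rule Ck_on_bounded_linear[OF bounded_linear_scaleR_right])

lemma Ck_on_lincomb:
  "ray_set S B \<Longrightarrow> Ck_on k B S f \<Longrightarrow> Ck_on k B S g \<Longrightarrow> Ck_on k B S (\<lambda>x. a *\<^sub>R f x + b *\<^sub>R g x)"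
  by (intro Ck_on_add Ck_on_scaleR_const)

lemma Ck_on_diff:
  "ray_set S B \<Longrightarrow> Ck_on k B S f \<Longrightarrow> Ck_on k B S g \<Longrightarrow> Ck_on k B S (\<lambda>x. f x - g x)"
  using Ck_on_lincomb[of S B k f g 1 "-1"] by simp

lemma partials_lincomb:
  assumes "ray_set S B" "Ck_on (enat n) B S f" "Ck_on (enat n) B S g" "set bs \<subseteq> B" "length bs \<le> n" "x \<in> S"
  shows "partials S bs (\<lambda>x. a *\<^sub>R f x + b *\<^sub>R g x) x = a *\<^sub>R partials S bs f x + b *\<^sub>R partials S bs g x"
  using partials_add[OF assms(1) Ck_on_scaleR_const Ck_on_scaleR_const, of n f g bs x a b]
    partials_bounded_linear[OF bounded_linear_scaleR_right assms(1,2,4,5,6), of a]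
    partials_bounded_linear[OF bounded_linear_scaleR_right assms(1,3,4,5,6), of b] assms
  by auto

lemma Ck_on_sum:
  assumes "ray_set S B" "\<And>i. i \<in> I \<Longrightarrow> Ck_on k B S (f i)"
  shows "Ck_on k B S (\<lambda>x. \<Sum>i\<in>I. f i x)"
  using assms(2)
proof (induction I rule: infinite_finite_induct)
  case (insert i I)
  then show ?case using Ck_on_add[OF assms(1), of k "f i" "\<lambda>x. \<Sum>i\<in>I. f i x"] by simp
qed (auto intro: Ck_on_const[OF assms(1)])

lemma jet_add_le:
  assumes "finite B" "ray_set S B" "Ck_on (enat n) B S f" "Ck_on (enat n) B S g" "x \<in> S"
  shows "jet S B n (\<lambda>x. f x + g x) x \<le> jet S B n f x + jet S B n g x"
  unfolding jet_def sum.distrib[symmetric]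
  by (rule sum_mono) (simp add: partials_add[OF assms(2-4) _ _ assms(5)] norm_triangle_ineq)

lemma jet_zero:
  assumes "ray_set S B" "x \<in> S"
  shows "jet S B n (\<lambda>x. 0) x = 0"
  unfolding jet_def by (intro sum.neutral) (simp add: partials_zero[OF assms(1) _ assms(2)])

lemma jet_sum_le:
  assumes "finite B" "ray_set S B" "\<And>i. i \<in> I \<Longrightarrow> Ck_on (enat n) B S (f i)" "x \<in> S"
  shows "jet S B n (\<lambda>x. \<Sum>i\<in>I. f i x) x \<le> (\<Sum>i\<in>I. jet S B n (f i) x)"
  using assms(3)
proof (induction I rule: infinite_finite_induct)
  case (insert i I)
  have "jet S B n (\<lambda>x. f i x + (\<Sum>i\<in>I. f i x)) x \<le> jet S B n (f i) x + jet S B n (\<lambda>x. \<Sum>i\<in>I. f i x) x"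
    using insert assms by (intro jet_add_le Ck_on_sum) auto
  also have "\<dots> \<le> jet S B n (f i) x + (\<Sum>i\<in>I. jet S B n (f i) x)" using insert by simp
  finally show ?case using insert by simp
qed (simp_all add: jet_zero[OF assms(2,4)])

lemma Ck_on_bilinear:
  assumes pr: "bounded_bilinear pr" and S: "ray_set S B" "Ck_on k B S f" "Ck_on k B S g"
  shows "Ck_on k B S (\<lambda>x. pr (f x) (g x))"
proof (rule Ck_onI)
  interpret bounded_bilinear pr by fact
  fix n assume "enat n \<le> k"
  then have "Ck_on (enat n) B S f" "Ck_on (enat n) B S g" using S Ck_on_enatD by blast+
  then show "Ck_on (enat n) B S (\<lambda>x. pr (f x) (g x))"
  proof (induction n arbitrary: f g)
    case 0
    then show ?case by (auto simp: Ck_on_0 intro!: continuous_on)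
  next
    case (Suc n)
    then have f: "f differentiable_on S" "continuous_on S f" "g differentiable_on S" "continuous_on S g"
      by (auto simp: Ck_on_Suc)
    have D: "((\<lambda>x. pr (f x) (g x)) has_derivative (\<lambda>v. pr (f x) (frechet_derivative g (at x within S) v) + pr (frechet_derivative f (at x within S) v) (g x))) (at x within S)"
      if "x \<in> S" for x
      using FDERIV[OF has_derivative_frechet_within[OF f(1) that] has_derivative_frechet_within[OF f(3) that]] .
    have fn: "Ck_on (enat n) B S f" "Ck_on (enat n) B S g" using Suc.prems by (auto intro: Ck_on_mono)
    show ?case
      unfolding Ck_on_Suc
    proof (intro conjI ballI)
      show "continuous_on S (\<lambda>x. pr (f x) (g x))"
        using f by (intro continuous_on)
      show "(\<lambda>x. pr (f x) (g x)) differentiable_on S"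
        unfolding differentiable_on_def using D differentiableI by blast
      fix b assume b: "b \<in> B"
      have "Ck_on (enat n) B S (\<lambda>x. pr (f x) (pd S b g x) + pr (pd S b f x) (g x))"
        using Suc.prems b fn by (intro Ck_on_add[OF S(1)] Suc.IH) (auto simp: Ck_on_Suc)
      then show "Ck_on (enat n) B S (pd S b (\<lambda>x. pr (f x) (g x)))"
        by (rule Ck_on_cong) (use pd_eq[OF S(1) _ b D] in auto)
    qed
  qed
qed

text \<open>The constant depends on \<open>g\<close> and \<open>K\<close> only: derivatives of
  \<open>g\<close> are bounded on the compact \<open>K\<close>, and each derivative of the product
  falls on one factor. This is continuity of multiplication by a fixed C^n function.\<close>

lemma jet_bilinear_le:
  fixes pr :: "'b::real_normed_vector \<Rightarrow> 'c::real_normed_vector \<Rightarrow> 'd::real_normed_vector"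
    and g :: "'a::euclidean_space \<Rightarrow> 'c"
  assumes pr: "bounded_bilinear pr" and S: "ray_set S B" "finite B" "Ck_on (enat n) B S g"
    and K: "compact K" "K \<subseteq> S"
  shows "\<exists>C\<ge>0. \<forall>f. Ck_on (enat n) B S f \<longrightarrow>
    (\<forall>x\<in>K. jet S B n (\<lambda>x. pr (f x) (g x)) x \<le> C * jet S B n f x)"
proof -
  interpret bounded_bilinear pr by fact
  obtain A where A: "A \<ge> 0" "\<And>a b. norm (pr a b) \<le> norm a * norm b * A"
    using nonneg_bounded by blast
  have bd: "\<exists>G\<ge>0. \<forall>f. \<forall>x\<in>K. norm (pr (f x) (g x)) \<le> G * norm (f x)"
    if "continuous_on S g" for g
  proof -
    have "compact (g ` K)" using that K by (meson compact_continuous_image continuous_on_subset)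
    then have "bounded (g ` K)" by (rule compact_imp_bounded)
    then obtain G where G: "G > 0" "\<forall>x\<in>K. norm (g x) \<le> G" by (auto simp: bounded_pos)
    show ?thesis
    proof (intro exI[of _ "G * A"] conjI allI ballI)
      fix f x assume x: "x \<in> K"
      have "norm (pr (f x) (g x)) \<le> norm (f x) * norm (g x) * A" by (rule A)
      also have "\<dots> \<le> norm (f x) * G * A" using x G A by (intro mult_right_mono mult_left_mono) auto
      finally show "norm (pr (f x) (g x)) \<le> G * A * norm (f x)" by (simp add: algebra_simps)
    qed (use G A in auto)
  qed
  show ?thesis using S(3)
  proof (induction n arbitrary: g)
    case 0
    then show ?case using bd[of g] by (auto simp: Ck_on_0 jet_0)
  next
    case (Suc n)
    have g: "continuous_on S g" "g differentiable_on S" using Suc.prems by (auto simp: Ck_on_Suc)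
    have gn: "Ck_on (enat n) B S g" "\<And>b. b \<in> B \<Longrightarrow> Ck_on (enat n) B S (pd S b g)"
      using Suc.prems by (simp_all add: Ck_on_SucD Ck_on_pdD)
    obtain G where G: "G \<ge> 0" "\<And>f::'a \<Rightarrow> 'b. \<And>x. x \<in> K \<Longrightarrow> norm (pr (f x) (g x)) \<le> G * norm (f x)"
      using bd[OF g(1)] by blast
    obtain C1 where C1: "C1 \<ge> 0" "\<And>f x. Ck_on (enat n) B S f \<Longrightarrow> x \<in> K \<Longrightarrow> jet S B n (\<lambda>x. pr (f x) (g x)) x \<le> C1 * jet S B n f x"
      using Suc.IH[OF gn(1)] by blast
    have "\<forall>b\<in>B. \<exists>C\<ge>0. \<forall>f. Ck_on (enat n) B S f \<longrightarrow>
      (\<forall>x\<in>K. jet S B n (\<lambda>x. pr (f x) (pd S b g x)) x \<le> C * jet S B n f x)"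
      using Suc.IH[OF gn(2)] by blast
    then obtain C2 where C2: "\<And>b. b \<in> B \<Longrightarrow> C2 b \<ge> 0"
      "\<And>b f x. b \<in> B \<Longrightarrow> Ck_on (enat n) B S f \<Longrightarrow> x \<in> K \<Longrightarrow> jet S B n (\<lambda>x. pr (f x) (pd S b g x)) x \<le> C2 b * jet S B n f x"
      by metis
    show ?case
    \<comment> \<open>\<open>G\<close> bounds the undifferentiated product, \<open>C2 b\<close> and
      \<open>C1\<close> the two Leibniz terms of the derivative along \<open>b\<close>.\<close>
    proof (intro exI[of _ "G + (\<Sum>b\<in>B. C2 b + C1)"] conjI allI impI ballI)
      show "0 \<le> G + (\<Sum>b\<in>B. C2 b + C1)" using G C1 C2 by (intro add_nonneg_nonneg sum_nonneg) auto
      fix f :: "'a \<Rightarrow> 'b" and x assume fC: "Ck_on (enat (Suc n)) B S f" and x: "x \<in> K"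
      then have xS: "x \<in> S" using K by auto
      have f: "f differentiable_on S" "continuous_on S f" using fC by (auto simp: Ck_on_Suc)
      have fn: "Ck_on (enat n) B S f" "\<And>b. b \<in> B \<Longrightarrow> Ck_on (enat n) B S (pd S b f)"
        using fC by (simp_all add: Ck_on_SucD Ck_on_pdD)
      have D: "((\<lambda>x. pr (f x) (g x)) has_derivative (\<lambda>v. pr (f x) (frechet_derivative g (at x within S) v) + pr (frechet_derivative f (at x within S) v) (g x))) (at x within S)"
        if "x \<in> S" for x
        using FDERIV[OF has_derivative_frechet_within[OF f(1) that] has_derivative_frechet_within[OF g(2) that]] .
      have b1: "jet S B n (pd S b (\<lambda>x. pr (f x) (g x))) x \<le> (C2 b + C1) * jet S B (Suc n) f x"
        if b: "b \<in> B" for b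
      proof -
        have "jet S B n (pd S b (\<lambda>x. pr (f x) (g x))) x =
            jet S B n (\<lambda>x. pr (f x) (pd S b g x) + pr (pd S b f x) (g x)) x"
          by (rule jet_cong[OF _ xS]) (use pd_eq[OF S(1) _ b D] in auto)
        also have "\<dots> \<le> jet S B n (\<lambda>x. pr (f x) (pd S b g x)) x + jet S B n (\<lambda>x. pr (pd S b f x) (g x)) x"
          using S b gn fn xS by (intro jet_add_le Ck_on_bilinear[OF pr]) auto
        also have "\<dots> \<le> C2 b * jet S B n f x + C1 * jet S B n (pd S b f) x"
          using b x fn by (intro add_mono C1 C2) auto
        also have "\<dots> \<le> C2 b * jet S B (Suc n) f x + C1 * jet S B (Suc n) f x"
          using C1 C2[OF b] b S by (intro add_mono mult_left_mono jet_mono_Suc jet_pd_le) auto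
        finally show ?thesis by (simp add: algebra_simps)
      qed
      have "jet S B (Suc n) (\<lambda>x. pr (f x) (g x)) x = norm (pr (f x) (g x)) + (\<Sum>b\<in>B. jet S B n (pd S b (\<lambda>x. pr (f x) (g x))) x)"
        by (rule jet_Suc[OF S(2)])
      also have "\<dots> \<le> G * jet S B (Suc n) f x + (\<Sum>b\<in>B. (C2 b + C1) * jet S B (Suc n) f x)"
      proof (intro add_mono sum_mono b1)
        have "norm (pr (f x) (g x)) \<le> G * norm (f x)" using G x by blast
        also have "\<dots> \<le> G * jet S B (Suc n) f x" using G S by (intro mult_left_mono norm_le_jet) auto
        finally show "norm (pr (f x) (g x)) \<le> G * jet S B (Suc n) f x" .
      qed
      finally show "jet S B (Suc n) (\<lambda>x. pr (f x) (g x)) x \<le> (G + (\<Sum>b\<in>B. C2 b + C1)) * jet S B (Suc n) f x"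
        by (simp add: sum_distrib_right distrib_right)
    qed
  qed
qed

text \<open>\<open>F\<close> lives on an open set, so its full derivative is determined and may be
  expanded in the basis; only the inner map is differentiated relative to the thin set
  \<open>S\<close>.\<close>

lemma pd_compose:
  fixes F :: "'b::euclidean_space \<Rightarrow> 'c::real_normed_vector" and \<phi> :: "'a::euclidean_space \<Rightarrow> 'b"
  assumes S: "ray_set S B" "x \<in> S" "b \<in> B" and "open T" "\<phi> ` S \<subseteq> T"
    and "\<phi> differentiable_on S" "F differentiable_on T"
  shows "((\<lambda>x. F (\<phi> x)) has_derivative (\<lambda>v. frechet_derivative F (at (\<phi> x)) (frechet_derivative \<phi> (at x within S) v))) (at x within S)"
    and "pd S b (\<lambda>x. F (\<phi> x)) x = (\<Sum>i\<in>Basis. (pd S b \<phi> x \<bullet> i) *\<^sub>R pd T i F (\<phi> x))"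
proof -
  have "\<phi> x \<in> T" using assms by auto
  then have F: "(F has_derivative frechet_derivative F (at (\<phi> x))) (at (\<phi> x))"
    using has_derivative_frechet_within[OF assms(7), of "\<phi> x"] at_within_open[OF _ assms(4)] by metis
  show D: "((\<lambda>x. F (\<phi> x)) has_derivative (\<lambda>v. frechet_derivative F (at (\<phi> x)) (frechet_derivative \<phi> (at x within S) v))) (at x within S)"
    using has_derivative_compose[OF has_derivative_frechet_within[OF assms(6) S(2)] F] .
  have "pd S b (\<lambda>x. F (\<phi> x)) x = frechet_derivative F (at (\<phi> x)) (pd S b \<phi> x)"
    by (rule pd_eq[OF S D])
  also have "\<dots> = frechet_derivative F (at (\<phi> x)) (\<Sum>i\<in>Basis. (pd S b \<phi> x \<bullet> i) *\<^sub>R i)"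
    by (simp add: euclidean_representation)
  also have "\<dots> = (\<Sum>i\<in>Basis. (pd S b \<phi> x \<bullet> i) *\<^sub>R frechet_derivative F (at (\<phi> x)) i)"
    using has_derivative_linear[OF F] by (simp add: linear_sum linear_cmul)
  finally show "pd S b (\<lambda>x. F (\<phi> x)) x = (\<Sum>i\<in>Basis. (pd S b \<phi> x \<bullet> i) *\<^sub>R pd T i F (\<phi> x))"
    using at_within_open[OF \<open>\<phi> x \<in> T\<close> assms(4)] by simp
qed

lemma Ck_on_compose:
  fixes F :: "'b::euclidean_space \<Rightarrow> 'c::real_normed_vector" and \<phi> :: "'a::euclidean_space \<Rightarrow> 'b"
  assumes S: "ray_set S B" and T: "open T" "\<phi> ` S \<subseteq> T"
    and "Ck_on k B S \<phi>" "Ck_on k Basis T F"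
  shows "Ck_on k B S (\<lambda>x. F (\<phi> x))"
proof (rule Ck_onI)
  fix n assume "enat n \<le> k"
  then have "Ck_on (enat n) B S \<phi>" "Ck_on (enat n) Basis T F" using assms Ck_on_enatD by blast+
  then show "Ck_on (enat n) B S (\<lambda>x. F (\<phi> x))"
  proof (induction n arbitrary: F)
    case 0
    then show ?case using T by (auto simp: Ck_on_0 intro: continuous_on_compose2)
  next
    case (Suc n)
    then have f: "\<phi> differentiable_on S" "continuous_on S \<phi>" "F differentiable_on T" "continuous_on T F"
      by (auto simp: Ck_on_Suc)
    have fn: "Ck_on (enat n) B S \<phi>" "Ck_on (enat n) Basis T F" using Suc.prems by (auto intro: Ck_on_mono)
    show ?case
      unfolding Ck_on_Suc
    proof (intro conjI ballI)
      show "continuous_on S (\<lambda>x. F (\<phi> x))"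
        using f T by (auto intro: continuous_on_compose2)
      have D: "((\<lambda>x. F (\<phi> x)) has_derivative (\<lambda>v. frechet_derivative F (at (\<phi> x)) (frechet_derivative \<phi> (at x within S) v))) (at x within S)" if "x \<in> S" for x
      proof -
        have "\<phi> x \<in> T" using that T by auto
        then have F: "(F has_derivative frechet_derivative F (at (\<phi> x))) (at (\<phi> x))"
          using has_derivative_frechet_within[OF f(3), of "\<phi> x"] at_within_open[OF _ T(1)] by metis
        show ?thesis
          using has_derivative_compose[OF has_derivative_frechet_within[OF f(1) that] F] .
      qed
      then show "(\<lambda>x. F (\<phi> x)) differentiable_on S"
        unfolding differentiable_on_def using differentiableI by blast
      fix b assume b: "b \<in> B"
      have "Ck_on (enat n) B S (\<lambda>x. \<Sum>i\<in>Basis. (pd S b \<phi> x \<bullet> i) *\<^sub>R pd T i F (\<phi> x))"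
        using Suc.prems b fn
        by (intro Ck_on_sum[OF S] Ck_on_bilinear[OF bounded_bilinear_scaleR S] Suc.IH
            Ck_on_bounded_linear[OF bounded_linear_inner_left S]) (auto simp: Ck_on_Suc)
      then show "Ck_on (enat n) B S (pd S b (\<lambda>x. F (\<phi> x)))"
        by (rule Ck_on_cong) (use pd_compose(2)[OF S _ b T f(1,3)] in auto)
    qed
  qed
qed

text \<open>The constant is uniform in \<open>F\<close>: it collects bounds on the compact
  \<open>K\<close> for derivatives of \<open>\<phi>\<close>, which enter the chain rule as scalar
  coefficients.\<close>

lemma jet_compose_le:
  fixes \<phi> :: "'a::euclidean_space \<Rightarrow> 'b::euclidean_space"
  assumes S: "ray_set S B" "finite B" and T: "open T" "\<phi> ` S \<subseteq> T" and "Ck_on (enat n) B S \<phi>"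
    and K: "compact K" "K \<subseteq> S"
  shows "\<exists>C\<ge>0. \<forall>F::'b \<Rightarrow> 'c::real_normed_vector. Ck_on (enat n) Basis T F \<longrightarrow>
    (\<forall>x\<in>K. jet S B n (\<lambda>x. F (\<phi> x)) x \<le> C * jet T Basis n F (\<phi> x))"
  using assms(5)
proof (induction n)
  case 0
  then show ?case by (intro exI[of _ 1]) (simp add: jet_0)
next
  case (Suc n)
  then have p: "\<phi> differentiable_on S" by (auto simp: Ck_on_Suc)
  have pn: "Ck_on (enat n) B S \<phi>" "\<And>b. b \<in> B \<Longrightarrow> Ck_on (enat n) B S (pd S b \<phi>)"
    using Suc.prems by (simp_all add: Ck_on_SucD Ck_on_pdD)
  obtain C1 where C1: "C1 \<ge> 0" "\<And>F::'b \<Rightarrow> 'c. \<And>x. Ck_on (enat n) Basis T F \<Longrightarrow> x \<in> K \<Longrightarrow> jet S B n (\<lambda>x. F (\<phi> x)) x \<le> C1 * jet T Basis n F (\<phi> x)"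
    using Suc.IH[OF pn(1)] by blast
  define P where "P = (\<lambda>b i C. C \<ge> 0 \<and> (\<forall>f::'a \<Rightarrow> 'c. Ck_on (enat n) B S f \<longrightarrow>
      (\<forall>x\<in>K. jet S B n (\<lambda>x. (pd S b \<phi> x \<bullet> i) *\<^sub>R f x) x \<le> C * jet S B n f x)))"
  define C2 where "C2 = (\<lambda>b i. SOME C. P b i C)"
  have "P b i (C2 b i)" if b: "b \<in> B" for b i
  proof -
    have "\<exists>C\<ge>0. \<forall>f::'a \<Rightarrow> 'c. Ck_on (enat n) B S f \<longrightarrow>
      (\<forall>x\<in>K. jet S B n (\<lambda>x. (pd S b \<phi> x \<bullet> i) *\<^sub>R f x) x \<le> C * jet S B n f x)"
      by (rule jet_bilinear_le[OF bounded_bilinear.flip[OF bounded_bilinear_scaleR] S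
        Ck_on_bounded_linear[OF bounded_linear_inner_left S(1) pn(2)[OF b]] K])
    then show ?thesis unfolding C2_def P_def by (rule someI_ex)
  qed
  then have C2: "\<And>b i. b \<in> B \<Longrightarrow> C2 b i \<ge> 0"
      "\<And>b i x. \<And>f::'a \<Rightarrow> 'c. b \<in> B \<Longrightarrow> Ck_on (enat n) B S f \<Longrightarrow> x \<in> K \<Longrightarrow> jet S B n (\<lambda>x. (pd S b \<phi> x \<bullet> i) *\<^sub>R f x) x \<le> C2 b i * jet S B n f x"
    unfolding P_def by blast+
  \<comment> \<open>The leading 1 accounts for the value of \<open>F\<close> itself, the double sum
    for the terms of the chain rule.\<close>
  define C where "C = 1 + (\<Sum>b\<in>B. \<Sum>i\<in>Basis. C2 b i * C1)"
  show ?case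
  proof (intro exI[of _ C] conjI allI impI ballI)
    show "0 \<le> C" unfolding C_def using C1 C2 by (intro add_nonneg_nonneg sum_nonneg) auto
    fix F :: "'b \<Rightarrow> 'c" and x assume F: "Ck_on (enat (Suc n)) Basis T F" and x: "x \<in> K"
    then have xS: "x \<in> S" using K by auto
    have f: "F differentiable_on T" using F by (auto simp: Ck_on_Suc)
    have Fn: "Ck_on (enat n) Basis T F" "\<And>b. b \<in> Basis \<Longrightarrow> Ck_on (enat n) Basis T (pd T b F)"
        using F by (simp_all add: Ck_on_SucD Ck_on_pdD)
    let ?J = "jet T Basis (Suc n) F (\<phi> x)"
    have b1: "jet S B n (pd S b (\<lambda>x. F (\<phi> x))) x \<le> (\<Sum>i\<in>Basis. C2 b i * C1) * ?J" if b: "b \<in> B" for b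
    proof -
      have q: "Ck_on (enat n) B S (\<lambda>x. pd T i F (\<phi> x))" if "i \<in> Basis" for i
        by (rule Ck_on_compose[OF S(1) T pn(1) Fn(2)[OF that]])
      have "jet S B n (pd S b (\<lambda>x. F (\<phi> x))) x = jet S B n (\<lambda>x. \<Sum>i\<in>Basis. (pd S b \<phi> x \<bullet> i) *\<^sub>R pd T i F (\<phi> x)) x"
        by (rule jet_cong[OF _ xS]) (use pd_compose(2)[OF S(1) _ b T p f] in auto)
      also have "\<dots> \<le> (\<Sum>i\<in>Basis. jet S B n (\<lambda>x. (pd S b \<phi> x \<bullet> i) *\<^sub>R pd T i F (\<phi> x)) x)"
        by (rule jet_sum_le[OF S(2,1) Ck_on_bilinear[OF bounded_bilinear_scaleR S(1)
            Ck_on_bounded_linear[OF bounded_linear_inner_left S(1) pn(2)[OF b]] q] xS])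
      also have "\<dots> \<le> (\<Sum>i\<in>Basis. C2 b i * (C1 * ?J))"
      proof (rule sum_mono)
        fix i :: 'b assume i: "i \<in> Basis"
        have "jet S B n (\<lambda>x. (pd S b \<phi> x \<bullet> i) *\<^sub>R pd T i F (\<phi> x)) x \<le> C2 b i * jet S B n (\<lambda>x. pd T i F (\<phi> x)) x"
          by (rule C2(2)[OF b q[OF i] x])
        also have "jet S B n (\<lambda>x. pd T i F (\<phi> x)) x \<le> C1 * jet T Basis n (pd T i F) (\<phi> x)"
          using C1(2)[OF Fn(2)[OF i] x] .
        also have "\<dots> \<le> C1 * ?J" using C1 i by (intro mult_left_mono jet_pd_le) auto
        finally show "jet S B n (\<lambda>x. (pd S b \<phi> x \<bullet> i) *\<^sub>R pd T i F (\<phi> x)) x \<le> C2 b i * (C1 * ?J)"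
          using C2(1)[OF b] by (simp add: mult_left_mono)
      qed
      finally show ?thesis by (simp add: sum_distrib_right mult.assoc)
    qed
    have "jet S B (Suc n) (\<lambda>x. F (\<phi> x)) x = norm (F (\<phi> x)) + (\<Sum>b\<in>B. jet S B n (pd S b (\<lambda>x. F (\<phi> x))) x)"
      by (rule jet_Suc[OF S(2)])
    also have "\<dots> \<le> ?J + (\<Sum>b\<in>B. (\<Sum>i\<in>Basis. C2 b i * C1) * ?J)"
      by (intro add_mono sum_mono b1 norm_le_jet) auto
    finally show "jet S B (Suc n) (\<lambda>x. F (\<phi> x)) x \<le> C * ?J"
      by (simp add: C_def sum_distrib_right distrib_right)
  qed
qed

lemma Ck_on_linear:
  assumes "ray_set S B" "bounded_linear h" shows "Ck_on k B S h"
proof (rule Ck_onI)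
  fix n show "Ck_on (enat n) B S h"
  proof (cases n)
    case 0
    then show ?thesis using assms by (simp add: Ck_on_0 linear_continuous_on)
  next
    case (Suc l)
    have D: "(h has_derivative h) (at x within S)" for x using assms(2) by (rule bounded_linear_imp_has_derivative)
    show ?thesis unfolding Suc Ck_on_Suc
    proof (intro conjI ballI)
      show "continuous_on S h" using assms by (simp add: linear_continuous_on)
      show "h differentiable_on S" unfolding differentiable_on_def using D differentiableI by blast
      fix b assume b: "b \<in> B"
      show "Ck_on (enat l) B S (pd S b h)"
        by (rule Ck_on_cong[OF Ck_on_const[OF assms(1), of _ "h b"]]) (use pd_eq[OF assms(1) _ b D] in auto)
    qed
  qed
qed

lemma Ck_on_ident: "ray_set S B \<Longrightarrow> Ck_on k B S (\<lambda>x. x)"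
  by (rule Ck_on_linear[OF _ bounded_linear_ident])

lemma Ck_on_real_deriv:
  fixes f :: "real \<Rightarrow> 'b::real_normed_vector"
  assumes "open S" "\<And>x. x \<in> S \<Longrightarrow> (f has_vector_derivative f' x) (at x)" "Ck_on (enat n) Basis S f'"
  shows "Ck_on (enat (Suc n)) Basis S f"
  unfolding Ck_on_Suc
proof (intro conjI ballI)
  have D: "(f has_derivative (\<lambda>t. t *\<^sub>R f' x)) (at x within S)" if "x \<in> S" for x
    using assms(2)[OF that] by (auto simp: has_vector_derivative_def intro: has_derivative_at_withinI)
  show d: "f differentiable_on S" unfolding differentiable_on_def using D differentiableI by blast
  then show "continuous_on S f" by (rule differentiable_imp_continuous_on)
  fix b :: real assume b: "b \<in> Basis"
  then have "b = 1" by simp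
  show "Ck_on (enat n) Basis S (pd S b f)"
    by (rule Ck_on_cong[OF assms(3)]) (use pd_eq[OF ray_set_open[OF assms(1)] _ b D] \<open>b = 1\<close> in auto)
qed

text \<open>All exponents at once, because differentiation lowers the exponent. Exponent -1 serves
  quotients, -1/2 the normalisation of the boundary normal.\<close>

lemma Ck_on_powr: "Ck_on k Basis {0<..} (\<lambda>x::real. x powr a)"
proof (rule Ck_onI)
  fix n show "Ck_on (enat n) Basis {0<..} (\<lambda>x::real. x powr a)"
  proof (induction n arbitrary: a)
    case 0
    then show ?case by (auto simp: Ck_on_0 intro!: continuous_intros)
  next
    case (Suc n)
    show ?case
    proof (rule Ck_on_real_deriv)
      show "Ck_on (enat n) Basis {0<..} (\<lambda>x. a *\<^sub>R x powr (a - 1))"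
        by (intro Ck_on_scaleR_const ray_set_open Suc.IH) auto
      fix x :: real assume "x \<in> {0<..}"
      then show "((\<lambda>x. x powr a) has_vector_derivative a *\<^sub>R x powr (a - 1)) (at x)"
        unfolding has_real_derivative_iff_has_vector_derivative[symmetric]
        by (auto intro!: derivative_eq_intros)
    qed auto
  qed
qed

lemma Ck_on_powr_compose:
  fixes f :: "'a::euclidean_space \<Rightarrow> real"
  assumes "ray_set S B" "Ck_on k B S f" "\<And>x. x \<in> S \<Longrightarrow> f x > 0"
  shows "Ck_on k B S (\<lambda>x. f x powr a)"
  by (rule Ck_on_compose[OF assms(1) _ _ assms(2) Ck_on_powr]) (use assms(3) in auto)

lemma Ck_on_divide_pos:
  fixes f g :: "'a::euclidean_space \<Rightarrow> real"
  assumes "ray_set S B" "Ck_on k B S f" "Ck_on k B S g" "\<And>x. x \<in> S \<Longrightarrow> g x > 0"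
  shows "Ck_on k B S (\<lambda>x. f x / g x)"
proof (rule Ck_on_cong)
  show "Ck_on k B S (\<lambda>x. f x * g x powr (-1))"
    by (intro Ck_on_bilinear[OF bounded_bilinear_mult] Ck_on_powr_compose assms)
  fix x assume "x \<in> S"
  then show "f x / g x = f x * g x powr (-1)"
    using assms(4)[of x] by (simp add: powr_minus divide_inverse)
qed

lemmas Ck_on_scaleR = Ck_on_bilinear[OF bounded_bilinear_scaleR]
lemmas Ck_on_mult = Ck_on_bilinear[OF bounded_bilinear_mult]
lemmas Ck_on_inner = Ck_on_bilinear[OF bounded_bilinear_inner]

section \<open>Smooth cut-off functions and mollification\<close>

lemma continuous_on_compose_UNIV:
  "continuous_on UNIV f \<Longrightarrow> continuous_on S g \<Longrightarrow> continuous_on S (\<lambda>x. f (g x))"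
  by (rule continuous_on_compose2[of UNIV]) auto

text \<open>The extra power \<open>u ^ n\<close> absorbs the factor \<open>u\<close> that is split
  off when a polynomial is unfolded by one coefficient.\<close>

lemma poly_times_exp_tendsto_0:
  fixes r :: "real poly"
  shows "((\<lambda>u. u ^ n * poly r u * exp (- u)) \<longlongrightarrow> 0) at_top"
proof (induction r arbitrary: n)
  case (pCons a r)
  have "((\<lambda>u. a * (u ^ n / exp u) + u ^ Suc n * poly r u * exp (- u)) \<longlongrightarrow> a * 0 + 0) at_top"
    by (intro tendsto_intros tendsto_power_div_exp_0 pCons.IH)
  then show ?case by (simp add: algebra_simps exp_minus divide_inverse)
qed simp

text \<open>The classical flat function exp(-1/t), with a polynomial in 1/t as a factor so that the
  family is closed under differentiation.\<close>

definition flat :: "real poly \<Rightarrow> real \<Rightarrow> real" where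
  "flat p t = (if t > 0 then poly p (inverse t) * exp (- inverse t) else 0)"

text \<open>The inner derivative of 1/t is -(1/t)^2, which multiplies both \<open>pderiv p\<close>
  and the -1 produced by the exponential; \<open>[:0,0,1:]\<close> is the square of the variable. At
  0 the exponential beats every polynomial.\<close>

lemma flat_deriv: "(flat p has_real_derivative flat ([:0,0,1:] * (p - pderiv p)) t) (at t)"
proof -
  consider "t > 0" | "t < 0" | "t = 0" by linarith
  then show ?thesis
  proof cases
    case 1
    have "((\<lambda>t. poly p (inverse t) * exp (- inverse t)) has_real_derivative
      flat ([:0,0,1:] * (p - pderiv p)) t) (at t)"
      using 1 by (auto intro!: derivative_eq_intros simp: flat_def algebra_simps power2_eq_square)
    then show ?thesis
      by (rule has_field_derivative_transform_within_open[of _ _ _ "{0<..}"]) (use 1 in \<open>auto simp: flat_def\<close>)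
  next
    case 2
    have "((\<lambda>t. 0) has_real_derivative flat ([:0,0,1:] * (p - pderiv p)) t) (at t)"
      using 2 by (simp add: flat_def)
    then show ?thesis
      by (rule has_field_derivative_transform_within_open[of _ _ _ "{..<0}"]) (use 2 in \<open>auto simp: flat_def\<close>)
  next
    case 3
    have "((\<lambda>h. (flat p (0 + h) - flat p 0) / h) \<longlongrightarrow> 0) (at 0)"
    proof (rule filterlim_split_at)
      have "((\<lambda>h. 0) \<longlongrightarrow> (0::real)) (at_left 0)" by simp
      then show "((\<lambda>h. (flat p (0 + h) - flat p 0) / h) \<longlongrightarrow> 0) (at_left 0)"
        by (rule tendsto_cong[THEN iffD1, rotated])
          (auto simp: eventually_at_filter flat_def)
      have "((\<lambda>h. inverse h ^ 1 * poly p (inverse h) * exp (- inverse h)) \<longlongrightarrow> 0) (at_right 0)"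
        by (rule filterlim_compose[OF poly_times_exp_tendsto_0 filterlim_inverse_at_top_right])
      then show "((\<lambda>h. (flat p (0 + h) - flat p 0) / h) \<longlongrightarrow> 0) (at_right 0)"
        by (rule tendsto_cong[THEN iffD1, rotated])
          (auto simp: eventually_at_filter flat_def field_simps)
    qed
    then show ?thesis using 3 by (simp add: DERIV_def flat_def)
  qed
qed

lemma Ck_on_flat: "Ck_on k Basis UNIV (flat p)"
proof (rule Ck_onI)
  fix n show "Ck_on (enat n) Basis UNIV (flat p)"
  proof (induction n arbitrary: p)
    case 0
    have "continuous_on UNIV (flat p)"
      by (rule DERIV_continuous_on[OF has_field_derivative_at_within[OF flat_deriv]])
    then show ?case by (simp add: Ck_on_0)
  next
    case (Suc n)
    show ?case
      by (rule Ck_on_real_deriv[OF _ _ Suc.IH])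
        (use flat_deriv in \<open>auto simp: has_real_derivative_iff_has_vector_derivative[symmetric]\<close>)
  qed
qed

lemma flat_1_pos: "t > 0 \<Longrightarrow> flat 1 t > 0" and flat_1_zero: "t \<le> 0 \<Longrightarrow> flat p t = 0"
  and flat_1_nonneg: "flat 1 t \<ge> 0"
  by (auto simp: flat_def)

text \<open>The usual quotient of flat functions: the numerator switches off far from
  \<open>p\<close>, the other summand of the denominator switches off near \<open>p\<close>.\<close>

lemma smooth_plateau:
  fixes p :: "'a::euclidean_space"
  assumes r: "r > 0"
  obtains \<eta> :: "'a \<Rightarrow> real" where "\<And>k. Ck_on k Basis UNIV \<eta>" "\<And>x. \<eta> x \<ge> 0"
    "\<And>x. dist p x \<le> r \<Longrightarrow> \<eta> x = 1" "\<And>x. dist p x \<ge> 2 * r \<Longrightarrow> \<eta> x = 0"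
proof -
  \<comment> \<open>The squared distance in units of \<open>r\<close> is smooth also at
    \<open>p\<close>. \<open>A\<close> vanishes from 2 on and \<open>B\<close> up to 1, so they
    never vanish together; distance \<open>2 * r\<close> gives \<open>q\<close> the value 4, safely
    beyond 2.\<close>
  define q where "q x = ((p - x) \<bullet> (p - x)) * (1 / r\<^sup>2)" for x :: 'a
  have R: "ray_set (UNIV :: 'a set) Basis" by (rule ray_set_open) simp
  have xp: "Ck_on k Basis UNIV (\<lambda>x::'a. p - x)" for k
    by (intro Ck_on_diff Ck_on_ident Ck_on_const R)
  have q: "Ck_on k Basis UNIV q" for k
    unfolding q_def by (rule Ck_on_mult[OF R Ck_on_inner[OF R xp xp] Ck_on_const[OF R]])
  define A B where "A x = flat 1 (2 - q x)" and "B x = flat 1 (q x - 1)" for x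
  have A: "Ck_on k Basis UNIV A" for k
    unfolding A_def
    by (rule Ck_on_compose[OF R open_UNIV _ _ Ck_on_flat]) (auto intro: Ck_on_diff[OF R Ck_on_const[OF R] q])
  have B: "Ck_on k Basis UNIV B" for k
    unfolding B_def
    by (rule Ck_on_compose[OF R open_UNIV _ _ Ck_on_flat]) (auto intro: Ck_on_diff[OF R q Ck_on_const[OF R]])
  have pos: "A x + B x > 0" for x
  proof (cases "q x < 2")
    case True
    then have "A x > 0" by (simp add: A_def flat_1_pos)
    then show ?thesis using flat_1_nonneg[of "q x - 1"] by (simp add: B_def)
  next
    case False
    then have "B x > 0" by (simp add: B_def flat_1_pos)
    then show ?thesis using flat_1_nonneg[of "2 - q x"] by (simp add: A_def)
  qed
  have qd: "q x = (dist p x / r)\<^sup>2" for x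
    by (simp add: q_def power_divide dist_norm power2_norm_eq_inner)
  show ?thesis
  proof
    show "Ck_on k Basis UNIV (\<lambda>x. A x / (A x + B x))" for k
      by (rule Ck_on_divide_pos[OF R A Ck_on_add[OF R A B] pos])
    show "A x / (A x + B x) \<ge> 0" for x
      using pos[of x] by (simp add: A_def flat_1_nonneg)
    show "A x / (A x + B x) = 1" if "dist p x \<le> r" for x
    proof -
      have "dist p x / r \<le> 1" using that r by simp
      then have "q x \<le> 1" unfolding qd using r by (simp add: power_le_one)
      then have "B x = 0" by (simp add: B_def flat_1_zero)
      then show ?thesis using pos[of x] by simp
    qed
    show "A x / (A x + B x) = 0" if "dist p x \<ge> 2 * r" for x
    proof -
      have "2 \<le> dist p x / r" using that r by (simp add: field_simps)
      then have "2\<^sup>2 \<le> q x" unfolding qd by (intro power_mono) auto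
      then have "A x = 0" by (simp add: A_def flat_1_zero)
      then show ?thesis by simp
    qed
  qed
qed

section \<open>Differentiation under the integral and mollification\<close>

text \<open>\<open>leibniz_rule\<close> works with a derivative valued in bounded linear maps. It is
  assembled from the components \<open>dg\<close>, and evaluating its integral at basis vectors
  gives the components back.\<close>

lemma leibniz_partials:
  fixes g :: "'a::euclidean_space \<Rightarrow> 'b::euclidean_space \<Rightarrow> 'c::banach" and dg :: "'a \<Rightarrow> 'a \<Rightarrow> 'b \<Rightarrow> 'c"
  assumes g: "continuous_on (UNIV \<times> cbox a b) (\<lambda>(x, y). g x y)"
    and D: "\<And>x y. y \<in> cbox a b \<Longrightarrow> ((\<lambda>x. g x y) has_derivative (\<lambda>v. \<Sum>i\<in>Basis. (v \<bullet> i) *\<^sub>R dg i x y)) (at x)"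
    and dg: "\<And>i. i \<in> Basis \<Longrightarrow> continuous_on (UNIV \<times> cbox a b) (\<lambda>(x, y). dg i x y)"
  shows "\<exists>G'. ((\<lambda>x. integral (cbox a b) (g x)) has_derivative G') (at x) \<and>
    (\<forall>i\<in>Basis. G' i = integral (cbox a b) (dg i x))"
proof -
  have bl: "bounded_linear (\<lambda>v. \<Sum>i\<in>Basis. (v \<bullet> i) *\<^sub>R dg i x y)" for x y
    by (intro bounded_linear_sum bounded_linear_scaleR_left[THEN bounded_linear_compose] bounded_linear_inner_left)
  define fx where "fx x y = Blinfun (\<lambda>v. \<Sum>i\<in>Basis. (v \<bullet> i) *\<^sub>R dg i x y)" for x y
  have fx: "blinfun_apply (fx x y) = (\<lambda>v. \<Sum>i\<in>Basis. (v \<bullet> i) *\<^sub>R dg i x y)" for x y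
    unfolding fx_def by (rule bounded_linear_Blinfun_apply[OF bl])
  have fxi: "blinfun_apply (fx x y) i = dg i x y" if "i \<in> Basis" for x y i
    unfolding fx using that by (simp add: inner_Basis if_distrib[of "\<lambda>c. c *\<^sub>R _"] cong: if_cong)
  have cfx: "continuous_on (UNIV \<times> cbox a b) (\<lambda>(x, y). fx x y)"
    by (rule continuous_on_blinfun_componentwise) (use dg in \<open>simp add: case_prod_beta fxi\<close>)
  have inn: "continuous_on (cbox a b) (h x)" if "continuous_on (UNIV \<times> cbox a b) (\<lambda>(x, y). h x y)"
    for h :: "'a \<Rightarrow> 'b \<Rightarrow> 'd::topological_space" and x
  proof -
    have 1: "continuous_on (cbox a b) (\<lambda>y. (x, y))" by (intro continuous_intros)
    have "(\<lambda>y. (x, y)) ` cbox a b \<subseteq> UNIV \<times> cbox a b" by auto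
    from continuous_on_compose2[OF that 1 this] show ?thesis by simp
  qed
  have "((\<lambda>x. integral (cbox a b) (g x)) has_derivative integral (cbox a b) (fx x)) (at x)"
    by (rule leibniz_rule[where U = UNIV])
      (use D cfx inn[OF g] in \<open>auto simp: fx intro: integrable_continuous\<close>)
  moreover have "blinfun_apply (integral (cbox a b) (fx x)) i = integral (cbox a b) (dg i x)" if "i \<in> Basis" for i
    using blinfun_apply_integral[OF integrable_continuous[OF inn[OF cfx]]] fxi[OF that] by simp
  ultimately show ?thesis by blast
qed

lemma has_derivative_sum_pd:
  fixes f :: "'a::euclidean_space \<Rightarrow> 'b::real_normed_vector"
  assumes "f differentiable (at x)"
  shows "(f has_derivative (\<lambda>v. \<Sum>i\<in>Basis. (v \<bullet> i) *\<^sub>R pd UNIV i f x)) (at x)"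
proof -
  have D: "(f has_derivative frechet_derivative f (at x)) (at x)"
    using assms by (simp add: frechet_derivative_works)
  have "frechet_derivative f (at x) v = (\<Sum>i\<in>Basis. (v \<bullet> i) *\<^sub>R pd UNIV i f x)" for v
  proof -
    have "frechet_derivative f (at x) v = frechet_derivative f (at x) (\<Sum>i\<in>Basis. (v \<bullet> i) *\<^sub>R i)"
      by (simp add: euclidean_representation)
    then show ?thesis using has_derivative_linear[OF D] by (simp add: linear_sum linear_cmul)
  qed
  then have "frechet_derivative f (at x) = (\<lambda>v. \<Sum>i\<in>Basis. (v \<bullet> i) *\<^sub>R pd UNIV i f x)" by blast
  then show ?thesis using D by simp
qed

context
  fixes a b :: "'a::euclidean_space"
begin

text \<open>Two forms of convolution over a fixed box. Here \<open>x\<close> occurs only in the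
  kernel, so derivatives fall on the kernel and the result inherits its smoothness; in
  \<open>conv2\<close> they fall on \<open>X\<close>, which gives the approximation of the
  derivatives of \<open>X\<close>.\<close>

definition conv1 :: "('a \<Rightarrow> real) \<Rightarrow> ('a \<Rightarrow> 'c::euclidean_space) \<Rightarrow> 'a \<Rightarrow> 'c" where
  "conv1 \<rho> X x = integral (cbox a b) (\<lambda>y. \<rho> (x - y) *\<^sub>R X y)"

definition conv2 :: "('a \<Rightarrow> real) \<Rightarrow> ('a \<Rightarrow> 'c::euclidean_space) \<Rightarrow> 'a \<Rightarrow> 'c" where
  "conv2 \<rho> X x = integral (cbox a b) (\<lambda>y. \<rho> y *\<^sub>R X (x - y))"

lemma Ck_on_conv1:
  fixes X :: "'a \<Rightarrow> 'c::euclidean_space"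
  assumes X: "continuous_on UNIV X"
  shows "Ck_on (enat n) Basis UNIV \<rho> \<Longrightarrow> Ck_on (enat n) Basis UNIV (conv1 \<rho> X)"
proof (induction n arbitrary: \<rho>)
  case 0
  then have R: "continuous_on UNIV \<rho>" by (simp add: Ck_on_0)
  have "continuous_on (UNIV \<times> cbox a b) (\<lambda>(x, y). \<rho> (x - y) *\<^sub>R X y)"
    unfolding case_prod_beta
    by (intro continuous_on_scaleR continuous_on_compose_UNIV[OF R] continuous_on_compose_UNIV[OF X] continuous_intros)
  then show ?case unfolding Ck_on_0 conv1_def by (rule integral_continuous_on_param)
next
  case (Suc n)
  then have r: "continuous_on UNIV \<rho>" "\<rho> differentiable_on UNIV" by (auto simp: Ck_on_Suc)
  have rb: "continuous_on UNIV (pd UNIV i \<rho>)" if "i \<in> Basis" for i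
    using Ck_on_continuous[OF Ck_on_pdD[OF Suc.prems that]] .
  have c: "continuous_on (UNIV \<times> cbox a b) (\<lambda>(x, y). \<sigma> (x - y) *\<^sub>R X y)"
    if "continuous_on UNIV \<sigma>" for \<sigma> :: "'a \<Rightarrow> real"
    unfolding case_prod_beta
    by (intro continuous_on_scaleR continuous_on_compose_UNIV[OF that] continuous_on_compose_UNIV[OF X] continuous_intros)
  have D: "((\<lambda>x. \<rho> (x - y) *\<^sub>R X y) has_derivative (\<lambda>v. \<Sum>i\<in>Basis. (v \<bullet> i) *\<^sub>R (pd UNIV i \<rho> (x - y) *\<^sub>R X y))) (at x)" for x y
  proof -
    have "\<rho> differentiable (at (x - y))" using r(2) by (simp add: differentiable_on_def)
    from has_derivative_sum_pd[OF this]
    have "((\<lambda>x. \<rho> (x - y)) has_derivative (\<lambda>v. \<Sum>i\<in>Basis. (v \<bullet> i) *\<^sub>R pd UNIV i \<rho> (x - y))) (at x)"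
      by (intro has_derivative_compose[where f = "\<lambda>x. x - y" and g = \<rho>]) (auto intro!: derivative_eq_intros)
    then have "((\<lambda>x. \<rho> (x - y) *\<^sub>R X y) has_derivative (\<lambda>v. (\<Sum>i\<in>Basis. (v \<bullet> i) *\<^sub>R pd UNIV i \<rho> (x - y)) *\<^sub>R X y)) (at x)"
      by (rule has_derivative_scaleR_left)
    then show ?thesis by (simp add: scaleR_left.sum)
  qed
  have key: "\<exists>G'. (conv1 \<rho> X has_derivative G') (at x) \<and> (\<forall>i\<in>Basis. G' i = conv1 (pd UNIV i \<rho>) X x)" for x
    unfolding conv1_def
    by (rule leibniz_partials[OF c[OF r(1)] D c[OF rb]])
  have R: "ray_set (UNIV::'a set) Basis" by (rule ray_set_open) simp
  show ?case unfolding Ck_on_Suc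
  proof (intro conjI ballI)
    show "conv1 \<rho> X differentiable_on UNIV"
      unfolding differentiable_on_def using key differentiableI by blast
    then show "continuous_on UNIV (conv1 \<rho> X)" by (rule differentiable_imp_continuous_on)
    fix i :: 'a assume i: "i \<in> Basis"
    show "Ck_on (enat n) Basis UNIV (pd UNIV i (conv1 \<rho> X))"
    proof (rule Ck_on_cong[OF Suc.IH[OF Ck_on_pdD[OF Suc.prems i]]])
      fix x
      obtain G' where G': "(conv1 \<rho> X has_derivative G') (at x)" "\<forall>i\<in>Basis. G' i = conv1 (pd UNIV i \<rho>) X x"
        using key[of x] by blast
      show "pd UNIV i (conv1 \<rho> X) x = conv1 (pd UNIV i \<rho>) X x"
        using pd_eq[OF R UNIV_I i G'(1)] i G'(2) by simp
    qed
  qed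
qed

lemma pd_conv2:
  fixes X :: "'a \<Rightarrow> 'c::euclidean_space"
  assumes rho: "continuous_on UNIV \<rho>" and X: "Ck_on (enat (Suc n)) Basis UNIV X" and i: "i \<in> Basis"
  shows "pd UNIV i (conv2 \<rho> X) = conv2 \<rho> (pd UNIV i X)"
proof
  fix x
  have r: "continuous_on UNIV X" "X differentiable_on UNIV" using X by (auto simp: Ck_on_Suc)
  have rb: "continuous_on UNIV (pd UNIV i X)" if "i \<in> Basis" for i
    using Ck_on_continuous[OF Ck_on_pdD[OF X that]] .
  have c: "continuous_on (UNIV \<times> cbox a b) (\<lambda>(x, y). \<rho> y *\<^sub>R Z (x - y))"
    if "continuous_on UNIV Z" for Z :: "'a \<Rightarrow> 'c"
    unfolding case_prod_beta
    by (intro continuous_on_scaleR continuous_on_compose_UNIV[OF that] continuous_on_compose_UNIV[OF rho] continuous_intros)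
  have D: "((\<lambda>x. \<rho> y *\<^sub>R X (x - y)) has_derivative (\<lambda>v. \<Sum>i\<in>Basis. (v \<bullet> i) *\<^sub>R (\<rho> y *\<^sub>R pd UNIV i X (x - y)))) (at x)" for x y
  proof -
    have "X differentiable (at (x - y))" using r(2) by (simp add: differentiable_on_def)
    from has_derivative_sum_pd[OF this]
    have "((\<lambda>x. X (x - y)) has_derivative (\<lambda>v. \<Sum>i\<in>Basis. (v \<bullet> i) *\<^sub>R pd UNIV i X (x - y))) (at x)"
      by (intro has_derivative_compose[where f = "\<lambda>x. x - y" and g = X]) (auto intro!: derivative_eq_intros)
    then have "((\<lambda>x. \<rho> y *\<^sub>R X (x - y)) has_derivative (\<lambda>v. \<rho> y *\<^sub>R (\<Sum>i\<in>Basis. (v \<bullet> i) *\<^sub>R pd UNIV i X (x - y)))) (at x)"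
      by (rule has_derivative_scaleR_right)
    then show ?thesis by (simp add: scaleR_right.sum mult.commute)
  qed
  have key: "\<exists>G'. (conv2 \<rho> X has_derivative G') (at x) \<and> (\<forall>i\<in>Basis. G' i = conv2 \<rho> (pd UNIV i X) x)" for x
    unfolding conv2_def
    by (rule leibniz_partials[OF c[OF r(1)] D c[OF rb]])
  have R: "ray_set (UNIV::'a set) Basis" by (rule ray_set_open) simp
  obtain G' where G': "(conv2 \<rho> X has_derivative G') (at x)" "\<forall>i\<in>Basis. G' i = conv2 \<rho> (pd UNIV i X) x"
    using key[of x] by blast
  show "pd UNIV i (conv2 \<rho> X) x = conv2 \<rho> (pd UNIV i X) x"
    using pd_eq[OF R UNIV_I i G'(1)] i G'(2) by simp
qed

lemma partials_conv2:
  fixes X :: "'a \<Rightarrow> 'c::euclidean_space"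
  assumes rho: "continuous_on UNIV \<rho>"
  shows "Ck_on (enat n) Basis UNIV X \<Longrightarrow> set bs \<subseteq> Basis \<Longrightarrow> length bs \<le> n \<Longrightarrow>
    partials UNIV bs (conv2 \<rho> X) = conv2 \<rho> (partials UNIV bs X)"
proof (induction n arbitrary: X bs)
  case (Suc n)
  show ?case
  proof (cases bs rule: rev_cases)
    case (snoc as i)
    then have i: "i \<in> Basis" using Suc.prems by auto
    show ?thesis
      using Suc.IH[OF Ck_on_pdD[OF Suc.prems(1) i], of as] Suc.prems snoc pd_conv2[OF rho Suc.prems(1) i]
      by (auto simp: partials_snoc)
  qed simp
qed simp

end

text \<open>The substitution of \<open>x - y\<close> for \<open>y\<close> reflects and shifts the
  box. Since \<open>\<rho>\<close> and \<open>X\<close> vanish outside the same symmetric box, the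
  integrand is zero on the difference of the old and the new box.\<close>

lemma conv1_eq_conv2:
  fixes X :: "'a::euclidean_space \<Rightarrow> 'c::euclidean_space"
  assumes "continuous_on UNIV \<rho>" "continuous_on UNIV X"
    and rho0: "\<And>y. y \<notin> cbox (-c) c \<Longrightarrow> \<rho> y = 0" and X0: "\<And>y. y \<notin> cbox (-c) c \<Longrightarrow> X y = 0"
  shows "conv1 (-c) c \<rho> X x = conv2 (-c) c \<rho> X x"
proof -
  define f where "f y = \<rho> (x - y) *\<^sub>R X y" for y
  define i where "i = conv1 (-c) c \<rho> X x"
  have "continuous_on (cbox (-c) c) f"
    unfolding f_def
    by (intro continuous_on_scaleR continuous_on_compose_UNIV[OF assms(1)] continuous_on_compose_UNIV[OF assms(2)] continuous_intros)
  then have "(f has_integral i) (cbox (-c) c)"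
    unfolding i_def conv1_def f_def by (intro integrable_integral integrable_continuous)
  then have "((\<lambda>y. f (- y)) has_integral i) (cbox (- c) (- (- c)))"
    by (rule has_integral_reflect_lemma)
  then have "((\<lambda>y. f (- y)) has_integral i) (cbox ((- c + x) + (-x)) ((c + x) + (-x)))"
    by simp
  then have "(((\<lambda>y. f (- y)) \<circ> (+) (-x)) has_integral i) (cbox (- c + x) (c + x))"
    by (rule has_integral_shift_cbox_iff[THEN iffD2])
  then have 1: "((\<lambda>y. \<rho> y *\<^sub>R X (x - y)) has_integral i) (cbox (- c + x) (c + x))"
    by (simp add: o_def f_def)
  have sub: "x - y \<in> cbox (-c) c \<Longrightarrow> y \<in> cbox (- c + x) (c + x)" for y
    by (simp add: mem_box inner_simps algebra_simps)
  have "((\<lambda>y. \<rho> y *\<^sub>R X (x - y)) has_integral i) (cbox (-c) c)"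
  proof (rule has_integral_spike_set_eq[THEN iffD1, OF _ _ 1])
    have "{y \<in> cbox (- c + x) (c + x) - cbox (-c) c. \<rho> y *\<^sub>R X (x - y) \<noteq> 0} = {}" using rho0 by auto
    then show "negligible {y \<in> cbox (- c + x) (c + x) - cbox (-c) c. \<rho> y *\<^sub>R X (x - y) \<noteq> 0}"
      by (metis negligible_empty)
    have "{y \<in> cbox (-c) c - cbox (- c + x) (c + x). \<rho> y *\<^sub>R X (x - y) \<noteq> 0} = {}" using X0 sub by auto
    then show "negligible {y \<in> cbox (-c) c - cbox (- c + x) (c + x). \<rho> y *\<^sub>R X (x - y) \<noteq> 0}"
      by (metis negligible_empty)
  qed
  then show ?thesis unfolding conv2_def i_def by (simp add: integral_unique)
qed

text \<open>Shifts are kept shorter than 1. If \<open>x\<close> has norm at most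
  \<open>R + 1\<close>, both points lie in the compact ball of radius \<open>R + 2\<close>;
  otherwise both lie outside the support.\<close>

lemma uniformly_continuous_compact_support:
  fixes Z :: "'a::euclidean_space \<Rightarrow> 'b::real_normed_vector"
  assumes "continuous_on UNIV Z" "\<And>x. x \<notin> cball 0 R \<Longrightarrow> Z x = 0" "e > 0"
  obtains d where "d > 0" "\<And>x y. norm y < d \<Longrightarrow> norm (Z (x - y) - Z x) < e"
proof -
  have "uniformly_continuous_on (cball 0 (R + 2)) Z"
    using assms(1) by (intro compact_uniformly_continuous) (auto intro: continuous_on_subset)
  then obtain d where d: "d > 0"
    "\<And>x x'. x \<in> cball 0 (R + 2) \<Longrightarrow> x' \<in> cball 0 (R + 2) \<Longrightarrow> dist x' x < d \<Longrightarrow> dist (Z x') (Z x) < e"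
    using assms(3) unfolding uniformly_continuous_on_def by metis
  show ?thesis
  proof
    show "min d 1 > 0" using d by simp
    fix x y :: 'a assume y: "norm y < min d 1"
    show "norm (Z (x - y) - Z x) < e"
    proof (cases "norm x \<le> R + 1")
      case True
      then have "norm (x - y) \<le> R + 2" using y norm_triangle_ineq4[of x y] by simp
      then show ?thesis using d(2)[of x "x - y"] True y by (simp add: dist_norm norm_minus_commute)
    next
      case False
      then have "norm (x - y) > R" using y norm_triangle_ineq2[of x y] by simp
      then show ?thesis using False assms(2)[of x] assms(2)[of "x - y"] \<open>e > 0\<close> by simp
    qed
  qed
qed

lemma partials_zero_outside:
  assumes "closed K" "\<And>x. x \<notin> K \<Longrightarrow> f x = 0" "x \<notin> K" "set bs \<subseteq> Basis"
  shows "partials UNIV bs f x = 0"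
proof -
  have "partials UNIV bs f x = partials (UNIV \<inter> - K) bs (\<lambda>x. 0) x"
    by (rule partials_local) (use assms in auto)
  also have "\<dots> = 0" using assms by (intro partials_zero[of _ Basis] ray_set_open) auto
  finally show ?thesis .
qed

text \<open>Mollification. The approximation is uniform on the whole space, so it is close in every
  seminorm of the C^k topology simultaneously.\<close>

lemma Ckc_smooth_dense:
  fixes X :: "'a::euclidean_space \<Rightarrow> 'a"
  assumes D: "open D" and X: "X \<in> Ckc D (enat k)" and e: "e > 0"
  obtains Y where "Y \<in> Ckc D \<infinity>"
    "\<And>bs x. set bs \<subseteq> Basis \<Longrightarrow> length bs \<le> k \<Longrightarrow> norm (partials UNIV bs Y x - partials UNIV bs X x) \<le> e"
proof -
  have Xk: "Ck_on (enat k) Basis UNIV X" using X by (auto simp: Ckc_def)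
  obtain K where K: "compact K" "K \<subseteq> D" "\<And>x. x \<notin> K \<Longrightarrow> X x = 0" using X by (auto simp: Ckc_def)
  obtain R where R: "R > 0" "K \<subseteq> cball 0 R"
    using compact_imp_bounded[OF K(1)] unfolding bounded_pos by (meson mem_cball_0 subsetI)
  let ?L = "{bs::'a list. set bs \<subseteq> Basis \<and> length bs \<le> k}"
  have finL: "finite ?L" by (rule finite_lists_length_le) simp
  have cont: "continuous_on UNIV (partials UNIV bs X)" if "bs \<in> ?L" for bs
    using Xk that by (auto simp: Ck_on_def)
  have supp: "partials UNIV bs X x = 0" if "bs \<in> ?L" "x \<notin> cball 0 R" for bs x
  proof (rule partials_zero_outside[of "cball 0 R"])
    show "X y = 0" if "y \<notin> cball 0 R" for y using that R K(3)[of y] by blast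
  qed (use that in auto)
  have "\<forall>bs\<in>?L. \<exists>d. d > 0 \<and> (\<forall>x y. norm y < d \<longrightarrow> norm (partials UNIV bs X (x - y) - partials UNIV bs X x) < e)"
  proof
    fix bs assume bs: "bs \<in> ?L"
    obtain d where "d > 0" "\<And>x y. norm y < d \<Longrightarrow> norm (partials UNIV bs X (x - y) - partials UNIV bs X x) < e"
      using uniformly_continuous_compact_support[OF cont[OF bs] supp[OF bs] e] by blast
    then show "\<exists>d. d > 0 \<and> (\<forall>x y. norm y < d \<longrightarrow> norm (partials UNIV bs X (x - y) - partials UNIV bs X x) < e)"
      by blast
  qed
  from bchoice[OF this] obtain d where d: "\<And>bs. bs \<in> ?L \<Longrightarrow> d bs > 0"
    "\<And>bs x y. bs \<in> ?L \<Longrightarrow> norm y < d bs \<Longrightarrow> norm (partials UNIV bs X (x - y) - partials UNIV bs X x) < e"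
    by blast
  obtain d0 where d0: "d0 > 0" "(\<Union>x\<in>K. cball x d0) \<subseteq> D"
    using compact_subset_open_imp_cball_epsilon_subset[OF K(1) D K(2)] by blast
  \<comment> \<open>\<open>d0\<close> keeps the mollified support inside \<open>D\<close>, each
    \<open>d bs\<close> makes a partial derivative vary by less than \<open>e\<close>, and 1 keeps
    the kernel inside the box chosen below.\<close>
  define \<delta> where "\<delta> = Min (insert (min 1 d0) (d ` ?L))"
  have \<delta>: "\<delta> > 0" "\<delta> \<le> d0" "\<delta> \<le> 1" "\<And>bs. bs \<in> ?L \<Longrightarrow> \<delta> \<le> d bs"
    unfolding \<delta>_def using finL d d0 by (auto simp: Min_gr_iff Min_le_iff)
  obtain \<eta> :: "'a \<Rightarrow> real" where \<eta>: "\<And>k. Ck_on k Basis UNIV \<eta>" "\<And>x. \<eta> x \<ge> 0"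
    "\<And>x. dist 0 x \<le> \<delta>/2 \<Longrightarrow> \<eta> x = 1" "\<And>x. dist 0 x \<ge> 2 * (\<delta>/2) \<Longrightarrow> \<eta> x = 0"
    using smooth_plateau[of "\<delta>/2" 0] \<delta> by (metis half_gt_zero)
  obtain c :: 'a where c: "cball 0 (R + 1) \<subseteq> cbox (-c) c"
    using bounded_subset_cbox_symmetric[of "cball (0::'a) (R + 1)"] bounded_cball by blast
  let ?C = "cbox (-c) c"
  have \<eta>c: "continuous_on S \<eta>" for S using Ck_on_continuous[OF \<eta>(1)] continuous_on_subset by blast
  define I where "I = integral ?C \<eta>"
  have Ipos: "I > 0"
  proof -
    have "I \<ge> 0" unfolding I_def
      by (rule integral_nonneg) (use \<eta> \<eta>c in \<open>auto intro: integrable_continuous\<close>)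
    \<comment> \<open>A continuous nonnegative function with integral zero vanishes throughout the
      box, yet \<open>\<eta>\<close> is 1 at the interior point 0.\<close>
    moreover have "I \<noteq> 0"
    proof
      assume "I = 0"
      then have "(\<eta> has_integral 0) ?C" unfolding I_def using \<eta>c
        by (metis integrable_continuous integrable_integral)
      moreover have "0 \<in> box (-c) c"
      proof -
        have "cball 0 (R + 1) \<subseteq> ?C" by fact
        then have "interior (cball 0 (R + 1)) \<subseteq> interior ?C" by (rule interior_mono)
        then show ?thesis using R by (auto simp: interior_cbox)
      qed
      moreover have "box (-c) c \<subseteq> ?C" by (rule box_subset_cbox)
      ultimately have "\<eta> 0 = 0"
        using has_integral_0_cbox_imp_0[of "-c" c \<eta> 0] \<eta>c[of ?C] \<eta>(2) by blast
      then show False using \<eta>(3)[of 0] \<delta> by simp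
    qed
    ultimately show ?thesis by simp
  qed
  define \<rho> where "\<rho> x = (1 / I) *\<^sub>R \<eta> x" for x
  have RS: "ray_set (UNIV::'a set) Basis" by (rule ray_set_open) simp
  have \<rho>k: "Ck_on k Basis UNIV \<rho>" for k unfolding \<rho>_def by (rule Ck_on_scaleR_const[OF RS \<eta>(1)])
  have \<rho>c: "continuous_on S \<rho>" for S using Ck_on_continuous[OF \<rho>k] continuous_on_subset by blast
  have \<rho>0: "\<rho> y = 0" if "norm y \<ge> \<delta>" for y using \<eta>(4)[of y] that by (simp add: \<rho>_def)
  have \<rho>pos: "\<rho> y \<ge> 0" for y using \<eta>(2) Ipos by (simp add: \<rho>_def)
  have \<rho>1: "(\<rho> has_integral 1) ?C"
  proof -
    have "(\<eta> has_integral I) ?C" unfolding I_def using \<eta>c by (intro integrable_integral integrable_continuous)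
    from has_integral_cmul[OF this, of "1/I"] show ?thesis using Ipos by (simp add: \<rho>_def[abs_def])
  qed
  define Y where "Y = conv2 (-c) c \<rho> X"
  have Xc: "continuous_on UNIV X" using Ck_on_continuous[OF Xk] .
  \<comment> \<open>This form yields smoothness of \<open>Y\<close>; the form in its definition is
    kept for the support and for the partial derivatives.\<close>
  have Y1: "Y = conv1 (-c) c \<rho> X"
  proof
    fix x show "Y x = conv1 (-c) c \<rho> X x" unfolding Y_def
    proof (rule conv1_eq_conv2[OF \<rho>c Xc, symmetric])
      fix y assume y: "y \<notin> ?C"
      then have "y \<notin> cball 0 (R + 1)" using c by blast
      then have n: "norm y > R + 1" by simp
      then show "\<rho> y = 0" using \<delta> R by (intro \<rho>0) auto
      have "y \<notin> cball 0 R" using n by simp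
      then show "X y = 0" using R K(3)[of y] by blast
    qed
  qed
  show ?thesis
  proof
    show "Y \<in> Ckc D \<infinity>"
      unfolding Ckc_def
    proof (intro CollectI conjI)
      show "Ck_on \<infinity> Basis UNIV Y"
        unfolding Y1 by (rule Ck_onI) (rule Ck_on_conv1[OF Xc \<rho>k])
      define K' where "K' = {x + y |x y. x \<in> K \<and> y \<in> cball 0 \<delta>}"
      have "compact K'" unfolding K'_def by (rule compact_sums[OF K(1) compact_cball])
      moreover have "K' \<subseteq> D"
      proof
        fix z assume "z \<in> K'"
        then obtain x y where "z = x + y" "x \<in> K" "norm y \<le> \<delta>" by (auto simp: K'_def)
        then have "z \<in> cball x d0" using \<delta> by (auto simp: dist_norm)
        then show "z \<in> D" using d0 \<open>x \<in> K\<close> by blast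
      qed
      moreover have "Y x = 0" if "x \<notin> K'" for x
      proof -
        have "\<rho> y *\<^sub>R X (x - y) = 0" for y
        proof (cases "norm y \<le> \<delta>")
          case True
          have "x - y \<notin> K"
          proof
            assume "x - y \<in> K"
            then have "(x - y) + y \<in> K'" unfolding K'_def using True by (intro CollectI exI conjI) auto
            then show False using that by simp
          qed
          then show ?thesis using K by simp
        next
          case False then show ?thesis using \<rho>0 by simp
        qed
        then show ?thesis by (simp only: Y_def conv2_def integral_0)
      qed
      ultimately show "\<exists>K. compact K \<and> K \<subseteq> D \<and> (\<forall>x. x \<notin> K \<longrightarrow> Y x = 0)" by blast
    qed
    fix bs :: "'a list" and x assume bs: "set bs \<subseteq> Basis" "length bs \<le> k"
    define Z where "Z = partials UNIV bs X"
    have Zc: "continuous_on UNIV Z" unfolding Z_def using cont bs by blast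
    have "partials UNIV bs Y x = conv2 (-c) c \<rho> Z x"
      unfolding Y_def Z_def by (simp add: partials_conv2[OF \<rho>c Xk bs])
    moreover have i1: "((\<lambda>y. \<rho> y *\<^sub>R Z (x - y)) has_integral conv2 (-c) c \<rho> Z x) ?C"
      unfolding conv2_def
      by (intro integrable_integral integrable_continuous continuous_on_scaleR \<rho>c continuous_on_compose_UNIV[OF Zc] continuous_intros)
    have i2: "((\<lambda>y. \<rho> y *\<^sub>R Z x) has_integral 1 *\<^sub>R Z x) ?C"
      by (rule has_integral_scaleR_left[OF \<rho>1])
    have i3: "((\<lambda>y. \<rho> y *\<^sub>R e) has_integral 1 *\<^sub>R e) ?C"
      by (rule has_integral_scaleR_left[OF \<rho>1])
    have i4: "((\<lambda>y. \<rho> y *\<^sub>R Z (x - y) - \<rho> y *\<^sub>R Z x) has_integral conv2 (-c) c \<rho> Z x - Z x) ?C"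
      using has_integral_diff[OF i1 i2] by simp
    have "norm (integral ?C (\<lambda>y. \<rho> y *\<^sub>R Z (x - y) - \<rho> y *\<^sub>R Z x)) \<le> integral ?C (\<lambda>y. \<rho> y *\<^sub>R e)"
    proof (rule integral_norm_bound_integral)
      show "(\<lambda>y. \<rho> y *\<^sub>R Z (x - y) - \<rho> y *\<^sub>R Z x) integrable_on ?C" "(\<lambda>y. \<rho> y *\<^sub>R e) integrable_on ?C"
        using i3 i4 by blast+
      fix y
      show "norm (\<rho> y *\<^sub>R Z (x - y) - \<rho> y *\<^sub>R Z x) \<le> \<rho> y *\<^sub>R e"
      proof (cases "norm y < \<delta>")
        case True
        then have "norm (Z (x - y) - Z x) < e" unfolding Z_def using d(2)[of bs y x] \<delta>(4)[of bs] bs by auto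
        then have "\<rho> y * norm (Z (x - y) - Z x) \<le> \<rho> y * e" using \<rho>pos by (intro mult_left_mono) auto
        then show ?thesis using \<rho>pos[of y] by (simp add: scaleR_diff_right[symmetric])
      next
        case False then show ?thesis using \<rho>0[of y] by simp
      qed
    qed
    then have "norm (conv2 (-c) c \<rho> Z x - Z x) \<le> e"
      using integral_unique[OF i4] integral_unique[OF i3] by (simp only: scaleR_one)
    ultimately show "norm (partials UNIV bs Y x - partials UNIV bs X x) \<le> e" by (simp add: Z_def)
  qed
qed

section \<open>Functionals continuous with respect to seminorms\<close>

text \<open>Induction over the generation of open sets. For a generating set centred at another
  point \<open>f\<close>, the radius reduced by \<open>p (X - f)\<close> works by the triangle
  inequality; intersections are the source of finite families of seminorms.\<close>

lemma generate_topology_on_seminorm_ball: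
  fixes P :: "(('a \<Rightarrow> 'b::real_normed_vector) \<Rightarrow> real) set"
  assumes "generate_topology_on (insert V {{g \<in> V. p (\<lambda>x. g x - f x) < r} |f p r. f \<in> V \<and> p \<in> P \<and> 0 < r}) U"
    and tri: "\<And>p f g h. p \<in> P \<Longrightarrow> f \<in> V \<Longrightarrow> g \<in> V \<Longrightarrow> h \<in> V \<Longrightarrow>
      p (\<lambda>x. f x - h x) \<le> p (\<lambda>x. f x - g x) + p (\<lambda>x. g x - h x)"
    and X: "X \<in> U"
  shows "U \<subseteq> V \<and> (\<exists>Q r. finite Q \<and> Q \<subseteq> P \<and> r > 0 \<and> (\<forall>g\<in>V. (\<forall>q\<in>Q. q (\<lambda>x. g x - X x) < r) \<longrightarrow> g \<in> U))"
  using assms(1) X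
proof (induction arbitrary: X rule: generate_topology_on.induct)
  case (Int a b)
  have Xab: "X \<in> a" "X \<in> b" using Int.prems by auto
  from Int.IH(1)[OF Xab(1)] obtain Q r where 1: "a \<subseteq> V"
    "finite Q \<and> Q \<subseteq> P \<and> r > 0 \<and> (\<forall>g\<in>V. (\<forall>q\<in>Q. q (\<lambda>x. g x - X x) < r) \<longrightarrow> g \<in> a)"
    by blast
  from Int.IH(2)[OF Xab(2)] obtain Q' r' where 2:
    "finite Q' \<and> Q' \<subseteq> P \<and> r' > 0 \<and> (\<forall>g\<in>V. (\<forall>q\<in>Q'. q (\<lambda>x. g x - X x) < r') \<longrightarrow> g \<in> b)"
    by blast
  show ?case
  proof (intro conjI exI[of _ "Q \<union> Q'"] exI[of _ "min r r'"] ballI impI)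
    show "a \<inter> b \<subseteq> V" using 1(1) by blast
    show "finite (Q \<union> Q')" "Q \<union> Q' \<subseteq> P" "min r r' > 0" using 1(2) 2 by auto
    fix g assume g: "g \<in> V" "\<forall>q\<in>Q \<union> Q'. q (\<lambda>x. g x - X x) < min r r'"
    then have "\<forall>q\<in>Q. q (\<lambda>x. g x - X x) < r" "\<forall>q\<in>Q'. q (\<lambda>x. g x - X x) < r'" by auto
    then show "g \<in> a \<inter> b" using 1(2) 2 g(1) by blast
  qed
next
  case (UN K)
  then obtain k where k: "k \<in> K" "X \<in> k" by blast
  then obtain Q r where
    "finite Q \<and> Q \<subseteq> P \<and> r > 0 \<and> (\<forall>g\<in>V. (\<forall>q\<in>Q. q (\<lambda>x. g x - X x) < r) \<longrightarrow> g \<in> k)"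
    using UN.IH[OF k] by blast
  note Q = this
  show ?case
  proof (intro conjI exI[of _ Q] exI[of _ r] ballI impI)
    show "\<Union>K \<subseteq> V"
    proof
      fix y assume "y \<in> \<Union>K"
      then obtain k' where "k' \<in> K" "y \<in> k'" by blast
      then show "y \<in> V" using UN.IH[of k' y] by blast
    qed
    show "finite Q" "Q \<subseteq> P" "r > 0" using Q by auto
    fix g assume g: "g \<in> V" "\<forall>q\<in>Q. q (\<lambda>x. g x - X x) < r"
    then show "g \<in> \<Union>K" using Q k by blast
  qed
next
  case (Basis s)
  show ?case
  proof (cases "s = V")
    case True
    then show ?thesis by (intro conjI exI[of _ "{}"] exI[of _ 1]) auto
  next
    case False
    then obtain f p r where s: "s = {g \<in> V. p (\<lambda>x. g x - f x) < r}" "f \<in> V" "p \<in> P" "0 < r"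
      using Basis by auto
    have "p (\<lambda>x. g x - f x) < r" if "g \<in> V" "p (\<lambda>x. g x - X x) < r - p (\<lambda>x. X x - f x)" for g
      using tri[OF s(3) that(1) _ s(2), of X] Basis.prems that s by auto
    then show ?thesis using s Basis.prems
      by (intro conjI exI[of _ "{p}"] exI[of _ "r - p (\<lambda>x. X x - f x)"]) auto
  qed
qed simp

lemma topspace_seminorm_topology [simp]: "topspace (seminorm_topology V P) = V"
  unfolding seminorm_topology_def topology_generated_by_topspace by auto

text \<open>The members of \<open>P\<close> are arbitrary functions as far as the topology is
  concerned, so the triangle inequality enters as a hypothesis.\<close>

lemma continuous_functional_onD:
  assumes T: "continuous_functional_on V P T"
    and tri: "\<And>p f g h. p \<in> P \<Longrightarrow> f \<in> V \<Longrightarrow> g \<in> V \<Longrightarrow> h \<in> V \<Longrightarrow>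
      p (\<lambda>x. f x - h x) \<le> p (\<lambda>x. f x - g x) + p (\<lambda>x. g x - h x)"
    and X: "X \<in> V" and d: "d > 0"
  obtains Q r where "finite Q" "Q \<subseteq> P" "r > 0"
    "\<And>g. g \<in> V \<Longrightarrow> (\<And>q. q \<in> Q \<Longrightarrow> q (\<lambda>x. g x - X x) < r) \<Longrightarrow> \<bar>T g - T X\<bar> < d"
proof -
  have "openin (seminorm_topology V P) {g \<in> topspace (seminorm_topology V P). T g \<in> ball (T X) d}"
    using T unfolding continuous_functional_on_def
    by (rule openin_continuous_map_preimage) auto
  then have "generate_topology_on (insert V {{g \<in> V. p (\<lambda>x. g x - f x) < r} |f p r. f \<in> V \<and> p \<in> P \<and> 0 < r})
    {g \<in> V. T g \<in> ball (T X) d}"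
    unfolding topspace_seminorm_topology
    unfolding seminorm_topology_def openin_topology_generated_by_iff .
  moreover have "X \<in> {g \<in> V. T g \<in> ball (T X) d}" using X d by simp
  ultimately have "{g \<in> V. T g \<in> ball (T X) d} \<subseteq> V \<and> (\<exists>Q r. finite Q \<and> Q \<subseteq> P \<and> r > 0 \<and>
      (\<forall>g\<in>V. (\<forall>q\<in>Q. q (\<lambda>x. g x - X x) < r) \<longrightarrow> g \<in> {g \<in> V. T g \<in> ball (T X) d}))"
    by (intro generate_topology_on_seminorm_ball tri)
  then obtain Q r where Q: "finite Q" "Q \<subseteq> P" "r > 0"
      "\<forall>g\<in>V. (\<forall>q\<in>Q. q (\<lambda>x. g x - X x) < r) \<longrightarrow> g \<in> {g \<in> V. T g \<in> ball (T X) d}"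
    by blast
  show ?thesis
  proof (rule that[OF Q(1-3)])
    fix g assume "g \<in> V" "\<And>q. q \<in> Q \<Longrightarrow> q (\<lambda>x. g x - X x) < r"
    then have "T g \<in> ball (T X) d" using Q(4) by blast
    then show "\<bar>T g - T X\<bar> < d" by (simp add: dist_real_def abs_minus_commute)
  qed
qed

lemma continuous_functional_onI:
  assumes V: "\<And>f g. f \<in> V \<Longrightarrow> g \<in> V \<Longrightarrow> (\<lambda>x. f x - g x) \<in> V"
    and T: "linear_functional_on V T"
    and Q: "finite Q" "Q \<subseteq> P" "\<And>q. q \<in> Q \<Longrightarrow> q (\<lambda>x. 0) = 0"
    and bd: "\<And>f. f \<in> V \<Longrightarrow> \<bar>T f\<bar> \<le> C * (\<Sum>q\<in>Q. q f)" and C: "C \<ge> 0"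
  shows "continuous_functional_on V P T"
  unfolding continuous_functional_on_def continuous_map_def
proof (intro conjI allI impI)
  let ?\<tau> = "seminorm_topology V P"
  show "T \<in> topspace ?\<tau> \<rightarrow> topspace euclideanreal" by simp
  fix U :: "real set" assume U: "openin euclideanreal U"
  show "openin ?\<tau> {g \<in> topspace ?\<tau>. T g \<in> U}"
  proof (subst openin_subopen, rule ballI)
    fix f assume "f \<in> {g \<in> topspace ?\<tau>. T g \<in> U}"
    then have f: "f \<in> V" "T f \<in> U" by auto
    obtain e where e: "e > 0" "ball (T f) e \<subseteq> U" using U f by (auto simp: open_contains_ball)
    \<comment> \<open>The summand 1 keeps \<open>N\<close> positive and makes the final estimate
      strict: \<open>C * card Q * r\<close> equals \<open>(N - 1) * r\<close>, which is below
      \<open>e\<close>.\<close>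
    define N where "N = C * card Q + 1"
    have N: "N > 0" using C by (simp add: N_def add_nonneg_pos)
    define r where "r = e / N"
    have r: "r > 0" using e N by (simp add: r_def)
    define W where "W = V \<inter> (\<Inter>q\<in>Q. {g \<in> V. q (\<lambda>x. g x - f x) < r})"
    have op: "openin ?\<tau> V"
      using openin_topspace[of ?\<tau>] by simp
    have op2: "openin ?\<tau> {g \<in> V. q (\<lambda>x. g x - f x) < r}" if "q \<in> Q" for q
      unfolding seminorm_topology_def
      by (rule topology_generated_by_Basis) (use that Q f r in blast)
    have "openin ?\<tau> W"
    proof (cases "Q = {}")
      case True then show ?thesis using op by (simp add: W_def)
    next
      case False
      then show ?thesis unfolding W_def
        by (intro openin_Int op openin_INT2 Q op2)
    qed
    moreover have "q (\<lambda>x. f x - f x) < r" if "q \<in> Q" for q using Q(3)[OF that] r by simp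
    then have "f \<in> W" unfolding W_def using f by blast
    moreover have "W \<subseteq> {g \<in> topspace ?\<tau>. T g \<in> U}"
    proof
      fix g assume g: "g \<in> W"
      then have gV: "g \<in> V" by (simp add: W_def)
      have "T (\<lambda>x. 1 *\<^sub>R g x + (-1) *\<^sub>R f x) = 1 * T g + (-1) * T f"
        using T gV f unfolding linear_functional_on_def by blast
      then have "\<bar>T g - T f\<bar> = \<bar>T (\<lambda>x. g x - f x)\<bar>" by simp
      also have "\<dots> \<le> C * (\<Sum>q\<in>Q. q (\<lambda>x. g x - f x))" by (rule bd[OF V[OF gV f(1)]])
      also have "\<dots> \<le> C * (\<Sum>q\<in>Q. r)"
        using g C by (intro mult_left_mono sum_mono) (auto simp: W_def intro: less_imp_le)
      also have "\<dots> = (N - 1) * r" by (simp add: N_def)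
      also have "\<dots> < N * r" using r by (simp add: algebra_simps)
      also have "\<dots> = e" using N by (simp add: r_def)
      finally have "T g \<in> ball (T f) e" by (simp add: dist_real_def abs_minus_commute)
      then show "g \<in> {g \<in> topspace ?\<tau>. T g \<in> U}" using e gV by auto
    qed
    ultimately show "\<exists>W. openin ?\<tau> W \<and> f \<in> W \<and> W \<subseteq> {g \<in> topspace ?\<tau>. T g \<in> U}" by blast
  qed
qed

section \<open>Functionals on compactly supported C^k fields\<close>

lemma Ckc_Ck_on: "X \<in> Ckc D k \<Longrightarrow> Ck_on k Basis UNIV X"
  by (simp add: Ckc_def)

lemma Ckc_lincomb:
  assumes "X \<in> Ckc D k" "Y \<in> Ckc D k"
  shows "(\<lambda>x. a *\<^sub>R X x + b *\<^sub>R Y x) \<in> Ckc D k"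
proof -
  obtain K K' where K: "compact K" "K \<subseteq> D" "\<forall>x. x \<notin> K \<longrightarrow> X x = 0" "compact K'" "K' \<subseteq> D" "\<forall>x. x \<notin> K' \<longrightarrow> Y x = 0"
    using assms by (auto simp: Ckc_def)
  have "Ck_on k Basis UNIV (\<lambda>x. a *\<^sub>R X x + b *\<^sub>R Y x)"
    by (rule Ck_on_lincomb[OF ray_set_open[OF open_UNIV] Ckc_Ck_on[OF assms(1)] Ckc_Ck_on[OF assms(2)]])
  moreover have "compact (K \<union> K') \<and> K \<union> K' \<subseteq> D \<and> (\<forall>x. x \<notin> K \<union> K' \<longrightarrow> a *\<^sub>R X x + b *\<^sub>R Y x = 0)"
    using K by auto
  ultimately show ?thesis unfolding Ckc_def by blast
qed

lemma Ckc_diff: "X \<in> Ckc D k \<Longrightarrow> Y \<in> Ckc D k \<Longrightarrow> (\<lambda>x. X x - Y x) \<in> Ckc D k"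
  using Ckc_lincomb[of X D k Y 1 "-1"] by simp

lemma Ckc_zero: "(\<lambda>x. 0) \<in> Ckc D k"
  by (auto simp: Ckc_def intro: Ck_on_const ray_set_open)

lemma Ckc_mono: "X \<in> Ckc D k' \<Longrightarrow> k \<le> k' \<Longrightarrow> X \<in> Ckc D k"
  by (auto simp: Ckc_def intro: Ck_on_mono)

lemma partials_diff_Ckc:
  assumes "X \<in> Ckc D (enat k)" "Y \<in> Ckc D (enat k)" "set bs \<subseteq> Basis" "length bs \<le> k"
  shows "partials UNIV bs (\<lambda>x. X x - Y x) x = partials UNIV bs X x - partials UNIV bs Y x"
  using partials_lincomb[OF ray_set_open[OF open_UNIV] Ckc_Ck_on[OF assms(1)] Ckc_Ck_on[OF assms(2)] assms(3,4) UNIV_I, of 1 "-1"]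
  by simp

lemma Ckc_seminorms_cases:
  assumes "p \<in> Ckc_seminorms D (enat k)"
  obtains K bs where "p = (\<lambda>f. SUP x\<in>K. norm (partials UNIV bs f x))" "compact K" "K \<noteq> {}" "K \<subseteq> D"
    "set bs \<subseteq> Basis" "length bs \<le> k"
  using assms unfolding Ckc_seminorms_def by (auto simp: enat_ord_simps)

lemma Ckc_seminorm_le:
  assumes p: "p \<in> Ckc_seminorms D (enat k)"
    and "\<And>bs x. set bs \<subseteq> Basis \<Longrightarrow> length bs \<le> k \<Longrightarrow> norm (partials UNIV bs f x) \<le> e"
  shows "p f \<le> e"
proof -
  obtain K bs where K: "p = (\<lambda>f. SUP x\<in>K. norm (partials UNIV bs f x))" "compact K" "K \<noteq> {}" "K \<subseteq> D"
    "set bs \<subseteq> Basis" "length bs \<le> k" using p by (rule Ckc_seminorms_cases)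
  show ?thesis unfolding K(1) by (rule cSUP_least) (use K assms(2) in auto)
qed

lemma Ckc_seminorm_triangle:
  assumes p: "p \<in> Ckc_seminorms D (enat k)" and f: "f \<in> Ckc D (enat k)" and g: "g \<in> Ckc D (enat k)" and h: "h \<in> Ckc D (enat k)"
  shows "p (\<lambda>x. f x - h x) \<le> p (\<lambda>x. f x - g x) + p (\<lambda>x. g x - h x)"
proof -
  obtain K bs where K: "p = (\<lambda>f. SUP x\<in>K. norm (partials UNIV bs f x))" "compact K" "K \<noteq> {}" "K \<subseteq> D"
    "set bs \<subseteq> Basis" "length bs \<le> k" using p by (rule Ckc_seminorms_cases)
  have bdd: "norm (partials UNIV bs F x) \<le> (SUP x\<in>K. norm (partials UNIV bs F x))"
    if "F \<in> Ckc D (enat k)" "x \<in> K" for F x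
  proof (rule cSUP_upper[OF that(2)])
    have "continuous_on UNIV (partials UNIV bs F)"
      using Ckc_Ck_on[OF that(1)] K by (simp add: Ck_on_def)
    then have "compact ((\<lambda>x. norm (partials UNIV bs F x)) ` K)"
      by (intro compact_continuous_image K continuous_on_norm) (auto intro: continuous_on_subset)
    then show "bdd_above ((\<lambda>x. norm (partials UNIV bs F x)) ` K)"
      by (intro bounded_imp_bdd_above compact_imp_bounded)
  qed
  show ?thesis unfolding K(1)
  proof (rule cSUP_least[OF K(3)])
    fix x assume x: "x \<in> K"
    have "norm (partials UNIV bs (\<lambda>x. f x - h x) x) \<le> norm (partials UNIV bs (\<lambda>x. f x - g x) x) + norm (partials UNIV bs (\<lambda>x. g x - h x) x)"
      unfolding partials_diff_Ckc[OF f h K(5,6)] partials_diff_Ckc[OF f g K(5,6)] partials_diff_Ckc[OF g h K(5,6)]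
      using norm_triangle_ineq[of "partials UNIV bs f x - partials UNIV bs g x" "partials UNIV bs g x - partials UNIV bs h x"] by simp
    also have "\<dots> \<le> (SUP x\<in>K. norm (partials UNIV bs (\<lambda>x. f x - g x) x)) + (SUP x\<in>K. norm (partials UNIV bs (\<lambda>x. g x - h x) x))"
      by (intro add_mono bdd Ckc_diff f g h x)
    finally show "norm (partials UNIV bs (\<lambda>x. f x - h x) x) \<le> (SUP x\<in>K. norm (partials UNIV bs (\<lambda>x. f x - g x) x)) + (SUP x\<in>K. norm (partials UNIV bs (\<lambda>x. g x - h x) x))" .
  qed
qed

text \<open>Uniform closeness of all partial derivatives on the whole space implies closeness in any
  finite set of seminorms, each being a supremum over a compact set. It is also exactly what
  mollification provides.\<close>

lemma continuous_functional_on_Ckc: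
  assumes T: "continuous_functional_on (Ckc D (enat k)) (Ckc_seminorms D (enat k)) T"
    and X: "X \<in> Ckc D (enat k)" and d: "d > 0"
  obtains r where "r > 0" "\<And>Y. Y \<in> Ckc D (enat k) \<Longrightarrow>
    (\<And>bs x. set bs \<subseteq> Basis \<Longrightarrow> length bs \<le> k \<Longrightarrow> norm (partials UNIV bs Y x - partials UNIV bs X x) \<le> r) \<Longrightarrow>
    \<bar>T Y - T X\<bar> < d"
proof (rule continuous_functional_onD[OF T _ X d])
  fix p f g h assume "p \<in> Ckc_seminorms D (enat k)" "f \<in> Ckc D (enat k)" "g \<in> Ckc D (enat k)" "h \<in> Ckc D (enat k)"
  then show "p (\<lambda>x. f x - h x) \<le> p (\<lambda>x. f x - g x) + p (\<lambda>x. g x - h x)"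
    by (rule Ckc_seminorm_triangle)
next
  fix Q r assume Q: "finite Q" "Q \<subseteq> Ckc_seminorms D (enat k)" "r > 0"
    "\<And>g. g \<in> Ckc D (enat k) \<Longrightarrow> (\<And>q. q \<in> Q \<Longrightarrow> q (\<lambda>x. g x - X x) < r) \<Longrightarrow> \<bar>T g - T X\<bar> < d"
  show ?thesis
  \<comment> \<open>Half the radius, because a supremum of values at most \<open>r/2\<close> need
    not be attained strictly below it, whereas the seminorm ball is open.\<close>
  proof (rule that[of "r/2"])
    fix Y assume Y: "Y \<in> Ckc D (enat k)"
      "\<And>bs x. set bs \<subseteq> Basis \<Longrightarrow> length bs \<le> k \<Longrightarrow> norm (partials UNIV bs Y x - partials UNIV bs X x) \<le> r/2"
    show "\<bar>T Y - T X\<bar> < d"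
    proof (rule Q(4)[OF Y(1)])
      fix q assume "q \<in> Q"
      then have q: "q \<in> Ckc_seminorms D (enat k)" using Q(2) by blast
      have "q (\<lambda>x. Y x - X x) \<le> r/2"
        by (rule Ckc_seminorm_le[OF q, where f = "\<lambda>x. Y x - X x"]) (simp only: partials_diff_Ckc[OF Y(1) X] Y(2))
      then show "q (\<lambda>x. Y x - X x) < r" using Q(3) by simp
    qed
  qed (use Q in simp)
qed

text \<open>Both arguments are replaced by smooth approximations, for which \<open>T\<close> is
  linear; continuity at \<open>X\<close>, at \<open>Y\<close> and at their combination controls the
  three errors.\<close>

lemma linear_functional_on_Ckc_extend:
  assumes D: "open D" and lin: "linear_functional_on (Ckc D \<infinity>) T"
    and T: "continuous_functional_on (Ckc D (enat k)) (Ckc_seminorms D (enat k)) T"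
  shows "linear_functional_on (Ckc D (enat k)) T"
  unfolding linear_functional_on_def
proof (intro ballI allI)
  fix X Y a b assume X: "X \<in> Ckc D (enat k)" and Y: "Y \<in> Ckc D (enat k)"
  define Z where "Z = (\<lambda>x. a *\<^sub>R X x + b *\<^sub>R Y x)"
  have Z: "Z \<in> Ckc D (enat k)" unfolding Z_def by (rule Ckc_lincomb[OF X Y])
  \<comment> \<open>Divides the error budget: the three errors enter with the weights
    \<open>\<bar>b\<bar>\<close>, \<open>\<bar>a\<bar>\<close> and 1.\<close>
  define A where "A = 1 + \<bar>a\<bar> + \<bar>b\<bar>"
  have A: "A \<ge> 1" by (simp add: A_def)
  have "\<bar>T Z - (a * T X + b * T Y)\<bar> \<le> 0 + d" if d: "d > 0" for d
  proof -
    have d': "d / A > 0" using d A by simp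
    obtain r1 where r1: "r1 > 0" "\<And>W. W \<in> Ckc D (enat k) \<Longrightarrow>
      (\<And>bs x. set bs \<subseteq> Basis \<Longrightarrow> length bs \<le> k \<Longrightarrow> norm (partials UNIV bs W x - partials UNIV bs X x) \<le> r1) \<Longrightarrow>
      \<bar>T W - T X\<bar> < d/A" using continuous_functional_on_Ckc[OF T X d'] by blast
    obtain r2 where r2: "r2 > 0" "\<And>W. W \<in> Ckc D (enat k) \<Longrightarrow>
      (\<And>bs x. set bs \<subseteq> Basis \<Longrightarrow> length bs \<le> k \<Longrightarrow> norm (partials UNIV bs W x - partials UNIV bs Y x) \<le> r2) \<Longrightarrow>
      \<bar>T W - T Y\<bar> < d/A" using continuous_functional_on_Ckc[OF T Y d'] by blast
    obtain r3 where r3: "r3 > 0" "\<And>W. W \<in> Ckc D (enat k) \<Longrightarrow>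
      (\<And>bs x. set bs \<subseteq> Basis \<Longrightarrow> length bs \<le> k \<Longrightarrow> norm (partials UNIV bs W x - partials UNIV bs Z x) \<le> r3) \<Longrightarrow>
      \<bar>T W - T Z\<bar> < d/A" using continuous_functional_on_Ckc[OF T Z d'] by blast
    \<comment> \<open>The combination multiplies the approximation error by at most
      \<open>\<bar>a\<bar> + \<bar>b\<bar>\<close>, hence the division of \<open>r3\<close> by
      \<open>A\<close>.\<close>
    define r where "r = min (min r1 r2) (r3 / A)"
    have r: "r > 0" "r \<le> r1" "r \<le> r2" "r \<le> r3 / A" using r1 r2 r3 A by (auto simp: r_def)
    obtain X' where X': "X' \<in> Ckc D \<infinity>"
      "\<And>bs x. set bs \<subseteq> Basis \<Longrightarrow> length bs \<le> k \<Longrightarrow> norm (partials UNIV bs X' x - partials UNIV bs X x) \<le> r"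
      using Ckc_smooth_dense[OF D X r(1)] by blast
    obtain Y' where Y': "Y' \<in> Ckc D \<infinity>"
      "\<And>bs x. set bs \<subseteq> Basis \<Longrightarrow> length bs \<le> k \<Longrightarrow> norm (partials UNIV bs Y' x - partials UNIV bs Y x) \<le> r"
      using Ckc_smooth_dense[OF D Y r(1)] by blast
    have X'k: "X' \<in> Ckc D (enat k)" and Y'k: "Y' \<in> Ckc D (enat k)" using X' Y' by (auto intro: Ckc_mono)
    define Z' where "Z' = (\<lambda>x. a *\<^sub>R X' x + b *\<^sub>R Y' x)"
    have Z'k: "Z' \<in> Ckc D (enat k)" unfolding Z'_def by (rule Ckc_lincomb[OF X'k Y'k])
    have 1: "\<bar>T X' - T X\<bar> < d/A" using r X'(2) by (intro r1(2)[OF X'k]) (meson order_trans)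
    have 2: "\<bar>T Y' - T Y\<bar> < d/A" using r Y'(2) by (intro r2(2)[OF Y'k]) (meson order_trans)
    have 3: "\<bar>T Z' - T Z\<bar> < d/A"
    proof (rule r3(2)[OF Z'k])
      fix bs :: "'a list" and x assume bs: "set bs \<subseteq> Basis" "length bs \<le> k"
      have lc: "partials UNIV bs (\<lambda>x. a *\<^sub>R f x + b *\<^sub>R g x) x = a *\<^sub>R partials UNIV bs f x + b *\<^sub>R partials UNIV bs g x"
        if "f \<in> Ckc D (enat k)" "g \<in> Ckc D (enat k)" for f g
        by (rule partials_lincomb[OF ray_set_open[OF open_UNIV] Ckc_Ck_on[OF that(1)] Ckc_Ck_on[OF that(2)] bs UNIV_I])
      have "partials UNIV bs Z' x - partials UNIV bs Z x =
          a *\<^sub>R (partials UNIV bs X' x - partials UNIV bs X x) + b *\<^sub>R (partials UNIV bs Y' x - partials UNIV bs Y x)"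
        unfolding Z_def Z'_def lc[OF X'k Y'k] lc[OF X Y] by (simp add: algebra_simps)
      also have "norm \<dots> \<le> \<bar>a\<bar> * norm (partials UNIV bs X' x - partials UNIV bs X x) + \<bar>b\<bar> * norm (partials UNIV bs Y' x - partials UNIV bs Y x)"
        using norm_triangle_ineq by (metis norm_scaleR)
      also have "\<dots> \<le> \<bar>a\<bar> * r + \<bar>b\<bar> * r"
        using X'(2)[OF bs] Y'(2)[OF bs] by (intro add_mono mult_left_mono) auto
      also have "\<dots> \<le> A * r" using r by (simp add: A_def algebra_simps)
      also have "\<dots> \<le> r3" using r A by (simp add: field_simps)
      finally show "norm (partials UNIV bs Z' x - partials UNIV bs Z x) \<le> r3" .
    qed
    have lin': "T Z' = a * T X' + b * T Y'" unfolding Z'_def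
      using lin X'(1) Y'(1) by (simp add: linear_functional_on_def)
    have "T Z - (a * T X + b * T Y) = a * (T X' - T X) + b * (T Y' - T Y) - (T Z' - T Z)"
      unfolding lin' by (simp add: algebra_simps)
    also have "\<bar>\<dots>\<bar> \<le> \<bar>a\<bar> * \<bar>T X' - T X\<bar> + \<bar>b\<bar> * \<bar>T Y' - T Y\<bar> + \<bar>T Z' - T Z\<bar>"
      unfolding abs_mult[symmetric] by linarith
    also have "\<dots> \<le> \<bar>a\<bar> * (d/A) + \<bar>b\<bar> * (d/A) + d/A"
      using 1 2 3 by (intro add_mono mult_left_mono) auto
    also have "\<dots> = (d/A) * A" by (simp add: A_def algebra_simps add_divide_distrib)
    also have "\<dots> = d" using A by simp
    finally show ?thesis by simp
  qed
  then have "\<bar>T Z - (a * T X + b * T Y)\<bar> \<le> 0" by (rule field_le_epsilon)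
  then show "T (\<lambda>x. a *\<^sub>R X x + b *\<^sub>R Y x) = a * T X + b * T Y" by (simp add: Z_def)
qed

text \<open>Continuity at 0 combined with scaling, as for functionals on normed spaces; the role of
  the norm is taken by any uniform bound \<open>s\<close> on the jet.\<close>

lemma Ckc_functional_bound:
  assumes lin: "linear_functional_on (Ckc D (enat k)) T"
    and T: "continuous_functional_on (Ckc D (enat k)) (Ckc_seminorms D (enat k)) T"
  obtains C where "C \<ge> 0" "\<And>X s. X \<in> Ckc D (enat k) \<Longrightarrow> (\<And>x. jet UNIV Basis k X x \<le> s) \<Longrightarrow> \<bar>T X\<bar> \<le> C * s"
proof -
  obtain r where r: "r > 0" "\<And>Y. Y \<in> Ckc D (enat k) \<Longrightarrow>
    (\<And>bs x. set bs \<subseteq> Basis \<Longrightarrow> length bs \<le> k \<Longrightarrow> norm (partials UNIV bs Y x - partials UNIV bs (\<lambda>x. 0::'a) x) \<le> r) \<Longrightarrow>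
    \<bar>T Y - T (\<lambda>x. 0)\<bar> < 1"
    using continuous_functional_on_Ckc[OF T Ckc_zero zero_less_one] by blast
  have sc: "T (\<lambda>x. a *\<^sub>R X x) = a * T X" if "X \<in> Ckc D (enat k)" for X a
  proof -
    have "T (\<lambda>x. a *\<^sub>R X x + 0 *\<^sub>R X x) = a * T X + 0 * T X"
      using lin that unfolding linear_functional_on_def by blast
    then show ?thesis by simp
  qed
  have T0: "T (\<lambda>x. 0) = 0" using sc[OF Ckc_zero, of 0] by simp
  have p0: "partials UNIV bs (\<lambda>x. 0::'a) x = 0" if "set bs \<subseteq> Basis" for bs and x :: 'a
    by (rule partials_zero[OF ray_set_open[OF open_UNIV] that UNIV_I])
  have pos: "\<bar>T X\<bar> \<le> (1/r) * s" if X: "X \<in> Ckc D (enat k)" "\<And>x. jet UNIV Basis k X x \<le> s" and s: "s > 0" for X s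
  proof -
    define c where "c = r / s"
    have c: "c > 0" using r s by (simp add: c_def)
    have cX: "(\<lambda>x. c *\<^sub>R X x) \<in> Ckc D (enat k)" using Ckc_lincomb[OF X(1) X(1), of c 0] by simp
    have "\<bar>T (\<lambda>x. c *\<^sub>R X x) - T (\<lambda>x. 0)\<bar> < 1"
    proof (rule r(2)[OF cX])
      fix bs :: "'a list" and x assume bs: "set bs \<subseteq> Basis" "length bs \<le> k"
      have "partials UNIV bs (\<lambda>x. c *\<^sub>R X x) x = c *\<^sub>R partials UNIV bs X x"
        by (rule partials_bounded_linear[OF bounded_linear_scaleR_right ray_set_open[OF open_UNIV] Ckc_Ck_on[OF X(1)] bs UNIV_I])
      moreover have "norm (partials UNIV bs X x) \<le> s"
        using partials_le_jet[OF finite_Basis bs, of UNIV X x] X(2)[of x] by simp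
      ultimately show "norm (partials UNIV bs (\<lambda>x. c *\<^sub>R X x) x - partials UNIV bs (\<lambda>x. 0::'a) x) \<le> r"
        using c s r p0[OF bs(1)] by (simp add: c_def field_simps)
    qed
    then have "c * \<bar>T X\<bar> < 1" using sc[OF X(1), of c] T0 c by (simp add: abs_mult)
    then show ?thesis using r s by (simp add: c_def field_simps)
  qed
  show ?thesis
  proof (rule that[of "1/r"])
    show "1/r \<ge> 0" using r by simp
    fix X s assume X: "X \<in> Ckc D (enat k)" "\<And>x. jet UNIV Basis k X x \<le> s"
    have s0: "s \<ge> 0" using X(2) jet_nonneg order_trans by blast
    show "\<bar>T X\<bar> \<le> (1/r) * s"
    \<comment> \<open>\<open>s\<close> may be 0, where scaling by \<open>r / s\<close> is
      meaningless; it is enlarged by \<open>r * e\<close>, which costs exactly \<open>e\<close> in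
      the conclusion.\<close>
    proof (rule field_le_epsilon)
      fix e :: real assume e: "e > 0"
      have "\<bar>T X\<bar> \<le> (1/r) * (s + r * e)"
      proof (rule pos[OF X(1)])
        show "jet UNIV Basis k X x \<le> s + r * e" for x using X(2)[of x] r e
          by (meson add_increasing2 less_imp_le mult_pos_pos)
        show "0 < s + r * e" using s0 r e by (simp add: add_nonneg_pos)
      qed
      then show "\<bar>T X\<bar> \<le> (1/r) * s + e" using r by (simp add: field_simps)
    qed
  qed
qed

section \<open>Coordinate half-planes and flows\<close>

lemma ebasis_bij: "bij_betw (ebasis :: nat \<Rightarrow> 'a::euclidean_space) {..<DIM('a)} Basis"
proof -
  have "\<exists>e. bij_betw e {..<DIM('a)} (Basis :: 'a set)"
    using ex_bij_betw_nat_finite[OF finite_Basis] by (simp add: lessThan_atLeast0)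
  then show ?thesis unfolding ebasis_def by (rule someI_ex)
qed

lemma ebasis_in_Basis: "i < DIM('a) \<Longrightarrow> (ebasis i :: 'a::euclidean_space) \<in> Basis"
  using ebasis_bij[where 'a='a] by (auto simp: bij_betw_def)

lemma ebasis_image_subset: "m \<le> DIM('a) \<Longrightarrow> (ebasis ` {..<m} :: 'a::euclidean_space set) \<subseteq> Basis"
  using ebasis_in_Basis by (auto intro: less_le_trans)

lemma inner_ebasis:
  assumes "i < DIM('a)" "j < DIM('a)"
  shows "(ebasis i :: 'a::euclidean_space) \<bullet> ebasis j = (if i = j then 1 else 0)"
proof (cases "i = j")
  case False
  then have "(ebasis i :: 'a) \<noteq> ebasis j"
    using ebasis_bij[where 'a='a] assms by (auto simp: bij_betw_def inj_on_def)
  then show ?thesis using False assms by (simp add: inner_Basis ebasis_in_Basis)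
qed (use assms in \<open>simp add: ebasis_in_Basis\<close>)

definition proj :: "nat \<Rightarrow> 'a::euclidean_space \<Rightarrow> 'a" where
  "proj m x = (\<Sum>i<m. (x \<bullet> ebasis i) *\<^sub>R ebasis i)"

lemma linear_proj: "linear (proj m)"
  unfolding proj_def by (intro linearI) (simp_all add: inner_simps scaleR_left_distrib sum.distrib scaleR_sum_right)

lemma bounded_linear_proj: "bounded_linear (proj m :: 'a::euclidean_space \<Rightarrow> 'a)"
  using linear_proj linear_conv_bounded_linear by blast

lemma proj_inner_ebasis:
  assumes "m \<le> DIM('a)" "j < DIM('a)"
  shows "proj m x \<bullet> ebasis j = (if j < m then (x::'a::euclidean_space) \<bullet> ebasis j else 0)"
proof -
  have "proj m x \<bullet> ebasis j = (\<Sum>i<m. (x \<bullet> ebasis i) * (ebasis i \<bullet> (ebasis j :: 'a)))"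
    by (simp add: proj_def inner_sum_left)
  also have "\<dots> = (\<Sum>i<m. if i = j then x \<bullet> ebasis j else 0)"
    using assms by (intro sum.cong refl) (simp add: inner_ebasis)
  finally show ?thesis by simp
qed

lemma subspace_coord_plane: "subspace (coord_plane m)"
  by (auto simp: subspace_def coord_plane_def inner_simps)

lemma proj_in_coord_plane: "m \<le> DIM('a) \<Longrightarrow> proj m (x::'a::euclidean_space) \<in> coord_plane m"
  by (simp add: coord_plane_def proj_inner_ebasis)

lemma euclidean_eq_ebasis:
  fixes x y :: "'a::euclidean_space"
  assumes "\<And>j. j < DIM('a) \<Longrightarrow> x \<bullet> ebasis j = y \<bullet> ebasis j"
  shows "x = y"
proof (rule euclidean_eqI)
  fix b :: 'a assume "b \<in> Basis"
  then obtain j where "j < DIM('a)" "b = ebasis j"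
    using ebasis_bij[where 'a='a] by (force simp: bij_betw_def)
  then show "x \<bullet> b = y \<bullet> b" using assms by simp
qed

lemma proj_fix:
  assumes "m \<le> DIM('a)" "(x::'a::euclidean_space) \<in> coord_plane m"
  shows "proj m x = x"
  by (rule euclidean_eq_ebasis) (use assms in \<open>auto simp: proj_inner_ebasis coord_plane_def\<close>)

lemma ebasis_coord_plane: "i < m \<Longrightarrow> m \<le> DIM('a) \<Longrightarrow> (ebasis i :: 'a::euclidean_space) \<in> coord_plane m"
  by (auto simp: coord_plane_def inner_ebasis)

lemma proj_orth:
  assumes "m \<le> DIM('a)" "(y::'a::euclidean_space) \<in> coord_plane m"
  shows "(x - proj m x) \<bullet> y = 0"
proof -
  have "(x - proj m x) \<bullet> y = (x - proj m x) \<bullet> proj m y" using proj_fix[OF assms] by simp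
  also have "\<dots> = (\<Sum>i<m. (y \<bullet> ebasis i) * ((x - proj m x) \<bullet> ebasis i))"
    unfolding proj_def[of m y] by (simp add: inner_sum_right)
  also have "\<dots> = 0" using assms(1) by (intro sum.neutral) (simp add: inner_diff_left proj_inner_ebasis)
  finally show ?thesis .
qed

lemma coord_plane_span:
  assumes "m \<le> DIM('a)"
  shows "(coord_plane m :: 'a::euclidean_space set) = span (ebasis ` {..<m})"
proof (rule antisym)
  show "span (ebasis ` {..<m}) \<subseteq> (coord_plane m :: 'a set)"
    using assms by (intro span_minimal subspace_coord_plane) (auto intro: ebasis_coord_plane)
  show "(coord_plane m :: 'a set) \<subseteq> span (ebasis ` {..<m})"
  proof
    fix x :: 'a assume "x \<in> coord_plane m"
    then have "x = proj m x" using proj_fix[OF assms] by simp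
    also have "\<dots> \<in> span (ebasis ` {..<m})"
      unfolding proj_def by (intro span_sum span_scale span_base) auto
    finally show "x \<in> span (ebasis ` {..<m})" .
  qed
qed

section \<open>Model spaces and nearest-point projections\<close>

text \<open>
  Both kinds of model spaces at once: \<open>e = 0\<close> gives the coordinate plane, the last unit vector
  the half-plane.
\<close>

definition hspace :: "nat \<Rightarrow> 'a::euclidean_space \<Rightarrow> 'a set" where
  "hspace m e = {x \<in> coord_plane m. 0 \<le> x \<bullet> e}"

definition edge_vector :: "nat \<Rightarrow> 'a::euclidean_space \<Rightarrow> bool" where
  "edge_vector m e \<longleftrightarrow> e = 0 \<or> (1 \<le> m \<and> e = ebasis (m - 1))"

lemma coord_plane_hspace: "coord_plane m = hspace m 0"
  and half_plane_hspace: "half_plane m = hspace m (ebasis (m - 1))"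
  by (auto simp: hspace_def half_plane_def)

lemma model_space_hspace: "model_space m H \<longleftrightarrow> (\<exists>e. edge_vector m e \<and> H = hspace m e)"
  unfolding model_space_def edge_vector_def coord_plane_hspace half_plane_hspace by auto

lemma edge_vector_unit: "edge_vector m e \<Longrightarrow> m \<le> DIM('a) \<Longrightarrow> (e::'a::euclidean_space) \<noteq> 0 \<Longrightarrow> e \<bullet> e = 1 \<and> e \<in> ebasis ` {..<m}"
  by (auto simp: edge_vector_def inner_ebasis)

lemma edge_vector_coord_plane:
  assumes "edge_vector m e" "m \<le> DIM('a)" shows "(e::'a::euclidean_space) \<in> coord_plane m"
  using assms ebasis_coord_plane[of "m - 1" m] subspace_0[OF subspace_coord_plane]
  by (auto simp: edge_vector_def)

text \<open>A coordinate direction leaves the height over the edge unchanged or increases it, so its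
  rays never cross the edge.\<close>

lemma ray_set_hspace:
  assumes "edge_vector m e" "m \<le> DIM('a)"
  shows "ray_set (hspace m (e::'a::euclidean_space)) (ebasis ` {..<m})"
  unfolding ray_set_def
proof (intro ballI)
  fix x b :: 'a assume x: "x \<in> hspace m e" and b: "b \<in> ebasis ` {..<m}"
  then obtain i where i: "i < m" "b = ebasis i" by auto
  have "b \<bullet> e \<ge> 0" using i assms by (auto simp: edge_vector_def inner_ebasis)
  then have "x + t *\<^sub>R b \<in> hspace m e" if "t \<ge> 0" for t
  proof -
    have "x + t *\<^sub>R b \<in> coord_plane m"
      using x i ebasis_coord_plane[OF i(1) assms(2)]
      by (intro subspace_add[OF subspace_coord_plane] subspace_scale[OF subspace_coord_plane]) (auto simp: hspace_def)
    then show ?thesis using x that \<open>b \<bullet> e \<ge> 0\<close> by (auto simp: hspace_def inner_simps)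
  qed
  then show "\<exists>d>0. \<forall>t. 0 \<le> t \<and> t < d \<longrightarrow> x + t *\<^sub>R b \<in> hspace m e"
    by (intro exI[of _ 1]) auto
qed

lemma ray_set_chart:
  assumes "model_space m (H::'a::euclidean_space set)" "m \<le> DIM('a)" "open V"
  shows "ray_set (V \<inter> H) (ebasis ` {..<m})"
  using ray_set_Int_open[OF ray_set_hspace assms(3)] assms(1,2)
  by (auto simp: model_space_hspace Int_commute)

text \<open>The nearest-point projection onto \<open>hspace m e\<close>: project to the plane, then
  lift a negative height to 0. For \<open>e = 0\<close> it is \<open>proj m\<close>.\<close>

definition hproj :: "nat \<Rightarrow> 'a::euclidean_space \<Rightarrow> 'a \<Rightarrow> 'a" where
  "hproj m e x = proj m x - min 0 (x \<bullet> e) *\<^sub>R e"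

lemma proj_inner_edge:
  assumes "edge_vector m e" "m \<le> DIM('a)"
  shows "proj m x \<bullet> e = (x::'a::euclidean_space) \<bullet> e"
  using assms proj_inner_ebasis[of m "m - 1" x] by (auto simp: edge_vector_def)

lemma hproj_in_hspace:
  assumes "edge_vector m e" "m \<le> DIM('a)"
  shows "hproj m e (x::'a::euclidean_space) \<in> hspace m e"
proof -
  have "hproj m e x \<in> coord_plane m"
    unfolding hproj_def using assms
    by (intro subspace_diff subspace_scale subspace_coord_plane proj_in_coord_plane edge_vector_coord_plane)
  moreover have "hproj m e x \<bullet> e \<ge> 0"
    using edge_vector_unit[OF assms] proj_inner_edge[OF assms, of x]
    by (cases "e = 0") (auto simp: hproj_def inner_simps)
  ultimately show ?thesis by (simp add: hspace_def)
qed

lemma hproj_edge_zero: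
  assumes "edge_vector m e" "m \<le> DIM('a)" "(x::'a::euclidean_space) \<bullet> e < 0"
  shows "hproj m e x \<bullet> e = 0"
  using edge_vector_unit[OF assms(1,2)] proj_inner_edge[OF assms(1,2), of x] assms(3)
  by (cases "e = 0") (auto simp: hproj_def inner_simps)

text \<open>Pythagoras, as \<open>x - proj m x\<close> is orthogonal to \<open>e\<close>. Both terms
  on the right are differentiable in \<open>x\<close>, whereas \<open>hproj\<close> has a corner at
  the edge; this form of the distance is the one differentiated along trajectories.\<close>

lemma norm_diff_hproj:
  assumes "edge_vector m e" "m \<le> DIM('a)"
  shows "(norm ((x::'a::euclidean_space) - hproj m e x))\<^sup>2 = (norm (x - proj m x))\<^sup>2 + (min 0 (x \<bullet> e))\<^sup>2"
proof -
  have o: "(x - proj m x) \<bullet> e = 0" by (rule proj_orth[OF assms(2) edge_vector_coord_plane[OF assms]])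
  have eq: "x - hproj m e x = (x - proj m x) + min 0 (x \<bullet> e) *\<^sub>R e" by (simp add: hproj_def)
  have "(min 0 (x \<bullet> e))\<^sup>2 * (e \<bullet> e) = (min 0 (x \<bullet> e))\<^sup>2"
    using edge_vector_unit[OF assms] by (cases "e = 0") auto
  then show ?thesis unfolding eq power2_norm_eq_inner using o
    by (simp add: inner_add_left inner_add_right inner_commute power2_eq_square)
qed

lemma norm_proj_le:
  assumes "m \<le> DIM('a)" shows "norm (proj m (x::'a::euclidean_space)) \<le> norm x"
proof -
  have "x = (x - proj m x) + proj m x" by simp
  moreover have "(x - proj m x) \<bullet> proj m x = 0" by (rule proj_orth[OF assms proj_in_coord_plane[OF assms]])
  ultimately have "(norm x)\<^sup>2 = (norm (x - proj m x))\<^sup>2 + (norm (proj m x))\<^sup>2"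
    by (metis norm_add_Pythagorean orthogonal_def)
  then have "(norm (proj m x))\<^sup>2 \<le> (norm x)\<^sup>2" by simp
  then show ?thesis by (rule power2_le_imp_le) simp
qed

text \<open>Projection to a convex set brings a point no farther from any point of the set. It keeps
  projected trajectories in the ball where the field is Lipschitz.\<close>

lemma dist_hproj_le:
  assumes "edge_vector m e" "m \<le> DIM('a)" "(u::'a::euclidean_space) \<in> hspace m e"
  shows "norm (hproj m e x - u) \<le> norm (x - u)"
proof -
  have u: "u \<in> coord_plane m" "u \<bullet> e \<ge> 0" using assms(3) by (auto simp: hspace_def)
  have pu: "proj m x - u = proj m (x - u)" using linear_diff[OF linear_proj, of m x u] proj_fix[OF assms(2) u(1)] by simp
  have "(norm (hproj m e x - u))\<^sup>2 \<le> (norm (proj m (x - u)))\<^sup>2"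
  proof (cases "x \<bullet> e < 0")
    case False
    then show ?thesis by (simp add: hproj_def pu)
  next
    case True
    define s where "s = x \<bullet> e"
    have ee: "e \<bullet> e = 1" using True edge_vector_unit[OF assms(1,2)] by (cases "e = 0") auto
    have eq: "hproj m e x - u = proj m (x - u) - s *\<^sub>R e"
      using True by (simp add: hproj_def pu[symmetric] s_def)
    have pe: "proj m (x - u) \<bullet> e = s - u \<bullet> e"
      by (simp add: proj_inner_edge[OF assms(1,2)] inner_diff_left s_def)
    have "(norm (hproj m e x - u))\<^sup>2 = (norm (proj m (x - u)))\<^sup>2 - 2 * s * (s - u \<bullet> e) + s * s"
      unfolding eq power2_norm_eq_inner using ee pe
      by (simp add: inner_diff_left inner_diff_right inner_commute)
    also have "\<dots> = (norm (proj m (x - u)))\<^sup>2 - s * s + 2 * (s * (u \<bullet> e))" by (simp add: algebra_simps)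
    also have "\<dots> \<le> (norm (proj m (x - u)))\<^sup>2"
    proof -
      have "s * (u \<bullet> e) \<le> 0" using True u by (simp add: s_def mult_nonpos_nonneg)
      moreover have "s * s \<ge> 0" by simp
      ultimately show ?thesis by linarith
    qed
    finally show ?thesis .
  qed
  also have "\<dots> \<le> (norm (x - u))\<^sup>2" using norm_proj_le[OF assms(2)] by (simp add: power_mono)
  finally show ?thesis by (rule power2_le_imp_le) simp
qed

section \<open>Lipschitz estimates, Gronwall's inequality and uniqueness of flows\<close>

text \<open>The partial derivatives are bounded on the compact ball, their bounds add up to one for
  the operator norm, and convexity of the ball gives the mean value inequality.\<close>

lemma C1_lipschitz:
  fixes Y :: "'a::euclidean_space \<Rightarrow> 'b::real_normed_vector"
  assumes V: "open V" "cball c r \<subseteq> V" and Y: "Ck_on 1 Basis V Y"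
  shows "\<exists>B\<ge>0. \<forall>x\<in>cball c r. \<forall>y\<in>cball c r. norm (Y x - Y y) \<le> B * norm (x - y)"
proof -
  have Y1: "Ck_on (enat (Suc 0)) Basis V Y" using Y by (simp add: one_enat_def)
  have d: "Y differentiable_on V" using Ck_on_differentiable[OF Y] by simp
  have c: "continuous_on V (pd V i Y)" if "i \<in> Basis" for i
    using Y1 that by (simp only: Ck_on_Suc Ck_on_0)
  have "\<forall>i\<in>Basis. \<exists>b. b \<ge> 0 \<and> (\<forall>x\<in>cball c r. norm (pd V i Y x) \<le> b)"
  proof
    fix i :: 'a assume i: "i \<in> Basis"
    have "compact (pd V i Y ` cball c r)"
      by (rule compact_continuous_image[OF continuous_on_subset[OF c[OF i] V(2)] compact_cball])
    then have "bounded (pd V i Y ` cball c r)" by (rule compact_imp_bounded)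
    then obtain b where "b > 0" "\<forall>y\<in>pd V i Y ` cball c r. norm y \<le> b" unfolding bounded_pos by blast
    then show "\<exists>b. b \<ge> 0 \<and> (\<forall>x\<in>cball c r. norm (pd V i Y x) \<le> b)" by (intro exI[of _ b]) auto
  qed
  from bchoice[OF this] obtain b where b: "\<And>i. i \<in> Basis \<Longrightarrow> b i \<ge> 0"
    "\<And>i x. i \<in> Basis \<Longrightarrow> x \<in> cball c r \<Longrightarrow> norm (pd V i Y x) \<le> b i" by blast
  define B where "B = (\<Sum>i\<in>Basis. b i)"
  have on: "onorm (frechet_derivative Y (at x)) \<le> B" if x: "x \<in> cball c r" for x
  proof (rule onorm_bound)
    have xV: "x \<in> V" using x V by auto
    have D: "(Y has_derivative frechet_derivative Y (at x)) (at x)"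
      using has_derivative_frechet_within[OF d xV] at_within_open[OF xV V(1)] by simp
    fix v
    have "frechet_derivative Y (at x) v = frechet_derivative Y (at x) (\<Sum>i\<in>Basis. (v \<bullet> i) *\<^sub>R i)"
      by (simp add: euclidean_representation)
    also have "\<dots> = (\<Sum>i\<in>Basis. (v \<bullet> i) *\<^sub>R pd V i Y x)"
      using has_derivative_linear[OF D] at_within_open[OF xV V(1)] by (simp add: linear_sum linear_cmul)
    also have "norm \<dots> \<le> (\<Sum>i\<in>Basis. norm v * b i)"
    proof (rule order_trans[OF norm_sum sum_mono])
      fix i :: 'a assume i: "i \<in> Basis"
      show "norm ((v \<bullet> i) *\<^sub>R pd V i Y x) \<le> norm v * b i"
        using b[OF i] x Basis_le_norm[OF i, of v] by (simp add: mult_mono)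
    qed
    finally show "norm (frechet_derivative Y (at x) v) \<le> B * norm v"
      by (simp add: B_def sum_distrib_left[symmetric] mult.commute)
  qed (use b B_def in \<open>auto intro: sum_nonneg\<close>)
  show ?thesis
  proof (intro exI[of _ B] conjI ballI)
    show "B \<ge> 0" using b by (auto simp: B_def intro: sum_nonneg)
    fix x y assume xy: "x \<in> cball c r" "y \<in> cball c r"
    show "norm (Y x - Y y) \<le> B * norm (x - y)"
    proof (rule differentiable_bound[OF convex_cball _ on xy(1,2)])
      fix z assume z: "z \<in> cball c r"
      then have zV: "z \<in> V" using V by auto
      show "(Y has_derivative frechet_derivative Y (at z)) (at z within cball c r)"
        using has_derivative_frechet_within[OF d zV] at_within_open[OF zV V(1)] has_derivative_at_withinI by metis
    qed
  qed
qed

text \<open>Multiplication by \<open>exp (- C * t)\<close> absorbs the growth: the product is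
  nonincreasing and starts at 0.\<close>

lemma gronwall_zero:
  fixes \<delta> :: "real \<Rightarrow> real"
  assumes T: "T \<ge> 0" and d: "\<And>t. 0 \<le> t \<Longrightarrow> t \<le> T \<Longrightarrow> (\<delta> has_real_derivative \<delta>' t) (at t)"
    and le: "\<And>t. 0 \<le> t \<Longrightarrow> t \<le> T \<Longrightarrow> \<delta>' t \<le> C * \<delta> t" and 0: "\<delta> 0 = 0"
  shows "\<delta> T \<le> 0"
proof -
  have "\<delta> T * exp (- C * T) \<le> \<delta> 0 * exp (- C * 0)"
  proof (rule DERIV_nonpos_imp_nonincreasing[OF T])
    fix t assume t: "0 \<le> t" "t \<le> T"
    have "((\<lambda>t. \<delta> t * exp (- C * t)) has_real_derivative (\<delta>' t - C * \<delta> t) * exp (- C * t)) (at t)"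
      using d[OF t] by (auto intro!: derivative_eq_intros simp: algebra_simps)
    moreover have "(\<delta>' t - C * \<delta> t) * exp (- C * t) \<le> 0"
      using le[OF t] by (intro mult_nonpos_nonneg) auto
    ultimately show "\<exists>y. ((\<lambda>t. \<delta> t * exp (- C * t)) has_real_derivative y) (at t) \<and> y \<le> 0" by blast
  qed
  then have "\<delta> T * exp (- C * T) \<le> 0" using 0 by simp
  then show ?thesis by (simp add: mult_le_0_iff)
qed

lemma has_real_derivative_norm_square:
  fixes f :: "real \<Rightarrow> 'a::real_inner"
  assumes "(f has_vector_derivative f') (at t)"
  shows "((\<lambda>t. (norm (f t))\<^sup>2) has_real_derivative 2 * (f t \<bullet> f')) (at t)"
proof -
  have "(f has_derivative (\<lambda>s. s *\<^sub>R f')) (at t)" using assms by (simp add: has_vector_derivative_def)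
  from has_derivative_inner[OF this this]
  have "((\<lambda>t. f t \<bullet> f t) has_derivative (\<lambda>s. f t \<bullet> (s *\<^sub>R f') + (s *\<^sub>R f') \<bullet> f t)) (at t)" .
  moreover have "(\<lambda>s. f t \<bullet> (s *\<^sub>R f') + (s *\<^sub>R f') \<bullet> f t) = (*) (2 * (f t \<bullet> f'))"
    by (auto simp: inner_commute)
  ultimately show ?thesis by (simp add: has_field_derivative_def power2_norm_eq_inner)
qed

lemma ode_unique_forward:
  fixes X :: "'a::euclidean_space \<Rightarrow> 'a"
  assumes X: "Ck_on 1 Basis UNIV X"
    and y: "\<And>t. (y has_vector_derivative X (y t)) (at t)" and z: "\<And>t. (z has_vector_derivative X (z t)) (at t)"
    and 0: "y 0 = z 0" and T: "T \<ge> 0"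
  shows "y T = z T"
proof -
  have "continuous_on {0..T} y"
    by (rule continuous_at_imp_continuous_on) (use has_vector_derivative_continuous[OF y] in auto)
  moreover have "continuous_on {0..T} z"
    by (rule continuous_at_imp_continuous_on) (use has_vector_derivative_continuous[OF z] in auto)
  ultimately have "compact (y ` {0..T} \<union> z ` {0..T})"
    by (intro compact_Un compact_continuous_image) auto
  then have "bounded (y ` {0..T} \<union> z ` {0..T})" by (rule compact_imp_bounded)
  \<comment> \<open>Over a bounded time both trajectories stay in one ball, which supplies a
    Lipschitz constant; Gronwall is then applied to their squared distance.\<close>
  then obtain r where r: "y ` {0..T} \<union> z ` {0..T} \<subseteq> cball 0 r"
    unfolding bounded_iff by (metis mem_cball_0 subsetI)
  obtain B where B: "B \<ge> 0" "\<And>x y. x \<in> cball 0 r \<Longrightarrow> y \<in> cball 0 r \<Longrightarrow> norm (X x - X y) \<le> B * norm (x - y)"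
    using C1_lipschitz[where c = 0 and r = r, OF open_UNIV subset_UNIV X] by blast
  have "(norm (y T - z T))\<^sup>2 \<le> 0"
  proof (rule gronwall_zero[OF T, where C = "2 * B"])
    fix t assume t: "0 \<le> t" "t \<le> T"
    show "((\<lambda>t. (norm (y t - z t))\<^sup>2) has_real_derivative 2 * ((y t - z t) \<bullet> (X (y t) - X (z t)))) (at t)"
      by (intro has_real_derivative_norm_square has_vector_derivative_diff y z)
    have "t \<in> {0..T}" using t by simp
    then have "y t \<in> cball 0 r" "z t \<in> cball 0 r" using r by blast+
    then have "(y t - z t) \<bullet> (X (y t) - X (z t)) \<le> norm (y t - z t) * (B * norm (y t - z t))"
      by (intro order_trans[OF norm_cauchy_schwarz] mult_left_mono B) auto
    then show "2 * ((y t - z t) \<bullet> (X (y t) - X (z t))) \<le> 2 * B * (norm (y t - z t))\<^sup>2"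
      by (simp add: power2_eq_square algebra_simps)
  qed (use 0 in simp)
  then show ?thesis by simp
qed

lemma Ck_on_uminus: "ray_set S B \<Longrightarrow> Ck_on k B S f \<Longrightarrow> Ck_on k B S (\<lambda>x. - f x)"
  using Ck_on_scaleR_const[of S B k f "-1"] by simp

lemma has_vector_derivative_reverse:
  assumes "(y has_vector_derivative D) (at (- t))"
  shows "((\<lambda>t. y (- t)) has_vector_derivative - D) (at t)"
proof -
  have "(uminus has_vector_derivative (-1::real)) (at t)" by (auto intro!: derivative_eq_intros)
  from vector_diff_chain_at[OF this, of y D] assms show ?thesis by (simp add: o_def)
qed

lemma ode_unique:
  fixes X :: "'a::euclidean_space \<Rightarrow> 'a"
  assumes X: "Ck_on 1 Basis UNIV X"
    and y: "\<And>t. (y has_vector_derivative X (y t)) (at t)" and z: "\<And>t. (z has_vector_derivative X (z t)) (at t)"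
    and 0: "y 0 = z 0"
  shows "y T = z T"
proof (cases "T \<ge> 0")
  case True
  show ?thesis by (rule ode_unique_forward[OF X y z 0 True])
next
  case False
  have X': "Ck_on 1 Basis UNIV (\<lambda>x. - X x)" by (rule Ck_on_uminus[OF ray_set_open[OF open_UNIV] X])
  have "(\<lambda>t. y (- t)) (- T) = (\<lambda>t. z (- t)) (- T)"
  proof (rule ode_unique_forward[where y = "\<lambda>t. y (- t)" and z = "\<lambda>t. z (- t)", OF X'])
    show "((\<lambda>t. y (- t)) has_vector_derivative - X (y (- t))) (at t)" for t
      by (rule has_vector_derivative_reverse[OF y])
    show "((\<lambda>t. z (- t)) has_vector_derivative - X (z (- t))) (at t)" for t
      by (rule has_vector_derivative_reverse[OF z])
  qed (use 0 False in auto)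
  then show ?thesis by simp
qed

text \<open>Squaring removes the corner of \<open>min 0 s\<close>, so the penalty for leaving the
  half-plane can be differentiated along a trajectory.\<close>

lemma has_real_derivative_min_square: "((\<lambda>s::real. (min 0 s)\<^sup>2) has_real_derivative 2 * min 0 s) (at s)"
proof -
  consider "s < 0" | "s > 0" | "s = 0" by linarith
  then show ?thesis
  proof cases
    case 1
    have "((\<lambda>s. s\<^sup>2) has_real_derivative 2 * min 0 s) (at s)" using 1 by (auto intro!: derivative_eq_intros)
    then show ?thesis by (rule has_field_derivative_transform_within_open[of _ _ _ "{..<0}"]) (use 1 in auto)
  next
    case 2
    have "((\<lambda>s. 0) has_real_derivative 2 * min 0 s) (at s)" using 2 by auto
    then show ?thesis by (rule has_field_derivative_transform_within_open[of _ _ _ "{0<..}"]) (use 2 in auto)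
  next
    case 3
    have "((\<lambda>h. (min 0 h)\<^sup>2 / h) \<longlongrightarrow> 0) (at (0::real))"
    proof (rule Lim_null_comparison)
      show "\<forall>\<^sub>F h in at 0. norm ((min 0 h)\<^sup>2 / h) \<le> \<bar>h::real\<bar>"
        by (auto simp: eventually_at_filter min_def power2_eq_square)
      show "((\<lambda>h. \<bar>h\<bar>) \<longlongrightarrow> 0) (at (0::real))" by (rule tendsto_rabs_zero) simp
    qed
    then show ?thesis using 3 by (simp add: DERIV_def)
  qed
qed

text \<open>
  Nagumo invariance: the squared distance to the model space satisfies Gronwall's inequality, because
  \<open>u - hproj m e u\<close> is orthogonal to \<open>Y\<close> at \<open>hproj m e u\<close>.
\<close>

lemma viability_forward:
  fixes Y :: "'a::euclidean_space \<Rightarrow> 'a"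
  assumes m: "m \<le> DIM('a)" and e: "edge_vector m e" and V: "open V" and Y: "Ck_on 1 Basis V Y"
    and tan: "\<And>y. y \<in> V \<inter> hspace m e \<Longrightarrow> Y y \<in> coord_plane m"
    and bd: "\<And>y. y \<in> V \<inter> hspace m e \<Longrightarrow> y \<bullet> e = 0 \<Longrightarrow> Y y \<bullet> e = 0"
    and u0: "u 0 \<in> V \<inter> hspace m e" and e0: "e0 > 0"
    and u: "\<And>t. \<bar>t\<bar> < e0 \<Longrightarrow> (u has_vector_derivative Y (u t)) (at t)"
  shows "\<exists>\<epsilon>>0. \<forall>t. 0 \<le> t \<and> t < \<epsilon> \<longrightarrow> u t \<in> hspace m e"
proof -
  obtain r where r: "r > 0" "cball (u 0) r \<subseteq> V" using u0 V by (meson IntD1 open_contains_cball)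
  obtain B where B: "B \<ge> 0" "\<And>x y. x \<in> cball (u 0) r \<Longrightarrow> y \<in> cball (u 0) r \<Longrightarrow> norm (Y x - Y y) \<le> B * norm (x - y)"
    using C1_lipschitz[OF V r(2) Y] by blast
  have "continuous (at 0) u" using u[of 0] e0 has_vector_derivative_continuous by auto
  then obtain e1 where e1: "e1 > 0" "\<And>t. \<bar>t\<bar> < e1 \<Longrightarrow> u t \<in> cball (u 0) r"
    using r unfolding continuous_at_eps_delta
    by (metis dist_commute dist_real_def diff_zero less_imp_le mem_cball)
  show ?thesis
  proof (intro exI[of _ "min e0 e1"] conjI allI impI)
    show "min e0 e1 > 0" using e0 e1 by simp
    fix T assume T: "0 \<le> T \<and> T < min e0 e1"
    define w where "w t = u t - hproj m e (u t)" for t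
    define \<delta> where "\<delta> t = (norm (u t - proj m (u t)))\<^sup>2 + (min 0 (u t \<bullet> e))\<^sup>2" for t
    have \<delta>w: "\<delta> t = (norm (w t))\<^sup>2" for t unfolding \<delta>_def w_def by (simp add: norm_diff_hproj[OF e m])
    have "\<delta> T \<le> 0"
    proof (rule gronwall_zero[where C = "2 * B" and \<delta> = \<delta> and \<delta>' = "\<lambda>t. 2 * (w t \<bullet> Y (u t))"])
      show "0 \<le> T" using T by simp
      have h0: "u 0 \<in> hspace m e" using u0 by blast
      then show "\<delta> 0 = 0" by (simp add: \<delta>_def hspace_def proj_fix[OF m])
      fix t assume t: "0 \<le> t" "t \<le> T"
      let ?z = "hproj m e (u t)"
      have ut: "(u has_vector_derivative Y (u t)) (at t)" using t T by (intro u) auto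
      have 1: "((\<lambda>t. u t - proj m (u t)) has_vector_derivative Y (u t) - proj m (Y (u t))) (at t)"
        by (intro has_vector_derivative_diff ut bounded_linear.has_vector_derivative[OF bounded_linear_proj])
      have 2: "((\<lambda>t. u t \<bullet> e) has_real_derivative Y (u t) \<bullet> e) (at t)"
        unfolding has_real_derivative_iff_has_vector_derivative
        by (rule bounded_linear.has_vector_derivative[OF bounded_linear_inner_left ut])
      have 3: "((\<lambda>t. (min 0 (u t \<bullet> e))\<^sup>2) has_real_derivative 2 * min 0 (u t \<bullet> e) * (Y (u t) \<bullet> e)) (at t)"
        by (rule DERIV_chain2[OF has_real_derivative_min_square 2])
      have p0: "(u t - proj m (u t)) \<bullet> proj m (Y (u t)) = 0" by (rule proj_orth[OF m proj_in_coord_plane[OF m]])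
      have w: "w t = (u t - proj m (u t)) + min 0 (u t \<bullet> e) *\<^sub>R e" by (simp add: w_def hproj_def)
      have eq: "2 * ((u t - proj m (u t)) \<bullet> (Y (u t) - proj m (Y (u t)))) + 2 * min 0 (u t \<bullet> e) * (Y (u t) \<bullet> e) = 2 * (w t \<bullet> Y (u t))"
        unfolding w using p0 by (simp add: inner_diff_right inner_add_left inner_commute[of e])
      show "(\<delta> has_real_derivative 2 * (w t \<bullet> Y (u t))) (at t)"
        unfolding \<delta>_def eq[symmetric] by (rule DERIV_add[OF has_real_derivative_norm_square[OF 1] 3])
      have uc: "u t \<in> cball (u 0) r" using e1(2) t T by auto
      \<comment> \<open>The projected point must also lie in the ball around \<open>u 0\<close>,
        since the Lipschitz bound compares the field at both points.\<close>
      have "norm (?z - u 0) \<le> norm (u t - u 0)" by (rule dist_hproj_le[OF e m h0])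
      then have zc: "?z \<in> cball (u 0) r" using uc by (simp add: dist_norm norm_minus_commute)
      then have zV: "?z \<in> V \<inter> hspace m e" using r hproj_in_hspace[OF e m] by blast
      have "(u t - proj m (u t)) \<bullet> Y ?z = 0" by (rule proj_orth[OF m tan[OF zV]])
      \<comment> \<open>Either the height is nonnegative and the first factor vanishes, or the
        projection lies on the edge, where \<open>bd\<close> kills the second.\<close>
      moreover have "min 0 (u t \<bullet> e) * (Y ?z \<bullet> e) = 0"
        using bd[OF zV] hproj_edge_zero[OF e m, of "u t"] by (cases "u t \<bullet> e < 0") auto
      ultimately have "w t \<bullet> Y ?z = 0" unfolding w by (simp add: inner_add_left inner_commute[of e])
      then have "w t \<bullet> Y (u t) = w t \<bullet> (Y (u t) - Y ?z)" by (simp add: inner_diff_right)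
      also have "\<dots> \<le> norm (w t) * (B * norm (w t))"
        unfolding w_def by (intro order_trans[OF norm_cauchy_schwarz] mult_left_mono B uc zc norm_ge_zero)
      finally show "2 * (w t \<bullet> Y (u t)) \<le> 2 * B * \<delta> t" by (simp add: \<delta>w power2_eq_square algebra_simps)
    qed
    then have "w T = 0" by (simp add: \<delta>w)
    then have "u T = hproj m e (u T)" by (simp add: w_def)
    then show "u T \<in> hspace m e" using hproj_in_hspace[OF e m, of "u T"] by simp
  qed
qed

text \<open>Negative times follow from the forward statement for the reversed curve, which solves
  the equation of \<open>- Y\<close>; tangency is insensitive to the sign.\<close>

lemma viability:
  fixes Y :: "'a::euclidean_space \<Rightarrow> 'a"
  assumes m: "m \<le> DIM('a)" and e: "edge_vector m e" and V: "open V" and Y: "Ck_on 1 Basis V Y"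
    and tan: "\<And>y. y \<in> V \<inter> hspace m e \<Longrightarrow> Y y \<in> coord_plane m"
    and bd: "\<And>y. y \<in> V \<inter> hspace m e \<Longrightarrow> y \<bullet> e = 0 \<Longrightarrow> Y y \<bullet> e = 0"
    and u0: "u 0 \<in> V \<inter> hspace m e" and e0: "e0 > 0"
    and u: "\<And>t. \<bar>t\<bar> < e0 \<Longrightarrow> (u has_vector_derivative Y (u t)) (at t)"
  shows "\<exists>\<epsilon>>0. \<forall>t. \<bar>t\<bar> < \<epsilon> \<longrightarrow> u t \<in> hspace m e"
proof -
  have "\<exists>\<epsilon>>0. \<forall>t. 0 \<le> t \<and> t < \<epsilon> \<longrightarrow> u t \<in> hspace m e"
    by (rule viability_forward[OF m e V Y tan bd u0 e0 u])
  then obtain \<epsilon> where \<epsilon>: "\<epsilon> > 0" "\<And>t. 0 \<le> t \<and> t < \<epsilon> \<Longrightarrow> u t \<in> hspace m e" by blast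
  have "\<exists>\<epsilon>>0. \<forall>t. 0 \<le> t \<and> t < \<epsilon> \<longrightarrow> u (- t) \<in> hspace m e"
  proof (rule viability_forward[where u = "\<lambda>t. u (- t)", OF m e V Ck_on_uminus[OF ray_set_open[OF V] Y] _ _ _ e0])
    show "- Y y \<in> coord_plane m" if "y \<in> V \<inter> hspace m e" for y
      using tan[OF that] subspace_neg[OF subspace_coord_plane] by blast
    show "- Y y \<bullet> e = 0" if "y \<in> V \<inter> hspace m e" "y \<bullet> e = 0" for y using bd[OF that] by simp
    show "u (- 0) \<in> V \<inter> hspace m e" using u0 by simp
    show "((\<lambda>t. u (- t)) has_vector_derivative - Y (u (- t))) (at t)" if "\<bar>t\<bar> < e0" for t
      using that by (intro has_vector_derivative_reverse u) auto
  qed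
  then obtain \<epsilon>' where \<epsilon>': "\<epsilon>' > 0" "\<And>t. 0 \<le> t \<and> t < \<epsilon>' \<Longrightarrow> u (- t) \<in> hspace m e" by blast
  show ?thesis
  proof (intro exI[of _ "min \<epsilon> \<epsilon>'"] conjI allI impI)
    fix t assume "\<bar>t\<bar> < min \<epsilon> \<epsilon>'"
    then show "u t \<in> hspace m e" using \<epsilon>(2)[of t] \<epsilon>'(2)[of "- t"] by (cases "t \<ge> 0") auto
  qed (use \<epsilon> \<epsilon>' in auto)
qed

section \<open>Reflection across the boundary of a half-plane\<close>

text \<open>The \<open>n\<close>-th finite difference annihilates polynomials of degree below
  \<open>n\<close>. The base point \<open>c\<close> is left general because absorbing the factor
  \<open>j\<close> into the binomial coefficient shifts both \<open>j\<close> and \<open>c\<close>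
  by one.\<close>

lemma alternating_binomial_power_sum:
  fixes c :: real
  shows "i < n \<Longrightarrow> (\<Sum>j\<le>n. (-1) ^ j * real (n choose j) * (c - real j) ^ i) = 0"
proof (induction i arbitrary: n c)
  case 0
  then show ?case using choose_alternating_sum[of n, where ?'a = real] by simp
next
  case (Suc i)
  then obtain p where p: "n = Suc p" "i < p" by (cases n) auto
  have "(\<Sum>j\<le>Suc p. (-1) ^ j * real (Suc p choose j) * (real j * (c - real j) ^ i)) =
      (\<Sum>j\<le>p. (-1) ^ Suc j * real (Suc p choose Suc j) * (real (Suc j) * (c - real (Suc j)) ^ i))"
    by (subst sum.atMost_Suc_shift) simp
  also have "\<dots> = (\<Sum>j\<le>p. - real (Suc p) * ((-1) ^ j * real (p choose j) * ((c - 1) - real j) ^ i))"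
  proof (rule sum.cong[OF refl])
    fix j
    have "real (Suc j) * real (Suc p choose Suc j) = real (Suc p) * real (p choose j)"
      by (simp only: of_nat_mult[symmetric] Suc_times_binomial)
    then have "real (Suc j) * real (Suc p choose Suc j) * ((-1) ^ Suc j * (c - real (Suc j)) ^ i) =
      real (Suc p) * real (p choose j) * ((-1) ^ Suc j * (c - real (Suc j)) ^ i)" by simp
    then show "(-1) ^ Suc j * real (Suc p choose Suc j) * (real (Suc j) * (c - real (Suc j)) ^ i) =
      - real (Suc p) * ((-1) ^ j * real (p choose j) * ((c - 1) - real j) ^ i)"
      by (simp add: algebra_simps)
  qed
  also have "\<dots> = 0"
    unfolding sum_distrib_left[symmetric] using Suc.IH[OF p(2), of "c - 1"] by simp
  finally have A: "(\<Sum>j\<le>Suc p. (-1) ^ j * real (Suc p choose j) * (real j * (c - real j) ^ i)) = 0" .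
  have "(\<Sum>j\<le>n. (-1) ^ j * real (n choose j) * (c - real j) ^ Suc i) =
      c * (\<Sum>j\<le>n. (-1) ^ j * real (n choose j) * (c - real j) ^ i) -
      (\<Sum>j\<le>n. (-1) ^ j * real (n choose j) * (real j * (c - real j) ^ i))"
    unfolding sum_distrib_left sum_subtractf[symmetric] by (rule sum.cong) (simp_all add: algebra_simps)
  then show ?case using A Suc.IH[of n c] Suc.prems p by simp
qed

text \<open>Extrapolation weights: applied to the values at 0, -1, ..., -N they reproduce the value
  at 1 of every polynomial of degree at most \<open>n\<close>.\<close>

definition moments :: "nat \<Rightarrow> nat \<Rightarrow> (nat \<Rightarrow> real) \<Rightarrow> bool" where
  "moments N n a \<longleftrightarrow> (\<forall>i\<le>n. (\<Sum>j\<le>N. a j * (- real j) ^ i) = 1)"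

text \<open>Take the vanishing difference of order \<open>k + 1\<close> with \<open>c = 1\<close>
  and isolate its term \<open>j = 0\<close>, which is 1; the remaining nodes \<open>1 - j\<close>
  become 0, -1, ..., -k.\<close>

lemma moments_exist: "moments k k (\<lambda>j. (-1) ^ j * real (Suc k choose Suc j))"
  unfolding moments_def
proof (intro allI impI)
  fix i assume i: "i \<le> k"
  have "(\<Sum>j\<le>Suc k. (-1) ^ j * real (Suc k choose j) * (1 - real j) ^ i) = 0"
    by (rule alternating_binomial_power_sum) (use i in simp)
  then show "(\<Sum>j\<le>k. (-1) ^ j * real (Suc k choose Suc j) * (- real j) ^ i) = 1"
    by (subst (asm) sum.atMost_Suc_shift) (simp add: sum_negf)
qed

lemma moments_mono: "moments N n a \<Longrightarrow> n' \<le> n \<Longrightarrow> moments N n' a"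
  by (simp add: moments_def)

text \<open>A derivative across the edge brings out the factor \<open>- real j\<close> from the
  sample at that height. The new weights satisfy one moment condition less.\<close>

lemma moments_Suc: "moments N (Suc n) a \<Longrightarrow> moments N n (\<lambda>j. a j * (- real j))"
  unfolding moments_def
proof (intro allI impI)
  fix i assume a: "\<forall>i\<le>Suc n. (\<Sum>j\<le>N. a j * (- real j) ^ i) = 1" and i: "i \<le> n"
  have "(\<Sum>j\<le>N. a j * (- real j) * (- real j) ^ i) = (\<Sum>j\<le>N. a j * (- real j) ^ Suc i)"
    by (simp add: mult.assoc)
  then show "(\<Sum>j\<le>N. a j * (- real j) * (- real j) ^ i) = 1" using a[rule_format, of "Suc i"] i by simp
qed

section \<open>Extension of functions across the edge\<close>

text \<open>For a unit edge vector the height is multiplied by \<open>- real j\<close>; the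
  coefficient is \<open>1 + real j\<close> because \<open>proj m x\<close> still carries the
  original height. The sample \<open>j = 0\<close> lies on the edge itself.\<close>

definition refl_map :: "nat \<Rightarrow> 'a::euclidean_space \<Rightarrow> nat \<Rightarrow> 'a \<Rightarrow> 'a" where
  "refl_map m e j x = proj m x - ((1 + real j) * (x \<bullet> e)) *\<^sub>R e"

text \<open>
  Hestenes reflection: the moment conditions on \<open>a\<close> make the derivatives of the two branches agree
  on the hyperplane \<open>y \<bullet> e = 0\<close>.
\<close>

definition hestenes :: "nat \<Rightarrow> 'a::euclidean_space \<Rightarrow> nat \<Rightarrow> (nat \<Rightarrow> real) \<Rightarrow> ('a \<Rightarrow> 'b::real_normed_vector) \<Rightarrow> 'a \<Rightarrow> 'b" where
  "hestenes m e N a v y = (if 0 \<le> y \<bullet> e then v (proj m y) else (\<Sum>j\<le>N. a j *\<^sub>R v (refl_map m e j y)))"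

lemma bounded_linear_refl_map: "bounded_linear (refl_map m e j :: 'a::euclidean_space \<Rightarrow> 'a)"
proof -
  have "bounded_linear (\<lambda>x::'a. proj m x - ((x \<bullet> e) *\<^sub>R ((1 + real j) *\<^sub>R e)))"
    by (intro bounded_linear_sub bounded_linear_proj bounded_linear_scaleR_left[THEN bounded_linear_compose] bounded_linear_inner_left)
  then show ?thesis by (simp add: refl_map_def[abs_def] mult.commute)
qed

lemma has_derivative_within_Un:
  assumes "(f has_derivative f') (at x within S)" "(f has_derivative f') (at x within T)"
  shows "(f has_derivative f') (at x within S \<union> T)"
  using assms unfolding has_derivative_within Lim_within_Un by blast

text \<open>\<open>B\<close> is the region to be filled and \<open>K\<close> the part of the domain
  of \<open>v\<close> at which the construction samples. Keeping them apart lets a jet bound on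
  \<open>K\<close> control the extension on all of \<open>B\<close>.\<close>

locale extension_domain =
  fixes m N :: nat and e :: "'a::euclidean_space" and V B K :: "'a set"
  assumes m: "m \<le> DIM('a)" and e: "edge_vector m e" and V: "open V" and B: "open B"
    and K: "K \<subseteq> V \<inter> hspace m e"
    and BP: "\<And>y. y \<in> B \<Longrightarrow> 0 \<le> y \<bullet> e \<Longrightarrow> proj m y \<in> K"
    and BR: "\<And>y j. y \<in> B \<Longrightarrow> y \<bullet> e \<le> 0 \<Longrightarrow> j \<le> N \<Longrightarrow> refl_map m e j y \<in> K"
begin

abbreviation "S \<equiv> V \<inter> hspace m e"
abbreviation "Bm \<equiv> (ebasis ` {..<m} :: 'a set)"

lemma refl_map_edge: "y \<bullet> e = 0 \<Longrightarrow> refl_map m e j y = proj m y"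
  by (simp add: refl_map_def)

text \<open>On the edge all samples coincide and the weights sum to 1 by the zeroth moment, so both
  branches agree there.\<close>

lemma hestenes_lower:
  assumes "moments N n a" "y \<bullet> e \<le> 0"
  shows "hestenes m e N a v y = (\<Sum>j\<le>N. a j *\<^sub>R v (refl_map m e j y))"
proof (cases "y \<bullet> e = 0")
  case True
  have "(\<Sum>j\<le>N. a j) = 1" using assms(1) by (auto simp: moments_def dest!: spec[of _ 0])
  then show ?thesis using True by (simp add: hestenes_def refl_map_edge scaleR_left.sum[symmetric])
qed (use assms in \<open>simp add: hestenes_def\<close>)

lemma hestenes_continuous:
  assumes v: "continuous_on S v" and a: "moments N n a"
  shows "continuous_on B (hestenes m e N a v)"
proof -
  have "continuous_on B (\<lambda>y. if - (y \<bullet> e) \<le> 0 then v (proj m y) else (\<Sum>j\<le>N. a j *\<^sub>R v (refl_map m e j y)))"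
  proof (rule continuous_on_cases_le)
    show "continuous_on {t \<in> B. - (t \<bullet> e) \<le> 0} (\<lambda>y. v (proj m y))"
      by (rule continuous_on_compose2[OF v linear_continuous_on[OF bounded_linear_proj]]) (use BP K in auto)
    show "continuous_on {t \<in> B. 0 \<le> - (t \<bullet> e)} (\<lambda>y. \<Sum>j\<le>N. a j *\<^sub>R v (refl_map m e j y))"
    proof (intro continuous_on_sum continuous_on_scaleR continuous_on_const)
      fix j assume "j \<in> {..N}"
      then show "continuous_on {t \<in> B. 0 \<le> - (t \<bullet> e)} (\<lambda>y. v (refl_map m e j y))"
        by (intro continuous_on_compose2[OF v linear_continuous_on[OF bounded_linear_refl_map]]) (use BR K in auto)
    qed
    show "continuous_on B (\<lambda>t. - (t \<bullet> e))" by (intro continuous_intros)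
    fix t assume "t \<in> B" "- (t \<bullet> e) = 0"
    then show "v (proj m t) = (\<Sum>j\<le>N. a j *\<^sub>R v (refl_map m e j t))"
      using hestenes_lower[OF a, of t v] by (simp add: hestenes_def)
  qed
  then show ?thesis by (simp add: hestenes_def[abs_def])
qed

text \<open>The closed pieces on either side of the edge are treated separately. At an edge point
  the moments of order 0 and 1 make the two derivatives the same linear map, and the pieces together
  fill \<open>B\<close>.\<close>

lemma hestenes_derivative:
  fixes v :: "'a \<Rightarrow> 'b::real_normed_vector"
  assumes v: "v differentiable_on S" and a: "moments N (Suc n) a" and y: "y \<in> B"
  defines "D \<equiv> \<lambda>z. frechet_derivative v (at z within S)"
  shows "(hestenes m e N a v has_derivative
    (\<lambda>h. if 0 \<le> y \<bullet> e then D (proj m y) (proj m h) else (\<Sum>j\<le>N. a j *\<^sub>R D (refl_map m e j y) (refl_map m e j h)))) (at y)"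
    (is "(_ has_derivative ?D) _")
proof -
  define A1 where "A1 = {x \<in> B. 0 \<le> x \<bullet> e}"
  define A2 where "A2 = {x \<in> B. x \<bullet> e \<le> 0}"
  have Dv: "(v has_derivative D z) (at z within S)" if "z \<in> K" for z
    unfolding D_def by (rule has_derivative_frechet_within[OF v]) (use that K in auto)
  have 1: "(hestenes m e N a v has_derivative (\<lambda>h. D (proj m y) (proj m h))) (at y within A1)" if yA: "y \<in> A1"
  proof (rule has_derivative_transform[OF yA])
    show "hestenes m e N a v x = v (proj m x)" if "x \<in> A1" for x using that by (simp add: hestenes_def A1_def)
    have "proj m ` A1 \<subseteq> S" using BP K by (auto simp: A1_def)
    moreover have "proj m y \<in> K" using yA BP by (simp add: A1_def)
    ultimately have "(v has_derivative D (proj m y)) (at (proj m y) within proj m ` A1)"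
      using has_derivative_subset[OF Dv] by blast
    then show "((\<lambda>x. v (proj m x)) has_derivative (\<lambda>h. D (proj m y) (proj m h))) (at y within A1)"
      by (rule has_derivative_in_compose[OF bounded_linear_imp_has_derivative[OF bounded_linear_proj]])
  qed
  have 2: "(hestenes m e N a v has_derivative (\<lambda>h. \<Sum>j\<le>N. a j *\<^sub>R D (refl_map m e j y) (refl_map m e j h))) (at y within A2)"
    if yA: "y \<in> A2"
  proof (rule has_derivative_transform[OF yA])
    show "hestenes m e N a v x = (\<Sum>j\<le>N. a j *\<^sub>R v (refl_map m e j x))" if "x \<in> A2" for x
      using that hestenes_lower[OF a, of x v] by (simp add: A2_def)
    show "((\<lambda>x. \<Sum>j\<le>N. a j *\<^sub>R v (refl_map m e j x)) has_derivative (\<lambda>h. \<Sum>j\<le>N. a j *\<^sub>R D (refl_map m e j y) (refl_map m e j h))) (at y within A2)"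
    proof (intro has_derivative_sum has_derivative_scaleR_right)
      fix j assume j: "j \<in> {..N}"
      have "refl_map m e j ` A2 \<subseteq> S" using BR K j by (auto simp: A2_def)
      moreover have "refl_map m e j y \<in> K" using yA BR j by (simp add: A2_def)
      ultimately have "(v has_derivative D (refl_map m e j y)) (at (refl_map m e j y) within refl_map m e j ` A2)"
        using has_derivative_subset[OF Dv] by blast
      then show "((\<lambda>x. v (refl_map m e j x)) has_derivative (\<lambda>h. D (refl_map m e j y) (refl_map m e j h))) (at y within A2)"
        by (rule has_derivative_in_compose[OF bounded_linear_imp_has_derivative[OF bounded_linear_refl_map]])
    qed
  qed
  consider "y \<bullet> e > 0" | "y \<bullet> e < 0" | "y \<bullet> e = 0" by linarith
  then show ?thesis
  proof cases
    case 1
    have "open (B \<inter> {x. x \<bullet> e > 0})" using B by (intro open_Int open_Collect_less continuous_intros)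
    then have "(hestenes m e N a v has_derivative (\<lambda>h. D (proj m y) (proj m h))) (at y within B \<inter> {x. x \<bullet> e > 0}) \<longleftrightarrow>
        (hestenes m e N a v has_derivative (\<lambda>h. D (proj m y) (proj m h))) (at y)"
      using 1 y by (subst at_within_open) auto
    moreover have "(hestenes m e N a v has_derivative (\<lambda>h. D (proj m y) (proj m h))) (at y within B \<inter> {x. x \<bullet> e > 0})"
      by (rule has_derivative_subset[OF \<open>y \<in> A1 \<Longrightarrow> _\<close>]) (use 1 y in \<open>auto simp: A1_def\<close>)
    ultimately show ?thesis using 1 by simp
  next
    case 2
    have "open (B \<inter> {x. x \<bullet> e < 0})" using B by (intro open_Int open_Collect_less continuous_intros)
    then have "(hestenes m e N a v has_derivative (\<lambda>h. \<Sum>j\<le>N. a j *\<^sub>R D (refl_map m e j y) (refl_map m e j h))) (at y within B \<inter> {x. x \<bullet> e < 0}) \<longleftrightarrow>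
        (hestenes m e N a v has_derivative (\<lambda>h. \<Sum>j\<le>N. a j *\<^sub>R D (refl_map m e j y) (refl_map m e j h))) (at y)"
      using 2 y by (subst at_within_open) auto
    moreover have "(hestenes m e N a v has_derivative (\<lambda>h. \<Sum>j\<le>N. a j *\<^sub>R D (refl_map m e j y) (refl_map m e j h))) (at y within B \<inter> {x. x \<bullet> e < 0})"
      by (rule has_derivative_subset[OF \<open>y \<in> A2 \<Longrightarrow> _\<close>]) (use 2 y in \<open>auto simp: A2_def\<close>)
    ultimately show ?thesis using 2 by simp
  next
    case 3
    then have yA: "y \<in> A1" "y \<in> A2" using y by (auto simp: A1_def A2_def)
    have "proj m y \<in> K" using yA BP by (simp add: A1_def)
    then have linD: "linear (D (proj m y))" using Dv has_derivative_linear by blast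
    have m0: "(\<Sum>j\<le>N. a j) = 1" using a by (auto simp: moments_def dest!: spec[of _ 0])
    have m1: "(\<Sum>j\<le>N. a j * (- real j)) = 1" using a by (auto simp: moments_def dest!: spec[of _ 1])
    \<comment> \<open>The normal component enters with these weights; their sum is the zeroth minus
      the first moment.\<close>
    have "(\<Sum>j\<le>N. a j * (1 + real j)) = (\<Sum>j\<le>N. a j - a j * (- real j))"
      by (rule sum.cong) (simp_all add: algebra_simps)
    then have m2: "(\<Sum>j\<le>N. a j * (1 + real j)) = 0" unfolding sum_subtractf m0 m1 by simp
    have eq: "(\<Sum>j\<le>N. a j *\<^sub>R D (refl_map m e j y) (refl_map m e j h)) = D (proj m y) (proj m h)" for h
    proof -
      have "(\<Sum>j\<le>N. a j *\<^sub>R D (refl_map m e j y) (refl_map m e j h)) =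
          (\<Sum>j\<le>N. a j *\<^sub>R D (proj m y) (proj m h) - (a j * (1 + real j)) *\<^sub>R ((h \<bullet> e) *\<^sub>R D (proj m y) e))"
        unfolding refl_map_edge[OF 3] refl_map_def[of m e _ h]
        by (rule sum.cong) (simp_all only: linear_diff[OF linD] linear_cmul[OF linD] scaleR_diff_right scaleR_scaleR mult.assoc)
      also have "\<dots> = (\<Sum>j\<le>N. a j) *\<^sub>R D (proj m y) (proj m h) - (\<Sum>j\<le>N. a j * (1 + real j)) *\<^sub>R ((h \<bullet> e) *\<^sub>R D (proj m y) e)"
        unfolding sum_subtractf scaleR_left.sum ..
      finally show ?thesis unfolding m0 m2 by simp
    qed
    have "(hestenes m e N a v has_derivative (\<lambda>h. D (proj m y) (proj m h))) (at y within A1 \<union> A2)"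
      by (rule has_derivative_within_Un[OF 1[OF yA(1)] 2[OF yA(2), unfolded eq]])
    moreover have "A1 \<union> A2 = B" by (auto simp: A1_def A2_def)
    ultimately have "(hestenes m e N a v has_derivative (\<lambda>h. D (proj m y) (proj m h))) (at y)"
      by (simp only: at_within_open[OF y B])
    moreover have "0 \<le> y \<bullet> e" using 3 by simp
    ultimately show ?thesis by (simp only: if_True)
  qed
qed

text \<open>The weights after a derivative in direction \<open>b\<close>: the reflections rescale
  only the edge normal.\<close>

definition shift_coeff :: "'a \<Rightarrow> (nat \<Rightarrow> real) \<Rightarrow> nat \<Rightarrow> real" where
  "shift_coeff b a = (if b = e then (\<lambda>j. a j * (- real j)) else a)"

lemma moments_shift_coeff: "moments N (Suc n) a \<Longrightarrow> moments N n (shift_coeff b a)"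
  by (cases "b = e") (simp_all only: shift_coeff_def if_True if_False moments_Suc moments_mono[of N "Suc n" a n] le_SucI order_refl simp_thms)

text \<open>Differentiation stays within the family of reflection operators, which turns the C^n
  claim into an induction. Directions transverse to the plane are annihilated by \<open>proj\<close>
  and give 0.\<close>

lemma pd_hestenes:
  fixes v :: "'a \<Rightarrow> 'b::real_normed_vector"
  assumes v: "v differentiable_on S" and a: "moments N (Suc n) a" and y: "y \<in> B" and b: "b \<in> Basis"
  shows "pd UNIV b (hestenes m e N a v) y =
    (if b \<in> Bm then hestenes m e N (shift_coeff b a) (pd S b v) y else 0)"
proof -
  let ?D = "\<lambda>z. frechet_derivative v (at z within S)"
  have p: "pd UNIV b (hestenes m e N a v) y =
    (if 0 \<le> y \<bullet> e then ?D (proj m y) (proj m b) else (\<Sum>j\<le>N. a j *\<^sub>R ?D (refl_map m e j y) (refl_map m e j b)))"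
    by (rule pd_eq[OF ray_set_open[OF open_UNIV] UNIV_I b hestenes_derivative[OF v a y]])
  have lin: "linear (?D z)" if "z \<in> K" for z
    using has_derivative_frechet_within[OF v, of z] that K has_derivative_linear by blast
  obtain i where i: "i < DIM('a)" "b = ebasis i"
    using b ebasis_bij[where 'a='a] by (force simp: bij_betw_def)
  show ?thesis
  proof (cases "b \<in> Bm")
    case True
    have pb: "proj m b = b" using True m by (auto intro!: proj_fix ebasis_coord_plane)
    have rb: "refl_map m e j b = (if b = e then - real j else 1) *\<^sub>R b" for j
    proof (cases "b = e")
      case True
      then have "e \<noteq> 0" using b nonzero_Basis by blast
      then have "e \<bullet> e = 1" using edge_vector_unit[OF e m] by blast
      then show ?thesis using True pb by (simp add: refl_map_def algebra_simps)
    next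
      case False
      have "b \<bullet> e = 0"
      proof (cases "e = 0")
        case e0: False
        then have "e \<in> Basis" using edge_vector_unit[OF e m] ebasis_image_subset[OF m] by blast
        then show ?thesis using False b by (simp add: inner_Basis)
      qed simp
      then show ?thesis using False pb by (simp add: refl_map_def)
    qed
    have "(\<Sum>j\<le>N. a j *\<^sub>R ?D (refl_map m e j y) (refl_map m e j b)) =
        (\<Sum>j\<le>N. shift_coeff b a j *\<^sub>R pd S b v (refl_map m e j y))" if "y \<bullet> e < 0"
    proof (rule sum.cong[OF refl])
      fix j assume "j \<in> {..N}"
      then have "refl_map m e j y \<in> K" using BR y that by auto
      then have l: "linear (?D (refl_map m e j y))" by (rule lin)
      show "a j *\<^sub>R ?D (refl_map m e j y) (refl_map m e j b) = shift_coeff b a j *\<^sub>R pd S b v (refl_map m e j y)"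
        unfolding rb linear_cmul[OF l] by (simp add: shift_coeff_def)
    qed
    then show ?thesis using True p pb by (simp add: hestenes_def)
  next
    case False
    then have im: "\<not> i < m" using i by auto
    have pb: "proj m b = 0"
      by (rule euclidean_eq_ebasis) (use i im m in \<open>simp add: proj_inner_ebasis inner_ebasis\<close>)
    have "b \<bullet> e = 0" using proj_inner_edge[OF e m, of b] pb by simp
    then have rb: "refl_map m e j b = 0" for j using pb by (simp add: refl_map_def)
    have 1: "?D (proj m y) 0 = 0" if "0 \<le> y \<bullet> e" by (rule linear_0[OF lin[OF BP[OF y that]]])
    have 2: "(\<Sum>j\<le>N. a j *\<^sub>R ?D (refl_map m e j y) 0) = 0" if "y \<bullet> e < 0"
    proof (rule sum.neutral, rule ballI)
      fix j assume "j \<in> {..N}"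
      then have "refl_map m e j y \<in> K" using BR y that by auto
      then show "a j *\<^sub>R ?D (refl_map m e j y) 0 = 0" using linear_0[OF lin] by simp
    qed
    show ?thesis using False p 1 2 unfolding pb rb by simp
  qed
qed

lemma norm_hestenes_le:
  assumes y: "y \<in> B" and s: "\<And>z. z \<in> K \<Longrightarrow> norm (v z) \<le> s"
  shows "norm (hestenes m e N a v y) \<le> (1 + (\<Sum>j\<le>N. \<bar>a j\<bar>)) * s" and "s \<ge> 0"
proof -
  have "\<exists>z. z \<in> K" using BP[OF y] BR[OF y, of 0] by (cases "0 \<le> y \<bullet> e") auto
  then show s0: "s \<ge> 0" using s norm_ge_zero order_trans by blast
  have A: "0 \<le> (\<Sum>j\<le>N. \<bar>a j\<bar>) * s" using s0 by (intro mult_nonneg_nonneg sum_nonneg) auto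
  show "norm (hestenes m e N a v y) \<le> (1 + (\<Sum>j\<le>N. \<bar>a j\<bar>)) * s"
  proof (cases "0 \<le> y \<bullet> e")
    case True
    then show ?thesis using s[OF BP[OF y True]] A by (simp add: hestenes_def distrib_right)
  next
    case False
    have "norm (\<Sum>j\<le>N. a j *\<^sub>R v (refl_map m e j y)) \<le> (\<Sum>j\<le>N. \<bar>a j\<bar> * s)"
      using s BR[OF y] False by (intro order_trans[OF norm_sum] sum_mono) (auto intro!: mult_left_mono)
    then show ?thesis using False s0 by (simp add: hestenes_def distrib_right sum_distrib_right)
  qed
qed

text \<open>The weights are arbitrary in the induction, since a normal derivative replaces them and
  uses up a moment condition. The bound is uniform in \<open>v\<close>, so the extension is a
  bounded operator.\<close>

lemma hestenes_Ck:
  assumes "moments N n a"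
  shows "\<exists>A\<ge>0. \<forall>v::'a \<Rightarrow> 'b::real_normed_vector. Ck_on (enat n) Bm S v \<longrightarrow>
    Ck_on (enat n) Basis B (hestenes m e N a v) \<and>
    (\<forall>s. \<forall>y\<in>B. (\<forall>z\<in>K. jet S Bm n v z \<le> s) \<longrightarrow> jet B Basis n (hestenes m e N a v) y \<le> A * s)"
  using assms
proof (induction n arbitrary: a)
  case 0
  show ?case
  proof (intro exI[of _ "1 + (\<Sum>j\<le>N. \<bar>a j\<bar>)"] conjI allI impI ballI)
    show "0 \<le> 1 + (\<Sum>j\<le>N. \<bar>a j\<bar>)" by (simp add: sum_nonneg add_nonneg_nonneg)
    fix v :: "'a \<Rightarrow> 'b" assume "Ck_on (enat 0) Bm S v"
    then show "Ck_on (enat 0) Basis B (hestenes m e N a v)"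
      unfolding Ck_on_0 by (rule hestenes_continuous[OF _ 0])
    fix s y assume y: "y \<in> B" and s: "\<forall>z\<in>K. jet S Bm 0 v z \<le> s"
    show "jet B Basis 0 (hestenes m e N a v) y \<le> (1 + (\<Sum>j\<le>N. \<bar>a j\<bar>)) * s"
      unfolding jet_0 by (rule norm_hestenes_le(1)[OF y]) (use s in \<open>simp add: jet_0\<close>)
  qed
next
  case (Suc n)
  have R: "ray_set B Basis" by (rule ray_set_open[OF B])
  have "\<forall>b\<in>Bm. \<exists>A. A \<ge> 0 \<and> (\<forall>v::'a \<Rightarrow> 'b. Ck_on (enat n) Bm S v \<longrightarrow>
    Ck_on (enat n) Basis B (hestenes m e N (shift_coeff b a) v) \<and>
    (\<forall>s. \<forall>y\<in>B. (\<forall>z\<in>K. jet S Bm n v z \<le> s) \<longrightarrow> jet B Basis n (hestenes m e N (shift_coeff b a) v) y \<le> A * s))"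
    using Suc.IH[OF moments_shift_coeff[OF Suc.prems]] by blast
  from bchoice[OF this] obtain A where A: "\<And>b. b \<in> Bm \<Longrightarrow> A b \<ge> 0"
    "\<And>b v. b \<in> Bm \<Longrightarrow> Ck_on (enat n) Bm S (v::'a \<Rightarrow> 'b) \<Longrightarrow> Ck_on (enat n) Basis B (hestenes m e N (shift_coeff b a) v)"
    "\<And>b v s y. b \<in> Bm \<Longrightarrow> Ck_on (enat n) Bm S (v::'a \<Rightarrow> 'b) \<Longrightarrow> y \<in> B \<Longrightarrow> (\<forall>z\<in>K. jet S Bm n v z \<le> s) \<Longrightarrow>
      jet B Basis n (hestenes m e N (shift_coeff b a) v) y \<le> A b * s"
    by blast
  have fin: "finite Bm" by simp
  \<comment> \<open>The first bracket bounds the value of the extension, the sum its derivatives;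
    directions outside the plane contribute nothing.\<close>
  define C where "C = (1 + (\<Sum>j\<le>N. \<bar>a j\<bar>)) + (\<Sum>b\<in>Basis. if b \<in> Bm then A b else 0)"
  show ?case
  proof (intro exI[of _ C] conjI allI impI ballI)
    show "0 \<le> C" unfolding C_def using A(1) by (intro add_nonneg_nonneg sum_nonneg) auto
    fix v :: "'a \<Rightarrow> 'b" assume v: "Ck_on (enat (Suc n)) Bm S v"
    then have vd: "v differentiable_on S" "continuous_on S v" by (simp_all only: Ck_on_Suc)
    have vb: "Ck_on (enat n) Bm S (pd S b v)" if "b \<in> Bm" for b by (rule Ck_on_pdD[OF v that])
    have pdB: "pd B b (hestenes m e N a v) y = (if b \<in> Bm then hestenes m e N (shift_coeff b a) (pd S b v) y else 0)"
      if "b \<in> Basis" "y \<in> B" for b y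
      using pd_hestenes[OF vd(1) Suc.prems that(2,1)] at_within_open[OF that(2) B] by simp
    show "Ck_on (enat (Suc n)) Basis B (hestenes m e N a v)"
      unfolding Ck_on_Suc
    proof (intro conjI ballI)
      show "continuous_on B (hestenes m e N a v)" by (rule hestenes_continuous[OF vd(2) Suc.prems])
      show "hestenes m e N a v differentiable_on B"
        unfolding differentiable_on_def
        using hestenes_derivative[OF vd(1) Suc.prems] has_derivative_at_withinI differentiableI by blast
      fix b :: 'a assume b: "b \<in> Basis"
      show "Ck_on (enat n) Basis B (pd B b (hestenes m e N a v))"
      proof (cases "b \<in> Bm")
        case True
        show ?thesis by (rule Ck_on_cong[OF A(2)[OF True vb[OF True]]]) (use pdB[OF b] True in simp)
      next
        case False
        show ?thesis by (rule Ck_on_cong[OF Ck_on_const[OF R, of _ 0]]) (use pdB[OF b] False in simp)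
      qed
    qed
    fix s y assume y: "y \<in> B" and s: "\<forall>z\<in>K. jet S Bm (Suc n) v z \<le> s"
    have sv: "norm (v z) \<le> s" if "z \<in> K" for z using norm_le_jet[OF fin, of v z S "Suc n"] s that by force
    have sb: "\<forall>z\<in>K. jet S Bm n (pd S b v) z \<le> s" if "b \<in> Bm" for b
      using jet_pd_le[OF fin that, of S n v] s order_trans by blast
    have "jet B Basis (Suc n) (hestenes m e N a v) y = norm (hestenes m e N a v y) + (\<Sum>b\<in>Basis. jet B Basis n (pd B b (hestenes m e N a v)) y)"
      by (rule jet_Suc) simp
    also have "\<dots> \<le> (1 + (\<Sum>j\<le>N. \<bar>a j\<bar>)) * s + (\<Sum>b\<in>Basis. (if b \<in> Bm then A b else 0) * s)"
    proof (intro add_mono sum_mono norm_hestenes_le(1)[OF y sv])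
      fix b :: 'a assume b: "b \<in> Basis"
      show "jet B Basis n (pd B b (hestenes m e N a v)) y \<le> (if b \<in> Bm then A b else 0) * s"
      proof (cases "b \<in> Bm")
        case True
        have "jet B Basis n (pd B b (hestenes m e N a v)) y = jet B Basis n (hestenes m e N (shift_coeff b a) (pd S b v)) y"
          by (rule jet_cong[OF _ y]) (use pdB[OF b] True in simp)
        then show ?thesis using A(3)[OF True vb[OF True] y sb[OF True]] True by simp
      next
        case False
        have "jet B Basis n (pd B b (hestenes m e N a v)) y = jet B Basis n (\<lambda>x. 0::'b) y"
          by (rule jet_cong[OF _ y]) (use pdB[OF b] False in simp)
        then show ?thesis using jet_zero[OF R y, of n, where ?'b = 'b] False by simp
      qed
    qed
    finally show "jet B Basis (Suc n) (hestenes m e N a v) y \<le> C * s"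
      by (simp add: C_def distrib_right sum_distrib_right)
  qed
qed

end

text \<open>A reflected sample is at most \<open>N + 2\<close> times as far from the centre as
  \<open>y\<close>: once for the projection and at most \<open>1 + N\<close> times for the vertical
  displacement. Hence the radius.\<close>

lemma extension_domain_ball:
  fixes y0 :: "'a::euclidean_space"
  assumes m: "m \<le> DIM('a)" and e: "edge_vector m e" and V: "open V" and y0: "y0 \<in> hspace m e"
    and R: "R > 0" "cball y0 R \<subseteq> V"
  shows "extension_domain m N e V (ball y0 (R / (real N + 3))) (cball y0 R \<inter> hspace m e)"
proof
  have y0c: "y0 \<in> coord_plane m" "0 \<le> y0 \<bullet> e" using y0 by (auto simp: hspace_def)
  have ne: "norm e \<le> 1" using edge_vector_unit[OF e m] by (cases "e = 0") (auto simp: norm_eq_sqrt_inner)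
  have small: "R / (real N + 3) \<le> R" using R by (simp add: divide_le_eq mult_left_le_one_le algebra_simps)
  have P: "norm (proj m y - y0) \<le> norm (y - y0)" for y
    using linear_diff[OF linear_proj, of m y y0] proj_fix[OF m y0c(1)] norm_proj_le[OF m, of "y - y0"] by simp
  fix y assume y: "y \<in> ball y0 (R / (real N + 3))"
  then have yr: "norm (y - y0) < R / (real N + 3)" by (simp add: dist_norm norm_minus_commute)
  show "proj m y \<in> cball y0 R \<inter> hspace m e" if "0 \<le> y \<bullet> e"
    using that proj_in_coord_plane[OF m, of y] proj_inner_edge[OF e m, of y] P[of y] yr small
    by (auto simp: hspace_def dist_norm norm_minus_commute)
  fix j assume ye: "y \<bullet> e \<le> 0" and j: "j \<le> N"
  have "refl_map m e j y \<in> coord_plane m"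
    unfolding refl_map_def
    by (intro subspace_diff subspace_scale subspace_coord_plane proj_in_coord_plane edge_vector_coord_plane m e)
  moreover have "refl_map m e j y \<bullet> e \<ge> 0"
  proof (cases "e = 0")
    case False
    then have "e \<bullet> e = 1" using edge_vector_unit[OF e m] by blast
    then have "refl_map m e j y \<bullet> e = - (real j * (y \<bullet> e))"
      by (simp add: refl_map_def inner_diff_left proj_inner_edge[OF e m] algebra_simps)
    then show ?thesis using ye by (simp add: mult_nonneg_nonpos)
  qed simp
  moreover have "norm (refl_map m e j y - y0) \<le> R"
  proof -
    \<comment> \<open>The centre lies on or above the edge and \<open>y\<close> on or below it, so
      the depth of \<open>y\<close> is at most its distance from the centre.\<close>
    have "\<bar>y \<bullet> e\<bar> \<le> \<bar>(y - y0) \<bullet> e\<bar>" using ye y0c by (simp add: inner_diff_left)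
    also have "\<dots> \<le> norm (y - y0) * norm e" by (rule Cauchy_Schwarz_ineq2)
    also have "\<dots> \<le> norm (y - y0)" using ne by (simp add: mult_left_le)
    finally have ae: "\<bar>y \<bullet> e\<bar> \<le> norm (y - y0)" .
    have "norm (refl_map m e j y - y0) \<le> norm (proj m y - y0) + norm (((1 + real j) * (y \<bullet> e)) *\<^sub>R e)"
      unfolding refl_map_def
      using norm_triangle_ineq4[of "proj m y - y0" "((1 + real j) * (y \<bullet> e)) *\<^sub>R e"]
      by (simp only: diff_diff_eq add.commute[of y0])
    also have "norm (((1 + real j) * (y \<bullet> e)) *\<^sub>R e) = (1 + real j) * \<bar>y \<bullet> e\<bar> * norm e"
      by (simp add: abs_mult)
    also have "\<dots> \<le> (1 + real j) * \<bar>y \<bullet> e\<bar>" using ne by (intro mult_left_le) auto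
    also have "\<dots> \<le> (1 + real N) * norm (y - y0)" using ae j by (intro mult_mono) auto
    finally have "norm (refl_map m e j y - y0) \<le> (real N + 2) * norm (y - y0)" using P[of y] by (simp add: algebra_simps)
    also have "\<dots> \<le> (real N + 3) * norm (y - y0)" by (intro mult_right_mono) auto
    also have "\<dots> \<le> R" using yr by (simp add: field_simps)
    finally show ?thesis .
  qed
  ultimately show "refl_map m e j y \<in> cball y0 R \<inter> hspace m e"
    by (simp add: hspace_def dist_norm norm_minus_commute)
qed (use assms in auto)

section \<open>Charts, tangent spaces and boundaries\<close>

lemma open_ray:
  fixes x w :: "'a::real_normed_vector"
  assumes "open S" "x \<in> S"
  shows "\<exists>d>0. \<forall>t. 0 \<le> t \<and> t < d \<longrightarrow> x + t *\<^sub>R w \<in> S"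
  using ray_set_open[OF assms(1), of "{w}"] assms(2) unfolding ray_set_def by blast

locale mfd_chart =
  fixes r :: enat and m :: nat and M U V :: "'a::euclidean_space set" and \<phi> \<psi> :: "'a \<Rightarrow> 'a" and e :: 'a
  assumes chart: "chart r M (hspace m e) U V \<phi> \<psi>" and m: "m \<le> DIM('a)"
    and e: "edge_vector m e" and r: "1 \<le> r"
begin

abbreviation "D\<phi> x \<equiv> frechet_derivative \<phi> (at x)"
abbreviation "D\<psi> y \<equiv> frechet_derivative \<psi> (at y)"

lemma open_U: "open U" and open_V: "open V" and Ck_phi: "Ck_on r Basis U \<phi>" and Ck_psi: "Ck_on r Basis V \<psi>"
  using chart by (auto simp: chart_def)

lemma phi_in: "x \<in> U \<Longrightarrow> \<phi> x \<in> V" and psi_in: "y \<in> V \<Longrightarrow> \<psi> y \<in> U"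
  and psi_phi: "x \<in> U \<Longrightarrow> \<psi> (\<phi> x) = x" and phi_psi: "y \<in> V \<Longrightarrow> \<phi> (\<psi> y) = y"
  using chart by (auto simp: chart_def homeomorphism_def)

lemma mem_M_iff: "x \<in> U \<Longrightarrow> x \<in> M \<longleftrightarrow> \<phi> x \<in> hspace m e"
proof -
  assume x: "x \<in> U"
  have eq: "\<phi> ` (U \<inter> M) = V \<inter> hspace m e" using chart by (auto simp: chart_def)
  show "x \<in> M \<longleftrightarrow> \<phi> x \<in> hspace m e"
  proof
    assume "\<phi> x \<in> hspace m e"
    then obtain z where "z \<in> U \<inter> M" "\<phi> z = \<phi> x" using eq phi_in[OF x] by (metis IntI imageE)
    then show "x \<in> M" using psi_phi x by (metis IntD1 IntD2)
  qed (use eq x in blast)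
qed

lemma psi_mem_M: "y \<in> V \<Longrightarrow> \<psi> y \<in> M \<longleftrightarrow> y \<in> hspace m e"
  using mem_M_iff[OF psi_in] phi_psi by simp

lemma has_derivative_phi: "x \<in> U \<Longrightarrow> (\<phi> has_derivative D\<phi> x) (at x)"
  using Ck_on_has_derivative[OF Ck_phi r] at_within_open[OF _ open_U] by metis

lemma has_derivative_psi: "y \<in> V \<Longrightarrow> (\<psi> has_derivative D\<psi> y) (at y)"
  using Ck_on_has_derivative[OF Ck_psi r] at_within_open[OF _ open_V] by metis

lemma linear_phi: "x \<in> U \<Longrightarrow> linear (D\<phi> x)" and linear_psi: "y \<in> V \<Longrightarrow> linear (D\<psi> y)"
  using has_derivative_phi has_derivative_psi has_derivative_linear by blast+

lemma Dpsi_Dphi: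
  assumes "x \<in> U" shows "D\<psi> (\<phi> x) (D\<phi> x v) = v"
proof -
  have "((\<lambda>x. \<psi> (\<phi> x)) has_derivative (\<lambda>v. D\<psi> (\<phi> x) (D\<phi> x v))) (at x)"
    by (rule has_derivative_compose[OF has_derivative_phi[OF assms] has_derivative_psi[OF phi_in[OF assms]]])
  moreover have "((\<lambda>x. \<psi> (\<phi> x)) has_derivative (\<lambda>v. v)) (at x)"
    by (rule has_derivative_transform_within_open[OF has_derivative_ident open_U assms]) (simp add: psi_phi)
  ultimately show ?thesis using has_derivative_unique by metis
qed

lemma Dphi_Dpsi:
  assumes "y \<in> V" shows "D\<phi> (\<psi> y) (D\<psi> y v) = v"
proof -
  have "((\<lambda>x. \<phi> (\<psi> x)) has_derivative (\<lambda>v. D\<phi> (\<psi> y) (D\<psi> y v))) (at y)"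
    by (rule has_derivative_compose[OF has_derivative_psi[OF assms] has_derivative_phi[OF psi_in[OF assms]]])
  moreover have "((\<lambda>x. \<phi> (\<psi> x)) has_derivative (\<lambda>v. v)) (at y)"
    by (rule has_derivative_transform_within_open[OF has_derivative_ident open_V assms]) (simp add: phi_psi)
  ultimately show ?thesis using has_derivative_unique by metis
qed

lemma Dphi_Dpsi': "x \<in> U \<Longrightarrow> D\<phi> x (D\<psi> (\<phi> x) v) = v"
  using Dphi_Dpsi[OF phi_in] psi_phi by metis

lemma inj_Dpsi: "y \<in> V \<Longrightarrow> inj (D\<psi> y)"
  by (metis Dphi_Dpsi injI)

text \<open>The tangent space as seen by this one chart; \<open>tangent_space\<close> collects
  vectors from all charts and is identified with it afterwards.\<close>

definition T :: "'a \<Rightarrow> 'a set" where "T p = D\<psi> (\<phi> p) ` coord_plane m"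

lemma subspace_T: "p \<in> U \<Longrightarrow> subspace (T p)"
  unfolding T_def by (intro linear_subspace_image linear_psi phi_in subspace_coord_plane)

text \<open>At an edge point only vectors that do not point out of the half-plane keep the curve in
  \<open>M\<close>; at positive height every vector of the plane does for a short time. Such curves
  are the probes used to compare charts.\<close>

lemma inward_curve:
  assumes p: "p \<in> U" "p \<in> M" and w: "w \<in> coord_plane m" and adm: "\<phi> p \<bullet> e = 0 \<Longrightarrow> 0 \<le> w \<bullet> e"
  shows "\<exists>d>0. \<forall>t. 0 \<le> t \<and> t < d \<longrightarrow> \<psi> (\<phi> p + t *\<^sub>R w) \<in> M"
proof -
  have h: "\<phi> p \<in> coord_plane m" "0 \<le> \<phi> p \<bullet> e" using mem_M_iff[OF p(1)] p(2) by (auto simp: hspace_def)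
  obtain d1 where d1: "d1 > 0" "\<And>t. 0 \<le> t \<and> t < d1 \<Longrightarrow> \<phi> p + t *\<^sub>R w \<in> V"
    using open_ray[OF open_V phi_in[OF p(1)], of w] by blast
  have "\<exists>d2>0. \<forall>t. 0 \<le> t \<and> t < d2 \<longrightarrow> 0 \<le> (\<phi> p + t *\<^sub>R w) \<bullet> e"
  proof (cases "\<phi> p \<bullet> e = 0")
    case True
    then show ?thesis using adm by (intro exI[of _ 1]) (simp add: inner_simps)
  next
    case False
    have "open {x. 0 < x \<bullet> e}" by (intro open_Collect_less continuous_intros)
    moreover have "\<phi> p \<in> {x. 0 < x \<bullet> e}" using False h by simp
    ultimately obtain d2 where "d2 > 0" "\<forall>t. 0 \<le> t \<and> t < d2 \<longrightarrow> \<phi> p + t *\<^sub>R w \<in> {x. 0 < x \<bullet> e}"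
      using open_ray[of "{x. 0 < x \<bullet> e}" "\<phi> p" w] by blast
    then show ?thesis by (intro exI[of _ d2] conjI) (auto intro: less_imp_le simp del: inner_add_left)
  qed
  then obtain d2 where d2: "d2 > 0" "\<And>t. 0 \<le> t \<and> t < d2 \<Longrightarrow> 0 \<le> (\<phi> p + t *\<^sub>R w) \<bullet> e" by blast
  show ?thesis
  proof (intro exI[of _ "min d1 d2"] conjI allI impI)
    fix t assume t: "0 \<le> t \<and> t < min d1 d2"
    have "\<phi> p + t *\<^sub>R w \<in> coord_plane m"
      by (intro subspace_add[OF subspace_coord_plane] subspace_scale[OF subspace_coord_plane] h w)
    then have "\<phi> p + t *\<^sub>R w \<in> hspace m e" using d2(2)[of t] t by (simp add: hspace_def)
    then show "\<psi> (\<phi> p + t *\<^sub>R w) \<in> M" using psi_mem_M d1(2)[of t] t by simp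
  qed (use d1 d2 in simp)
qed

end

lemma real_derivative_nonneg_one_sided:
  fixes f :: "real \<Rightarrow> real"
  assumes "(f has_real_derivative D) (at 0)" "f 0 = 0" "d > 0" "\<And>t. 0 \<le> t \<and> t < d \<Longrightarrow> 0 \<le> f t"
  shows "0 \<le> D"
proof (rule tendsto_lowerbound)
  have "(f has_real_derivative D) (at 0 within {0<..})" using assms(1) by (rule has_field_derivative_at_within)
  then show "((\<lambda>y. (f y - f 0) / (y - 0)) \<longlongrightarrow> D) (at_right 0)" by (simp add: has_field_derivative_iff)
  show "\<forall>\<^sub>F x in at_right 0. 0 \<le> (f x - f 0) / (x - 0)"
    unfolding eventually_at_right_field using assms by (intro exI[of _ d]) auto
qed simp

text \<open>The curve of \<open>inward_curve\<close>, read in the second chart, stays in that model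
  space for small nonnegative times. Its coordinates beyond \<open>m\<close> vanish and its height
  is nonnegative; one-sided derivatives at time 0 give both claims.\<close>

lemma chart_transition:
  assumes c1: "mfd_chart r m M U1 V1 \<phi>1 \<psi>1 e1" and c2: "mfd_chart r' m M U2 V2 \<phi>2 \<psi>2 e2"
    and p: "p \<in> U1" "p \<in> U2" "p \<in> M" and w: "w \<in> coord_plane m" and adm: "\<phi>1 p \<bullet> e1 = 0 \<Longrightarrow> 0 \<le> w \<bullet> e1"
  defines "w' \<equiv> frechet_derivative \<phi>2 (at p) (frechet_derivative \<psi>1 (at (\<phi>1 p)) w)"
  shows "w' \<in> coord_plane m" and "\<phi>2 p \<bullet> e2 = 0 \<Longrightarrow> 0 \<le> w' \<bullet> e2"
proof -
  interpret c1: mfd_chart r m M U1 V1 \<phi>1 \<psi>1 e1 by fact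
  interpret c2: mfd_chart r' m M U2 V2 \<phi>2 \<psi>2 e2 by fact
  define g where "g t = \<phi>2 (\<psi>1 (\<phi>1 p + t *\<^sub>R w))" for t
  have "((\<lambda>t. \<phi>1 p + t *\<^sub>R w) has_derivative (\<lambda>t. t *\<^sub>R w)) (at 0)" by (auto intro!: derivative_eq_intros)
  from has_derivative_compose[OF this, of \<psi>1 "c1.D\<psi> (\<phi>1 p)"] c1.has_derivative_psi[OF c1.phi_in[OF p(1)]]
  have "((\<lambda>t. \<psi>1 (\<phi>1 p + t *\<^sub>R w)) has_derivative (\<lambda>t. c1.D\<psi> (\<phi>1 p) (t *\<^sub>R w))) (at 0)" by simp
  from has_derivative_compose[OF this, of \<phi>2 "c2.D\<phi> p"] c2.has_derivative_phi[OF p(2)] c1.psi_phi[OF p(1)]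
  have "(g has_derivative (\<lambda>t. c2.D\<phi> p (c1.D\<psi> (\<phi>1 p) (t *\<^sub>R w)))) (at 0)" by (simp add: g_def[abs_def])
  then have g: "(g has_vector_derivative w') (at 0)"
    unfolding has_vector_derivative_def w'_def
    by (simp add: linear_cmul[OF c1.linear_psi[OF c1.phi_in[OF p(1)]]] linear_cmul[OF c2.linear_phi[OF p(2)]])
  have gi: "((\<lambda>t. g t \<bullet> b) has_real_derivative w' \<bullet> b) (at 0)" for b
    unfolding has_real_derivative_iff_has_vector_derivative
    by (rule bounded_linear.has_vector_derivative[OF bounded_linear_inner_left g])
  have g0: "g 0 = \<phi>2 p" by (simp add: g_def c1.psi_phi[OF p(1)])
  obtain d1 where d1: "d1 > 0" "\<And>t. 0 \<le> t \<and> t < d1 \<Longrightarrow> \<psi>1 (\<phi>1 p + t *\<^sub>R w) \<in> M"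
    using c1.inward_curve[OF p(1,3) w adm] by blast
  have "open (V1 \<inter> \<psi>1 -` U2)"
    using continuous_open_preimage[OF Ck_on_continuous[OF c1.Ck_psi] c1.open_V c2.open_U] by simp
  moreover have "\<phi>1 p \<in> V1 \<inter> \<psi>1 -` U2" using p c1.phi_in c1.psi_phi by simp
  ultimately obtain d2 where d2: "d2 > 0" "\<And>t. 0 \<le> t \<and> t < d2 \<Longrightarrow> \<phi>1 p + t *\<^sub>R w \<in> V1 \<inter> \<psi>1 -` U2"
    using open_ray[of "V1 \<inter> \<psi>1 -` U2" "\<phi>1 p" w] by blast
  define d where "d = min d1 d2"
  have d: "d > 0" using d1 d2 by (simp add: d_def)
  have gh: "g t \<in> hspace m e2" if "0 \<le> t \<and> t < d" for t
    unfolding g_def using that d1(2)[of t] d2(2)[of t] c2.mem_M_iff by (auto simp: d_def)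
  have g0h: "\<phi>2 p \<in> hspace m e2" using c2.mem_M_iff p by blast
  show "w' \<in> coord_plane m"
    unfolding coord_plane_def
  proof (intro CollectI allI impI)
    fix i assume i: "m \<le> i \<and> i < DIM('a)"
    have z: "g t \<bullet> ebasis i = 0" if "0 \<le> t \<and> t < d" for t
      using gh[OF that] i by (auto simp: hspace_def coord_plane_def)
    have "0 \<le> w' \<bullet> ebasis i"
      by (rule real_derivative_nonneg_one_sided[OF gi _ d]) (use z d in auto)
    moreover have "0 \<le> - (w' \<bullet> ebasis i)"
      by (rule real_derivative_nonneg_one_sided[OF DERIV_minus[OF gi] _ d]) (use z d in auto)
    ultimately show "w' \<bullet> ebasis i = 0" by simp
  qed
  show "0 \<le> w' \<bullet> e2" if "\<phi>2 p \<bullet> e2 = 0"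
    by (rule real_derivative_nonneg_one_sided[OF gi _ d]) (use gh g0 that in \<open>auto simp: hspace_def\<close>)
qed

text \<open>A vector pointing out of the half-plane is handled through its negative, as
  \<open>T\<close> is a subspace. Used in both orders of the charts this shows that \<open>T\<close>
  is chart independent.\<close>

lemma T_subset:
  assumes c1: "mfd_chart r m M U1 V1 \<phi>1 \<psi>1 e1" and c2: "mfd_chart r' m M U2 V2 \<phi>2 \<psi>2 e2"
    and p: "p \<in> U1" "p \<in> U2" "p \<in> M"
  shows "mfd_chart.T m \<phi>1 \<psi>1 p \<subseteq> mfd_chart.T m \<phi>2 \<psi>2 p"
proof -
  interpret c1: mfd_chart r m M U1 V1 \<phi>1 \<psi>1 e1 by fact
  interpret c2: mfd_chart r' m M U2 V2 \<phi>2 \<psi>2 e2 by fact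
  have *: "c1.D\<psi> (\<phi>1 p) w \<in> c2.T p" if "w \<in> coord_plane m" "0 \<le> w \<bullet> e1" for w
  proof -
    have "c2.D\<phi> p (c1.D\<psi> (\<phi>1 p) w) \<in> coord_plane m" by (rule chart_transition(1)[OF c1 c2 p that])
    then have "c2.D\<psi> (\<phi>2 p) (c2.D\<phi> p (c1.D\<psi> (\<phi>1 p) w)) \<in> c2.T p" unfolding c2.T_def by blast
    then show ?thesis by (simp add: c2.Dpsi_Dphi[OF p(2)])
  qed
  show ?thesis
  proof
    fix v assume "v \<in> c1.T p"
    then obtain w where w: "w \<in> coord_plane m" "v = c1.D\<psi> (\<phi>1 p) w" by (auto simp: c1.T_def)
    show "v \<in> c2.T p"
    proof (cases "0 \<le> w \<bullet> e1")
      case True then show ?thesis using * w by blast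
    next
      case False
      have "- w \<in> coord_plane m" using w subspace_neg[OF subspace_coord_plane] by blast
      then have "c1.D\<psi> (\<phi>1 p) (- w) \<in> c2.T p" using False by (intro *) auto
      then have "- v \<in> c2.T p" using w linear_neg[OF c1.linear_psi[OF c1.phi_in[OF p(1)]]] by simp
      then show ?thesis using subspace_neg[OF c2.subspace_T[OF p(2)]] by force
    qed
  qed
qed

lemma mfd_chartI:
  assumes "chart r M (H::'a::euclidean_space set) U V \<phi> \<psi>" "model_space m H" "m \<le> DIM('a)" "1 \<le> r"
  obtains e where "H = hspace m e" "mfd_chart r m M U V \<phi> \<psi> e"
  using assms by (auto simp: model_space_hspace mfd_chart_def)

section \<open>Tangent space and boundary read in a single chart\<close>

context mfd_chart begin

lemma model: "model_space m (hspace m e)" using e by (auto simp: model_space_hspace)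

lemma tangent_space_eq:
  assumes p: "p \<in> U" "p \<in> M"
  shows "tangent_space r m M p = T p"
proof
  show "T p \<subseteq> tangent_space r m M p"
  proof
    fix v assume "v \<in> T p"
    then obtain w where w: "w \<in> coord_plane m" "v = D\<psi> (\<phi> p) w" by (auto simp: T_def)
    show "v \<in> tangent_space r m M p" unfolding tangent_space_def
      by (rule CollectI, rule exI[of _ "hspace m e"], rule exI[of _ U], rule exI[of _ V], rule exI[of _ \<phi>],
          rule exI[of _ \<psi>], rule exI[of _ w]) (use w model chart p in auto)
  qed
  show "tangent_space r m M p \<subseteq> T p"
  proof
    fix v assume "v \<in> tangent_space r m M p"
    then obtain H' U' V' \<phi>' \<psi>' w where v: "v = frechet_derivative \<psi>' (at (\<phi>' p)) w" "model_space m H'"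
      "chart r M H' U' V' \<phi>' \<psi>'" "p \<in> U' \<inter> M" "w \<in> coord_plane m"
      unfolding tangent_space_def by blast
    obtain e' where c': "mfd_chart r m M U' V' \<phi>' \<psi>' e'" by (rule mfd_chartI[OF v(3,2) m r])
    have "v \<in> mfd_chart.T m \<phi>' \<psi>' p" unfolding mfd_chart.T_def[OF c'] using v by blast
    then show "v \<in> T p" using T_subset[OF c' mfd_chart_axioms _ p] v(4) by blast
  qed
qed

text \<open>Suppose \<open>p\<close> is an edge point of some other chart but not of
  \<open>\<phi>\<close>. Then every vector of the plane is admissible in \<open>\<phi>\<close>, so
  the transition maps the plane into a half-space; but its image contains the edge vector and its
  negative.\<close>

lemma mem_boundary_iff:
  assumes p: "p \<in> U" "p \<in> M" and m1: "1 \<le> m"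
  shows "p \<in> mfd_boundary r m M \<longleftrightarrow> e \<noteq> 0 \<and> \<phi> p \<bullet> e = 0"
proof
  assume "e \<noteq> 0 \<and> \<phi> p \<bullet> e = 0"
  moreover from this have "e = ebasis (m - 1)" using e by (auto simp: edge_vector_def)
  ultimately show "p \<in> mfd_boundary r m M"
    unfolding mfd_boundary_def half_plane_hspace using chart p by blast
next
  assume "p \<in> mfd_boundary r m M"
  then obtain U' V' \<phi>' \<psi>' where c: "chart r M (half_plane m) U' V' \<phi>' \<psi>'" "p \<in> U'" "\<phi>' p \<bullet> ebasis (m - 1) = 0"
    unfolding mfd_boundary_def by blast
  let ?e = "ebasis (m - 1) :: 'a"
  have c': "mfd_chart r m M U' V' \<phi>' \<psi>' ?e"
    using c m1 m r by (auto simp: mfd_chart_def half_plane_hspace edge_vector_def)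
  interpret c': mfd_chart r m M U' V' \<phi>' \<psi>' ?e by (rule c')
  have ee: "?e \<bullet> ?e = 1" using m m1 by (simp add: inner_ebasis)
  have ec: "?e \<in> coord_plane m" using m m1 by (intro ebasis_coord_plane) auto
  show "e \<noteq> 0 \<and> \<phi> p \<bullet> e = 0"
  proof (rule ccontr)
    assume n: "\<not> (e \<noteq> 0 \<and> \<phi> p \<bullet> e = 0)"
    have pos: "0 \<le> c'.D\<phi> p (D\<psi> (\<phi> p) w) \<bullet> ?e" if "w \<in> coord_plane m" for w
      by (rule chart_transition(2)[OF mfd_chart_axioms c' p(1) c(2) p(2) that _ c(3)]) (use n in auto)
    have "c'.D\<psi> (\<phi>' p) ?e \<in> T p"
      using T_subset[OF c' mfd_chart_axioms c(2) p] ec unfolding c'.T_def by blast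
    then obtain w where w: "w \<in> coord_plane m" "c'.D\<psi> (\<phi>' p) ?e = D\<psi> (\<phi> p) w" by (auto simp: T_def)
    have we: "c'.D\<phi> p (D\<psi> (\<phi> p) w) = ?e" using c'.Dphi_Dpsi'[OF c(2)] w(2) by metis
    have "- w \<in> coord_plane m" using w subspace_neg[OF subspace_coord_plane] by blast
    from pos[OF this] have "0 \<le> - (?e \<bullet> ?e)"
      using we linear_neg[OF linear_psi[OF phi_in[OF p(1)]]] linear_neg[OF c'.linear_phi[OF c(2)]] by simp
    then show False using ee by simp
  qed
qed

text \<open>The edge of a half-plane is the coordinate plane of one dimension less, so the same maps
  straighten the boundary. All chart results thereby apply to the boundary, with edge vector
  0.\<close>

lemma boundary_chart:
  assumes e0: "e \<noteq> 0"
  shows "mfd_chart r (m - 1) (mfd_boundary r m M) U V \<phi> \<psi> 0"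
proof -
  have e: "1 \<le> m" "e = ebasis (m - 1)" using e e0 by (auto simp: edge_vector_def)
  have iff: "y \<in> coord_plane (m - 1) \<longleftrightarrow> y \<in> hspace m e \<and> y \<bullet> e = 0" for y :: 'a
  proof
    assume y: "y \<in> coord_plane (m - 1)"
    then have "y \<bullet> e = 0" using e m by (auto simp: coord_plane_def)
    moreover have "y \<in> coord_plane m" using y by (auto simp: coord_plane_def)
    ultimately show "y \<in> hspace m e \<and> y \<bullet> e = 0" by (simp add: hspace_def)
  next
    assume y: "y \<in> hspace m e \<and> y \<bullet> e = 0"
    show "y \<in> coord_plane (m - 1)" unfolding coord_plane_def
    proof (intro CollectI allI impI)
      fix i assume i: "m - 1 \<le> i \<and> i < DIM('a)"
      show "y \<bullet> ebasis i = 0"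
        using y i e by (cases "i = m - 1") (auto simp: hspace_def coord_plane_def)
    qed
  qed
  have sub: "mfd_boundary r m M \<subseteq> M" by (auto simp: mfd_boundary_def)
  have "\<phi> ` (U \<inter> mfd_boundary r m M) = V \<inter> hspace (m - 1) 0"
  proof
    show "\<phi> ` (U \<inter> mfd_boundary r m M) \<subseteq> V \<inter> hspace (m - 1) 0"
    proof
      fix y assume "y \<in> \<phi> ` (U \<inter> mfd_boundary r m M)"
      then obtain p where p: "p \<in> U" "p \<in> mfd_boundary r m M" "y = \<phi> p" by blast
      then have "p \<in> M" using sub by blast
      then have "y \<in> hspace m e" "y \<bullet> e = 0" using mem_boundary_iff[OF p(1) _ e(1)] mem_M_iff[OF p(1)] p by auto
      then show "y \<in> V \<inter> hspace (m - 1) 0" using iff phi_in p by (auto simp flip: coord_plane_hspace)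
    qed
    show "V \<inter> hspace (m - 1) 0 \<subseteq> \<phi> ` (U \<inter> mfd_boundary r m M)"
    proof
      fix y assume "y \<in> V \<inter> hspace (m - 1) 0"
      then have y: "y \<in> V" "y \<in> hspace m e" "y \<bullet> e = 0" using iff by (auto simp flip: coord_plane_hspace)
      then have "\<psi> y \<in> mfd_boundary r m M"
        using mem_boundary_iff[OF psi_in[OF y(1)] _ e(1)] psi_mem_M[OF y(1)] phi_psi e0 by auto
      then show "y \<in> \<phi> ` (U \<inter> mfd_boundary r m M)"
        using psi_in[OF y(1)] phi_psi[OF y(1)] by (metis IntI imageI)
    qed
  qed
  then show ?thesis
    using chart m r by (auto simp: mfd_chart_def chart_def edge_vector_def)
qed

end

section \<open>Gram-Schmidt frames, tangential part and outward normal\<close>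

text \<open>Gram-Schmidt without normalisation, so that only divisions by nonzero squares occur.\<close>

function gs :: "(nat \<Rightarrow> 'a::real_inner) \<Rightarrow> nat \<Rightarrow> 'a" where
  "gs a n = a n - (\<Sum>i<n. ((a n \<bullet> gs a i) / (gs a i \<bullet> gs a i)) *\<^sub>R gs a i)"
  by auto
termination by (relation "inv_image less_than snd") auto

declare gs.simps [simp del]

lemma gs_diff_in_span: "a n - gs a n \<in> span (gs a ` {..<n})"
  unfolding gs.simps[of a n] by (auto intro!: span_sum span_scale intro: span_base)

lemma gs_span: "span (gs a ` {..<n}) = span (a ` {..<n})"
proof (induction n)
  case (Suc n)
  have "span (gs a ` {..<Suc n}) = span (insert (gs a n) (gs a ` {..<n}))" by (simp add: lessThan_Suc)
  also have "\<dots> = span (insert (a n) (gs a ` {..<n}))"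
    by (rule eq_span_insert_eq[symmetric, OF gs_diff_in_span])
  also have "\<dots> = span (insert (a n) (a ` {..<n}))"
    by (simp only: span_insert Suc.IH)
  finally show ?case by (simp add: lessThan_Suc)
qed simp

text \<open>Dependent vectors are covered: a vanishing \<open>gs a j\<close> makes both inner
  products in question 0, whatever the value of the quotient.\<close>

lemma gs_orthogonal_less: "j < n \<Longrightarrow> gs a n \<bullet> gs a j = 0"
proof (induction n arbitrary: j rule: less_induct)
  case (less n)
  have "(\<Sum>i<n. ((a n \<bullet> gs a i) / (gs a i \<bullet> gs a i)) *\<^sub>R gs a i) \<bullet> gs a j =
      (\<Sum>i<n. if i = j then a n \<bullet> gs a j else 0)"
    unfolding inner_sum_left
  proof (rule sum.cong[OF refl])
    fix i assume i: "i \<in> {..<n}"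
    have "gs a i \<bullet> gs a j = 0" if "i \<noteq> j"
      using less.IH[of i j] less.IH[of j i] that i less.prems by (cases "i < j") (auto simp: inner_commute)
    then show "((a n \<bullet> gs a i) / (gs a i \<bullet> gs a i)) *\<^sub>R gs a i \<bullet> gs a j = (if i = j then a n \<bullet> gs a j else 0)"
      by (cases "gs a j = 0") auto
  qed
  then show ?case using less.prems by (subst gs.simps) (simp add: inner_diff_left)
qed

lemma gs_orthogonal: "i \<noteq> j \<Longrightarrow> gs a i \<bullet> gs a j = 0"
  using gs_orthogonal_less[of i j a] gs_orthogonal_less[of j i a] by (cases "i < j") (auto simp: inner_commute)

lemma gs_nonzero: "a n \<notin> span (a ` {..<n}) \<Longrightarrow> gs a n \<noteq> 0"
  using gs_diff_in_span[of a n] gs_span[of a n] by auto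

lemma Ck_on_gs:
  fixes a :: "nat \<Rightarrow> 'a::euclidean_space \<Rightarrow> 'b::euclidean_space"
  assumes S: "ray_set S B" and a: "\<And>i. i \<le> n \<Longrightarrow> Ck_on k B S (a i)"
    and nz: "\<And>i x. i < n \<Longrightarrow> x \<in> S \<Longrightarrow> gs (\<lambda>i. a i x) i \<noteq> 0"
  shows "Ck_on k B S (\<lambda>x. gs (\<lambda>i. a i x) n)"
  using a nz
proof (induction n rule: less_induct)
  case (less n)
  have IH: "Ck_on k B S (\<lambda>x. gs (\<lambda>i. a i x) i)" if "i < n" for i
    by (rule less.IH[OF that]) (use less.prems that in auto)
  have an: "Ck_on k B S (a n)" using less.prems by simp
  have "Ck_on k B S (\<lambda>x. \<Sum>i<n. ((a n x \<bullet> gs (\<lambda>i. a i x) i) / (gs (\<lambda>i. a i x) i \<bullet> gs (\<lambda>i. a i x) i)) *\<^sub>R gs (\<lambda>i. a i x) i)"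
  proof (rule Ck_on_sum[OF S])
    fix i assume "i \<in> {..<n}"
    then have i: "i < n" by simp
    show "Ck_on k B S (\<lambda>x. ((a n x \<bullet> gs (\<lambda>i. a i x) i) / (gs (\<lambda>i. a i x) i \<bullet> gs (\<lambda>i. a i x) i)) *\<^sub>R gs (\<lambda>i. a i x) i)"
      by (rule Ck_on_scaleR[OF S Ck_on_divide_pos[OF S Ck_on_inner[OF S an IH[OF i]] Ck_on_inner[OF S IH[OF i] IH[OF i]]] IH[OF i]])
        (use less.prems(2)[OF i] in simp)
  qed
  from Ck_on_diff[OF S an this] show ?case by (subst gs.simps) simp
qed

lemma orth_projection_eqI:
  assumes W: "subspace W" and y: "y \<in> W" "\<And>w. w \<in> W \<Longrightarrow> (x - y) \<bullet> w = 0"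
  shows "orth_projection W x = y"
  unfolding orth_projection_def
proof (rule the_equality)
  show "y \<in> W \<and> (\<forall>w\<in>W. orthogonal (x - y) w)" using y by (simp add: orthogonal_def)
  fix z assume z: "z \<in> W \<and> (\<forall>w\<in>W. orthogonal (x - z) w)"
  have zy: "z - y \<in> W" using W z y by (simp add: subspace_diff)
  have "(z - y) \<bullet> (z - y) = (x - y) \<bullet> (z - y) - (x - z) \<bullet> (z - y)" by (simp add: algebra_simps inner_diff_left)
  also have "\<dots> = 0" using y(2)[OF zy] z zy by (simp add: orthogonal_def)
  finally show "z = y" by simp
qed

context mfd_chart begin

text \<open>The coordinate frame orthogonalised in its order. Since the edge direction comes last,
  the first \<open>m - 1\<close> vectors span the tangent space of the boundary and
  \<open>G (m - 1)\<close> is normal to it inside \<open>T\<close>.\<close>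

definition G :: "nat \<Rightarrow> 'a \<Rightarrow> 'a" where "G i x = gs (\<lambda>i. D\<psi> (\<phi> x) (ebasis i)) i"

definition tang :: "('a \<Rightarrow> 'a) \<Rightarrow> 'a \<Rightarrow> 'a" where
  "tang X x = (\<Sum>i<m. ((X x \<bullet> G i x) / (G i x \<bullet> G i x)) *\<^sub>R G i x)"

text \<open>The minus sign is needed because \<open>G (m - 1)\<close> points inward. The field is
  defined on the whole chart domain and tangent to \<open>M\<close>, so it extends the outward
  normal off the boundary.\<close>

definition \<nu> :: "'a \<Rightarrow> 'a" where
  "\<nu> x = - (((G (m - 1) x \<bullet> G (m - 1) x) powr (- (1/2))) *\<^sub>R G (m - 1) x)"

lemma span_G:
  assumes x: "x \<in> U" and n: "n \<le> DIM('a)"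
  shows "span ((\<lambda>i. G i x) ` {..<n}) = D\<psi> (\<phi> x) ` coord_plane n"
proof -
  have "span ((\<lambda>i. G i x) ` {..<n}) = span ((\<lambda>i. D\<psi> (\<phi> x) (ebasis i)) ` {..<n})"
    unfolding G_def by (rule gs_span)
  also have "(\<lambda>i. D\<psi> (\<phi> x) (ebasis i)) ` {..<n} = D\<psi> (\<phi> x) ` (ebasis ` {..<n})" by (simp add: image_image)
  also have "span \<dots> = D\<psi> (\<phi> x) ` span (ebasis ` {..<n})"
    by (rule linear_span_image[OF linear_psi[OF phi_in[OF x]]])
  finally show ?thesis by (simp add: coord_plane_span[OF n])
qed

lemma T_span: "x \<in> U \<Longrightarrow> T x = span ((\<lambda>i. G i x) ` {..<m})"
  by (simp add: T_def span_G[OF _ m])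

lemma G_nonzero:
  assumes x: "x \<in> U" and i: "i < DIM('a)"
  shows "G i x \<noteq> 0"
  unfolding G_def
proof (rule gs_nonzero)
  have "ebasis i \<notin> (coord_plane i :: 'a set)" using i by (auto simp: coord_plane_def inner_ebasis)
  then have "D\<psi> (\<phi> x) (ebasis i) \<notin> D\<psi> (\<phi> x) ` coord_plane i"
    using inj_Dpsi[OF phi_in[OF x]] by (auto dest: injD)
  moreover have "span ((\<lambda>i. D\<psi> (\<phi> x) (ebasis i)) ` {..<i}) = D\<psi> (\<phi> x) ` coord_plane i"
    using span_G[OF x, of i] i unfolding G_def gs_span by simp
  ultimately show "D\<psi> (\<phi> x) (ebasis i) \<notin> span ((\<lambda>i. D\<psi> (\<phi> x) (ebasis i)) ` {..<i})" by simp
qed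

lemma G_pos: "x \<in> U \<Longrightarrow> i < DIM('a) \<Longrightarrow> 0 < G i x \<bullet> G i x"
  using G_nonzero by simp

lemma G_orthogonal: "i \<noteq> j \<Longrightarrow> G i x \<bullet> G j x = 0"
  unfolding G_def by (rule gs_orthogonal)

text \<open>The frame consists of first derivatives of \<open>\<psi>\<close>, so one order is lost:
  C^k data come from a C^(k+1) chart.\<close>

lemma Ck_G:
  assumes rk: "r = enat (Suc k)" and i: "i < DIM('a)"
  shows "Ck_on (enat k) Basis U (G i)"
  unfolding G_def
proof (rule Ck_on_gs[OF ray_set_open[OF open_U]])
  fix j assume j: "j \<le> i"
  then have "ebasis j \<in> (Basis :: 'a set)" using i by (simp add: ebasis_in_Basis)
  then have 1: "Ck_on (enat k) Basis V (pd V (ebasis j) \<psi>)" using Ck_on_pdD Ck_psi rk by simp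
  have 2: "Ck_on (enat k) Basis U \<phi>" by (rule Ck_on_SucD) (use Ck_phi rk in simp)
  have "Ck_on (enat k) Basis U (\<lambda>x. pd V (ebasis j) \<psi> (\<phi> x))"
    by (rule Ck_on_compose[OF ray_set_open[OF open_U] open_V _ 2 1]) (use phi_in in auto)
  then show "Ck_on (enat k) Basis U (\<lambda>x. D\<psi> (\<phi> x) (ebasis j))"
    by (rule Ck_on_cong) (simp add: at_within_open[OF phi_in open_V])
next
  fix j x assume "j < i" "x \<in> U"
  then show "gs (\<lambda>i. D\<psi> (\<phi> x) (ebasis i)) j \<noteq> 0" using G_nonzero[of x j] i by (simp add: G_def)
qed

lemma Ck_tang:
  assumes rk: "r = enat (Suc k)" and X: "Ck_on (enat k) Basis U X"
  shows "Ck_on (enat k) Basis U (tang X)"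
  unfolding tang_def
proof (rule Ck_on_sum[OF ray_set_open[OF open_U]])
  note R = ray_set_open[OF open_U]
  fix i assume "i \<in> {..<m}"
  then have i: "i < DIM('a)" using m by simp
  note Gi = Ck_G[OF rk i]
  show "Ck_on (enat k) Basis U (\<lambda>x. ((X x \<bullet> G i x) / (G i x \<bullet> G i x)) *\<^sub>R G i x)"
    by (rule Ck_on_scaleR[OF R Ck_on_divide_pos[OF R Ck_on_inner[OF R X Gi] Ck_on_inner[OF R Gi Gi] G_pos[OF _ i]] Gi])
qed

lemma tang_in_T: "x \<in> U \<Longrightarrow> tang X x \<in> T x"
  unfolding T_span tang_def by (intro span_sum span_scale span_base) auto

lemma diff_tang_orthogonal:
  assumes x: "x \<in> U" and w: "w \<in> T x"
  shows "(X x - tang X x) \<bullet> w = 0"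
proof -
  have "orthogonal (X x - tang X x) w"
  proof (rule orthogonal_to_span)
    show "w \<in> span ((\<lambda>i. G i x) ` {..<m})" using w T_span[OF x] by simp
    fix y assume "y \<in> (\<lambda>i. G i x) ` {..<m}"
    then obtain j where j: "j < m" "y = G j x" by auto
    have "tang X x \<bullet> G j x = (\<Sum>i<m. if i = j then X x \<bullet> G j x else 0)"
      unfolding tang_def inner_sum_left
      by (rule sum.cong[OF refl]) (use G_nonzero[OF x, of j] j m in \<open>auto simp: G_orthogonal\<close>)
    then show "orthogonal (X x - tang X x) y" using j by (simp add: orthogonal_def inner_diff_left)
  qed
  then show ?thesis by (simp add: orthogonal_def)
qed

lemma normal_part_eq:
  assumes x: "x \<in> U" "x \<in> M"
  shows "normal_part r m M X x = X x - tang X x"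
proof -
  have "orth_projection ((T x)\<^sup>\<bottom>) (X x) = X x - tang X x"
  proof (rule orth_projection_eqI[OF subspace_orthogonal_comp])
    show "X x - tang X x \<in> (T x)\<^sup>\<bottom>"
      using diff_tang_orthogonal[OF x(1)] by (auto simp: orthogonal_comp_def orthogonal_def inner_commute)
    show "(X x - (X x - tang X x)) \<bullet> w = 0" if "w \<in> (T x)\<^sup>\<bottom>" for w
      using that tang_in_T[OF x(1), of X] by (auto simp: orthogonal_comp_def orthogonal_def)
  qed
  then show ?thesis using x by (simp add: normal_part_def tangent_space_eq)
qed

text \<open>In an orthogonal frame the coefficient of the last vector is read off by an inner
  product; if it is 0, only the vectors spanning the edge remain.\<close>

lemma T_edge_zero:
  assumes p: "p \<in> U" and e0: "e \<noteq> 0" and v: "v \<in> T p" and o: "v \<bullet> G (m - 1) p = 0"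
  shows "v \<in> D\<psi> (\<phi> p) ` coord_plane (m - 1)"
proof -
  have m1: "1 \<le> m" using e e0 by (auto simp: edge_vector_def)
  then have ins: "{..<m} = insert (m - 1) {..<m - 1}" by auto
  have "v \<in> span (insert (G (m - 1) p) ((\<lambda>i. G i p) ` {..<m - 1}))"
    using v unfolding T_span[OF p] ins by simp
  then obtain c where c: "v - c *\<^sub>R G (m - 1) p \<in> span ((\<lambda>i. G i p) ` {..<m - 1})"
    by (auto simp: span_breakdown_eq)
  have "orthogonal (G (m - 1) p) (v - c *\<^sub>R G (m - 1) p)"
    by (rule orthogonal_to_span[OF c]) (auto simp: orthogonal_def intro!: G_orthogonal)
  then have "c * (G (m - 1) p \<bullet> G (m - 1) p) = 0" using o by (simp add: orthogonal_def inner_diff_right inner_commute)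
  then have "c = 0" using G_nonzero[OF p, of "m - 1"] m m1 by simp
  then show ?thesis using c span_G[OF p, of "m - 1"] m by simp
qed

text \<open>Orthogonalisation changes the last frame vector only by images of vectors of height 0,
  so its own height stays 1.\<close>

lemma Dphi_G:
  assumes p: "p \<in> U" and e0: "e \<noteq> 0"
  shows "D\<phi> p (G (m - 1) p) \<bullet> e = 1"
proof -
  have e: "1 \<le> m" "e = ebasis (m - 1)" using e e0 by (auto simp: edge_vector_def)
  let ?a = "\<lambda>i. D\<psi> (\<phi> p) (ebasis i)"
  have "?a (m - 1) - G (m - 1) p \<in> span ((\<lambda>i. G i p) ` {..<m - 1})"
    unfolding G_def using gs_diff_in_span[of ?a "m - 1"] by simp
  then obtain w where w: "w \<in> coord_plane (m - 1)" "?a (m - 1) - G (m - 1) p = D\<psi> (\<phi> p) w"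
    using span_G[OF p, of "m - 1"] m by auto
  have "G (m - 1) p = D\<psi> (\<phi> p) (ebasis (m - 1) - w)"
    using w(2) by (simp add: linear_diff[OF linear_psi[OF phi_in[OF p]]] algebra_simps)
  then have "D\<phi> p (G (m - 1) p) = ebasis (m - 1) - w" by (simp add: Dphi_Dpsi'[OF p])
  moreover have "w \<bullet> e = 0" using w(1) e m by (auto simp: coord_plane_def)
  ultimately show ?thesis using e m by (simp add: inner_diff_left inner_ebasis)
qed

lemma norm_\<nu>:
  assumes "p \<in> U" "m - 1 < DIM('a)" shows "norm (\<nu> p) = 1"
proof -
  have "(G (m - 1) p \<bullet> G (m - 1) p) powr (- (1/2)) = inverse (norm (G (m - 1) p))"
    using G_pos[OF assms] by (simp add: powr_minus powr_half_sqrt norm_eq_sqrt_inner)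
  then show ?thesis using G_nonzero[OF assms] by (simp add: \<nu>_def)
qed

text \<open>Orthogonality to the boundary leaves only multiples of \<open>G (m - 1)\<close>, and the
  norm fixes the absolute value of the factor. The outward condition is witnessed in some chart,
  possibly a different one; \<open>chart_transition\<close> carries its sign over.\<close>

lemma outward_normal_eq:
  assumes p: "p \<in> U" "p \<in> mfd_boundary r m M" and e0: "e \<noteq> 0"
  shows "outward_normal r m M p = \<nu> p"
proof -
  have em: "1 \<le> m" "e = ebasis (m - 1)" using e e0 by (auto simp: edge_vector_def)
  have pM: "p \<in> M" using p by (auto simp: mfd_boundary_def)
  have pe: "\<phi> p \<bullet> e = 0" using mem_boundary_iff[OF p(1) pM em(1)] p(2) by blast
  have m1: "m - 1 < DIM('a)" using em m by simp
  interpret b: mfd_chart r "m - 1" "mfd_boundary r m M" U V \<phi> \<psi> 0 by (rule boundary_chart[OF e0])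
  have Tb: "tangent_space r (m - 1) (mfd_boundary r m M) p = D\<psi> (\<phi> p) ` coord_plane (m - 1)"
    using b.tangent_space_eq[OF p] unfolding b.T_def .
  have Tp: "tangent_space r m M p = T p" by (rule tangent_space_eq[OF p(1) pM])
  define c0 where "c0 = (G (m - 1) p \<bullet> G (m - 1) p) powr (- (1/2))"
  have c0: "c0 > 0" unfolding c0_def using G_pos[OF p(1) m1] by (simp only: powr_gt_zero)
  have \<nu>: "\<nu> p = - (c0 *\<^sub>R G (m - 1) p)" by (simp add: \<nu>_def c0_def)
  have GT: "G (m - 1) p \<in> T p" unfolding T_span[OF p(1)] using em by (intro span_base) auto
  have Gorth: "G (m - 1) p \<bullet> w = 0" if "w \<in> D\<psi> (\<phi> p) ` coord_plane (m - 1)" for w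
  proof -
    have "w \<in> span ((\<lambda>i. G i p) ` {..<m - 1})" using that span_G[OF p(1), of "m - 1"] m by simp
    then have "orthogonal (G (m - 1) p) w"
      by (rule orthogonal_to_span) (auto simp: orthogonal_def intro!: G_orthogonal)
    then show ?thesis by (simp add: orthogonal_def)
  qed
  show ?thesis unfolding outward_normal_def Tb Tp
  proof (rule the_equality)
    have "\<nu> p \<in> T p" unfolding \<nu> by (intro subspace_neg subspace_scale subspace_T p GT)
    moreover have "\<forall>w\<in>D\<psi> (\<phi> p) ` coord_plane (m - 1). orthogonal (\<nu> p) w"
      using Gorth by (auto simp: orthogonal_def \<nu>)
    moreover have "D\<phi> p (\<nu> p) \<bullet> e < 0"
      unfolding \<nu> using c0 Dphi_G[OF p(1) e0] by (simp add: linear_neg[OF linear_phi[OF p(1)]] linear_cmul[OF linear_phi[OF p(1)]])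
    then have "points_outward r m M p (\<nu> p)"
      unfolding points_outward_def half_plane_hspace using chart p(1) pe em(2) by blast
    ultimately show "norm (\<nu> p) = 1 \<and> \<nu> p \<in> T p \<and> (\<forall>w\<in>D\<psi> (\<phi> p) ` coord_plane (m - 1). orthogonal (\<nu> p) w) \<and> points_outward r m M p (\<nu> p)"
      using norm_\<nu>[OF p(1) m1] by blast
  next
    fix v assume v: "norm v = 1 \<and> v \<in> T p \<and> (\<forall>w\<in>D\<psi> (\<phi> p) ` coord_plane (m - 1). orthogonal v w) \<and> points_outward r m M p v"
    define c where "c = (v \<bullet> G (m - 1) p) / (G (m - 1) p \<bullet> G (m - 1) p)"
    define d where "d = v - c *\<^sub>R G (m - 1) p"
    have "d \<bullet> G (m - 1) p = 0" using G_nonzero[OF p(1) m1] by (simp add: d_def c_def inner_diff_left)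
    moreover have "d \<in> T p" unfolding d_def using v GT by (intro subspace_diff subspace_scale subspace_T p) auto
    ultimately have dm: "d \<in> D\<psi> (\<phi> p) ` coord_plane (m - 1)" by (intro T_edge_zero[OF p(1) e0])
    then have "v \<bullet> d = 0" "G (m - 1) p \<bullet> d = 0" using v Gorth by (auto simp: orthogonal_def)
    then have "d \<bullet> d = 0" by (simp add: d_def inner_diff_left)
    then have vc: "v = c *\<^sub>R G (m - 1) p" by (simp add: d_def)
    have "\<not> c \<ge> 0"
    proof
      assume c: "c \<ge> 0"
      obtain U' V' \<phi>' \<psi>' where c': "chart r M (half_plane m) U' V' \<phi>' \<psi>'" "p \<in> U'" "\<phi>' p \<bullet> ebasis (m - 1) = 0"
        "frechet_derivative \<phi>' (at p) v \<bullet> ebasis (m - 1) < 0"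
        using v unfolding points_outward_def by blast
      have ch: "mfd_chart r m M U' V' \<phi>' \<psi>' e"
        using c' em m r by (auto simp: mfd_chart_def half_plane_hspace edge_vector_def)
      obtain w where w: "w \<in> coord_plane m" "v = D\<psi> (\<phi> p) w" using v by (auto simp: T_def)
      have "w = D\<phi> p v" using w Dphi_Dpsi'[OF p(1)] by simp
      then have "w \<bullet> e = c" using Dphi_G[OF p(1) e0] by (simp add: vc linear_cmul[OF linear_phi[OF p(1)]])
      then have "0 \<le> frechet_derivative \<phi>' (at p) (D\<psi> (\<phi> p) w) \<bullet> e"
        using c c'(3) em by (intro chart_transition(2)[OF mfd_chart_axioms ch p(1) c'(2) pM w(1)]) auto
      then show False using c'(4) w em by simp
    qed
    moreover have "\<bar>c\<bar> * norm (G (m - 1) p) = 1" using v vc by (metis norm_scaleR)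
    moreover have "c0 * norm (G (m - 1) p) = 1"
      using norm_\<nu>[OF p(1) m1] c0 by (simp add: \<nu>)
    ultimately have "- c * norm (G (m - 1) p) = c0 * norm (G (m - 1) p)" by simp
    moreover have "norm (G (m - 1) p) \<noteq> 0" using G_nonzero[OF p(1) m1] by simp
    ultimately have "- c = c0" by (metis mult_right_cancel)
    then have "c = - c0" by simp
    then show "v = \<nu> p" using vc \<nu> by simp
  qed
qed

lemma Ck_\<nu>:
  assumes rk: "r = enat (Suc k)" and m1: "m - 1 < DIM('a)"
  shows "Ck_on (enat k) Basis U \<nu>"
  unfolding \<nu>_def
  by (intro Ck_on_uminus Ck_on_scaleR Ck_on_powr_compose Ck_on_inner Ck_G rk m1 ray_set_open open_U G_pos)

text \<open>Turns the geometric conditions on a field into the hypotheses of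
  \<open>viability\<close>: at an edge point, zero flux puts the vector into the tangent space of
  the edge.\<close>

lemma tangential_coordinates:
  assumes p: "p \<in> U" "p \<in> M" and v: "v \<in> tangent_space r m M p"
    and bd: "p \<in> mfd_boundary r m M \<Longrightarrow> v \<bullet> outward_normal r m M p = 0" and m1: "1 \<le> m"
  shows "D\<phi> p v \<in> coord_plane m" and "\<phi> p \<bullet> e = 0 \<Longrightarrow> D\<phi> p v \<bullet> e = 0"
proof -
  have vT: "v \<in> T p" using v tangent_space_eq[OF p] by simp
  then show "D\<phi> p v \<in> coord_plane m" unfolding T_def using Dphi_Dpsi'[OF p(1)] by auto
  assume pe: "\<phi> p \<bullet> e = 0"
  show "D\<phi> p v \<bullet> e = 0"
  proof (cases "e = 0")
    case False
    then have em: "e = ebasis (m - 1)" using e by (auto simp: edge_vector_def)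
    have mm: "m - 1 < DIM('a)" using m m1 by simp
    have pb: "p \<in> mfd_boundary r m M" using mem_boundary_iff[OF p m1] False pe by blast
    have "(G (m - 1) p \<bullet> G (m - 1) p) powr (- (1/2)) \<noteq> 0" using G_pos[OF p(1) mm] by simp
    then have "v \<bullet> G (m - 1) p = 0"
      using bd[OF pb] outward_normal_eq[OF p(1) pb False] by (simp add: \<nu>_def)
    then have "v \<in> D\<psi> (\<phi> p) ` coord_plane (m - 1)" by (rule T_edge_zero[OF p(1) False vT])
    then have "D\<phi> p v \<in> coord_plane (m - 1)" using Dphi_Dpsi'[OF p(1)] by auto
    then show ?thesis using em m m1 by (auto simp: coord_plane_def)
  qed simp
qed

section \<open>Invariance of a submanifold under tangential flows\<close>

text \<open>The trajectory and the field are transported to the chart, where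
  \<open>viability\<close> applies in both time directions.\<close>

lemma flow_stays_locally:
  assumes rk: "r = enat (Suc k)" "1 \<le> k" and m1: "1 \<le> m" and Z: "Ck_on 1 Basis UNIV Z"
    and tan: "\<And>p. p \<in> M \<Longrightarrow> Z p \<in> tangent_space r m M p"
    and bd: "\<And>p. p \<in> mfd_boundary r m M \<Longrightarrow> Z p \<bullet> outward_normal r m M p = 0"
    and y: "\<And>t. (y has_vector_derivative Z (y t)) (at t)" and t0: "y t0 \<in> U" "y t0 \<in> M"
  shows "\<exists>\<epsilon>>0. \<forall>t. \<bar>t - t0\<bar> < \<epsilon> \<longrightarrow> y t \<in> M"
proof -
  define Y where "Y w = D\<phi> (\<psi> w) (Z (\<psi> w))" for w
  define u where "u s = \<phi> (y (t0 + s))" for s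
  have RV: "ray_set V Basis" by (rule ray_set_open[OF open_V])
  have Y: "Ck_on 1 Basis V Y"
  proof -
    have one: "1 = enat (Suc 0)" by (simp add: one_enat_def)
    have psi1: "Ck_on 1 Basis V \<psi>" by (rule Ck_on_mono[OF Ck_psi r]) simp
    have Zpsi: "Ck_on 1 Basis V (\<lambda>w. Z (\<psi> w))"
      by (rule Ck_on_compose[OF RV open_UNIV _ psi1 Z]) simp
    have phib: "Ck_on 1 Basis V (\<lambda>w. pd U b \<phi> (\<psi> w))" if b: "b \<in> Basis" for b
    proof (rule Ck_on_compose[OF RV open_U _ psi1])
      \<comment> \<open>Transporting the field costs one derivative of \<open>\<phi>\<close>; with
        \<open>k\<close> at least 1 the coefficients are still C^1, as the Lipschitz argument
        requires.\<close>
      have "Ck_on (enat k) Basis U (pd U b \<phi>)" using Ck_on_pdD Ck_phi rk(1) b by simp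
      then show "Ck_on 1 Basis U (pd U b \<phi>)" by (rule Ck_on_mono) (use rk(2) in \<open>auto simp: one\<close>)
    qed (use psi_in in auto)
    have "Ck_on 1 Basis V (\<lambda>w. \<Sum>b\<in>Basis. (Z (\<psi> w) \<bullet> b) *\<^sub>R pd U b \<phi> (\<psi> w))"
      by (intro Ck_on_sum[OF RV] Ck_on_scaleR[OF RV] Ck_on_inner[OF RV Zpsi Ck_on_const[OF RV]] phib)
    then show ?thesis
    proof (rule Ck_on_cong)
      fix w assume w: "w \<in> V"
      have "D\<phi> (\<psi> w) (Z (\<psi> w)) = D\<phi> (\<psi> w) (\<Sum>b\<in>Basis. (Z (\<psi> w) \<bullet> b) *\<^sub>R b)" by (simp add: euclidean_representation)
      also have "\<dots> = (\<Sum>b\<in>Basis. (Z (\<psi> w) \<bullet> b) *\<^sub>R D\<phi> (\<psi> w) b)"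
        using linear_phi[OF psi_in[OF w]] by (simp add: linear_sum linear_cmul)
      finally show "Y w = (\<Sum>b\<in>Basis. (Z (\<psi> w) \<bullet> b) *\<^sub>R pd U b \<phi> (\<psi> w))"
        by (simp add: Y_def at_within_open[OF psi_in[OF w] open_U])
    qed
  qed
  have "continuous (at t0) y" using y has_vector_derivative_continuous by blast
  then have "\<forall>\<^sub>F t in at t0. y t \<in> U"
    using t0(1) open_U by (simp add: continuous_at tendsto_def)
  then obtain e0 where e0: "e0 > 0" "\<And>t. t \<noteq> t0 \<Longrightarrow> dist t t0 < e0 \<Longrightarrow> y t \<in> U"
    unfolding eventually_at by auto
  have yU: "y (t0 + s) \<in> U" if "\<bar>s\<bar> < e0" for s
    using e0(2)[of "t0 + s"] t0(1) that by (cases "s = 0") (auto simp: dist_real_def)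
  have yd: "((\<lambda>s. y (t0 + s)) has_derivative (\<lambda>h. h *\<^sub>R Z (y (t0 + s)))) (at s)" for s
  proof -
    have "((\<lambda>s. t0 + s) has_derivative (\<lambda>h. h)) (at s)" by (auto intro!: derivative_eq_intros)
    from has_derivative_compose[OF this, of y "\<lambda>h. h *\<^sub>R Z (y (t0 + s))"] y[of "t0 + s"]
    show ?thesis by (simp add: has_vector_derivative_def)
  qed
  have ud: "(u has_vector_derivative Y (u s)) (at s)" if s: "\<bar>s\<bar> < e0" for s
  proof -
    have "(u has_derivative (\<lambda>h. D\<phi> (y (t0 + s)) (h *\<^sub>R Z (y (t0 + s))))) (at s)"
      unfolding u_def by (rule has_derivative_compose[OF yd has_derivative_phi[OF yU[OF s]]])
    then show ?thesis
      unfolding has_vector_derivative_def Y_def u_def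
      by (simp add: psi_phi[OF yU[OF s]] linear_cmul[OF linear_phi[OF yU[OF s]]])
  qed
  have "\<exists>\<epsilon>>0. \<forall>t. \<bar>t\<bar> < \<epsilon> \<longrightarrow> u t \<in> hspace m e"
  proof (rule viability[OF m e open_V Y])
    fix w assume w: "w \<in> V \<inter> hspace m e"
    then have p: "\<psi> w \<in> U" "\<psi> w \<in> M" using psi_in psi_mem_M by auto
    show "Y w \<in> coord_plane m" unfolding Y_def
      by (rule tangential_coordinates(1)[OF p tan[OF p(2)] bd m1])
    show "Y w \<bullet> e = 0" if "w \<bullet> e = 0" unfolding Y_def
      by (rule tangential_coordinates(2)[OF p tan[OF p(2)] bd m1]) (use that w phi_psi in auto)
  next
    show "u 0 \<in> V \<inter> hspace m e" unfolding u_def using t0 phi_in mem_M_iff by simp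
    show "e0 > 0" by fact
  qed (rule ud)
  then obtain \<epsilon> where \<epsilon>: "\<epsilon> > 0" "\<And>t. \<bar>t\<bar> < \<epsilon> \<Longrightarrow> u t \<in> hspace m e" by blast
  show ?thesis
  proof (intro exI[of _ "min \<epsilon> e0"] conjI allI impI)
    fix t assume t: "\<bar>t - t0\<bar> < min \<epsilon> e0"
    then have "y t \<in> U" "u (t - t0) \<in> hspace m e" using yU[of "t - t0"] \<epsilon>(2)[of "t - t0"] by auto
    then show "y t \<in> M" using mem_M_iff by (simp add: u_def)
  qed (use \<epsilon> e0 in simp)
qed

end

lemma submanifold_chart:
  assumes M: "submanifold r m (M::'a::euclidean_space set)" and p: "p \<in> M" and m: "m \<le> DIM('a)" and r: "1 \<le> r"
  obtains e U V \<phi> \<psi> where "mfd_chart r m M U V \<phi> \<psi> e" "p \<in> U"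
proof -
  obtain H U V \<phi> \<psi> where c: "model_space m H" "chart r M H U V \<phi> \<psi>" "p \<in> U"
    using M p unfolding submanifold_def by blast
  obtain e where "mfd_chart r m M U V \<phi> \<psi> e" by (rule mfd_chartI[OF c(2,1) m r])
  then show ?thesis using that c(3) by blast
qed

text \<open>The times at which a trajectory starting in \<open>M\<close> lies in \<open>M\<close>
  form a closed and open set. Equality rather than inclusion follows since the flow at time
  \<open>- t\<close> also preserves \<open>M\<close> and is the inverse by uniqueness of
  solutions.\<close>

lemma tangential_flow_invariant:
  fixes M :: "'a::euclidean_space set"
  assumes rk: "r = enat (Suc k)" "1 \<le> k" and m1: "1 \<le> m" and m: "m \<le> DIM('a)"
    and M: "closed M" "submanifold r m M" and Z: "Ck_on 1 Basis UNIV Z"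
    and tan: "\<And>p. p \<in> M \<Longrightarrow> Z p \<in> tangent_space r m M p"
    and bd: "\<And>p. p \<in> mfd_boundary r m M \<Longrightarrow> Z p \<bullet> outward_normal r m M p = 0"
    and \<Phi>: "is_flow Z \<Phi>"
  shows "\<Phi> t ` M = M"
proof -
  have r: "1 \<le> r" using rk by (simp add: one_enat_def)
  have d: "((\<lambda>s. \<Phi> s x) has_vector_derivative Z (\<Phi> t x)) (at t)" and init: "\<Phi> 0 x = x" for t x
    using \<Phi> by (auto simp: is_flow_def)
  have stay: "\<Phi> t x \<in> M" if x: "x \<in> M" for x t
  proof -
    define A where "A = {t. \<Phi> t x \<in> M}"
    have "isCont (\<lambda>t. \<Phi> t x) s" for s
      by (rule has_vector_derivative_continuous[OF d])
    from continuous_closed_vimage[OF M(1) this] have "closed A" by (simp add: A_def vimage_def)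
    moreover have "open A" unfolding open_dist
    proof
      fix t0 assume t0: "t0 \<in> A"
      then have p: "\<Phi> t0 x \<in> M" by (simp add: A_def)
      obtain e U V \<phi> \<psi> where ch: "mfd_chart r m M U V \<phi> \<psi> e" "\<Phi> t0 x \<in> U"
        by (rule submanifold_chart[OF M(2) p m r])
      have "\<exists>\<epsilon>>0. \<forall>t. \<bar>t - t0\<bar> < \<epsilon> \<longrightarrow> \<Phi> t x \<in> M"
        by (rule mfd_chart.flow_stays_locally[OF ch(1) rk m1 Z tan bd d ch(2) p])
      then show "\<exists>e>0. \<forall>y. dist y t0 < e \<longrightarrow> y \<in> A" by (auto simp: A_def dist_real_def)
    qed
    moreover have "0 \<in> A" using x init by (simp add: A_def)
    ultimately have "A = UNIV" using clopen[of A] by blast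
    then show ?thesis by (auto simp: A_def)
  qed
  show ?thesis
  proof
    show "\<Phi> t ` M \<subseteq> M" using stay by auto
    show "M \<subseteq> \<Phi> t ` M"
    proof
      fix x assume x: "x \<in> M"
      have "(\<lambda>s. \<Phi> (s - t) x) t = (\<lambda>s. \<Phi> s (\<Phi> (- t) x)) t"
      proof (rule ode_unique[where y = "\<lambda>s. \<Phi> (s - t) x" and z = "\<lambda>s. \<Phi> s (\<Phi> (- t) x)", OF Z])
        fix s
        have "((\<lambda>s. s - t) has_derivative (\<lambda>h. h)) (at s)" by (auto intro!: derivative_eq_intros)
        from has_derivative_compose[OF this, of "\<lambda>s. \<Phi> s x" "\<lambda>h. h *\<^sub>R Z (\<Phi> (s - t) x)"] d[of x "s - t"]
        show "((\<lambda>s. \<Phi> (s - t) x) has_vector_derivative Z (\<Phi> (s - t) x)) (at s)"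
          by (simp add: has_vector_derivative_def)
        show "((\<lambda>s. \<Phi> s (\<Phi> (- t) x)) has_vector_derivative Z (\<Phi> s (\<Phi> (- t) x))) (at s)" by (rule d)
      qed (simp add: init)
      then have "x = \<Phi> t (\<Phi> (- t) x)" by (simp add: init)
      then show "x \<in> \<Phi> t ` M" using stay[OF x, of "- t"] by blast
    qed
  qed
qed

section \<open>Extension operators\<close>

lemma Ck_on_restrict_directions:
  assumes "Ck_on k Basis V f" "open V" "ray_set S B" "S \<subseteq> V" "B \<subseteq> Basis"
  shows "Ck_on k B S f"
proof (rule Ck_onI)
  fix n assume "enat n \<le> k"
  then have "Ck_on (enat n) B V f" by (rule Ck_on_mono[OF assms(1) _ assms(5)])
  then show "Ck_on (enat n) B S f" by (rule Ck_on_restrict(1)[OF assms(3) ray_set_open[OF assms(2)] assms(4)])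
qed

text \<open>\<open>Ck_mfd\<close> quantifies over all charts. A local C^k extension into the ambient
  space is independent of charts and yields every local representative by composition with
  \<open>\<psi>\<close>.\<close>

lemma Ck_mfdI:
  fixes f :: "'a::euclidean_space \<Rightarrow> 'b::real_normed_vector"
  assumes m: "m \<le> DIM('a)" and r: "1 \<le> r" and kr: "k \<le> r" and z: "\<And>x. x \<notin> M \<Longrightarrow> f x = 0"
    and loc: "\<And>p. p \<in> M \<Longrightarrow> \<exists>W F. open W \<and> p \<in> W \<and> Ck_on k Basis W F \<and> (\<forall>x\<in>W \<inter> M. f x = F x)"
  shows "f \<in> Ck_mfd r m M k"
  unfolding Ck_mfd_def
proof (intro CollectI conjI allI impI)
  fix H U V and \<phi> \<psi> :: "'a \<Rightarrow> 'a" assume c: "model_space m H \<and> chart r M H U V \<phi> \<psi>"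
  obtain e where H: "H = hspace m e" and ch: "mfd_chart r m M U V \<phi> \<psi> e"
    by (rule mfd_chartI[of r M H U V \<phi> \<psi> m]) (use c m r in auto)
  interpret mfd_chart r m M U V \<phi> \<psi> e by (rule ch)
  show "Ck_on k (ebasis ` {..<m}) (V \<inter> H) (f \<circ> \<psi>)"
  proof (rule Ck_on_local)
    fix y assume y: "y \<in> V \<inter> H"
    then have "\<psi> y \<in> M" using psi_mem_M H by auto
    then obtain W F where W: "open W" "\<psi> y \<in> W" "Ck_on k Basis W F" "\<forall>x\<in>W \<inter> M. f x = F x"
      using loc by blast
    define T' where "T' = V \<inter> \<psi> -` W"
    have T': "open T'" unfolding T'_def
      using continuous_open_preimage[OF Ck_on_continuous[OF Ck_psi] open_V W(1)] .
    have R: "ray_set (V \<inter> H \<inter> T') (ebasis ` {..<m})"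
      using c by (intro ray_set_Int_open[OF ray_set_chart[OF _ m open_V] T']) auto
    have C: "Ck_on k (ebasis ` {..<m}) (V \<inter> H \<inter> T') \<psi>"
      by (rule Ck_on_restrict_directions[OF Ck_on_mono[OF Ck_psi kr order_refl] open_V R _ ebasis_image_subset[OF m]]) auto
    have "Ck_on k (ebasis ` {..<m}) (V \<inter> H \<inter> T') (\<lambda>x. F (\<psi> x))"
      by (rule Ck_on_compose[OF R W(1) _ C W(3)]) (auto simp: T'_def)
    moreover have "\<forall>z\<in>V \<inter> H \<inter> T'. (f \<circ> \<psi>) z = F (\<psi> z)"
      using W(4) psi_mem_M H by (auto simp: T'_def)
    ultimately show "\<exists>T g. open T \<and> y \<in> T \<and> (\<forall>y\<in>V \<inter> H \<inter> T. (f \<circ> \<psi>) y = g y) \<and> Ck_on k (ebasis ` {..<m}) (V \<inter> H \<inter> T) g"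
      using T' y W(2) by (intro exI[of _ T'] exI[of _ "\<lambda>x. F (\<psi> x)"]) (auto simp: T'_def)
  qed
qed (use z in auto)

lemma Ck_mfd_chartD:
  "f \<in> Ck_mfd r m M k \<Longrightarrow> model_space m H \<Longrightarrow> chart r M H U V \<phi> \<psi> \<Longrightarrow> Ck_on k (ebasis ` {..<m}) (V \<inter> H) (f \<circ> \<psi>)"
  unfolding Ck_mfd_def by blast

lemma Ck_mfd_lincomb:
  fixes f g :: "'a::euclidean_space \<Rightarrow> 'b::real_normed_vector"
  assumes m: "m \<le> DIM('a)" and f: "f \<in> Ck_mfd r m M k" and g: "g \<in> Ck_mfd r m M k"
  shows "(\<lambda>x. a *\<^sub>R f x + b *\<^sub>R g x) \<in> Ck_mfd r m M k"
  unfolding Ck_mfd_def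
proof (intro CollectI conjI allI impI)
  fix H U V and \<phi> \<psi> :: "'a \<Rightarrow> 'a" assume c: "model_space m H \<and> chart r M H U V \<phi> \<psi>"
  then have R: "ray_set (V \<inter> H) (ebasis ` {..<m})" using m by (intro ray_set_chart) (auto simp: chart_def)
  have "Ck_on k (ebasis ` {..<m}) (V \<inter> H) (\<lambda>x. a *\<^sub>R (f \<circ> \<psi>) x + b *\<^sub>R (g \<circ> \<psi>) x)"
    by (rule Ck_on_lincomb[OF R Ck_mfd_chartD[OF f conjunct1[OF c] conjunct2[OF c]] Ck_mfd_chartD[OF g conjunct1[OF c] conjunct2[OF c]]])
  then show "Ck_on k (ebasis ` {..<m}) (V \<inter> H) ((\<lambda>x. a *\<^sub>R f x + b *\<^sub>R g x) \<circ> \<psi>)" by (simp add: o_def)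
qed (use f g in \<open>auto simp: Ck_mfd_def\<close>)

lemma Ck_mfd_diff:
  fixes f g :: "'a::euclidean_space \<Rightarrow> 'b::real_normed_vector"
  assumes "m \<le> DIM('a)" "f \<in> Ck_mfd r m M k" "g \<in> Ck_mfd r m M k"
  shows "(\<lambda>x. f x - g x) \<in> Ck_mfd r m M k"
  using Ck_mfd_lincomb[OF assms, of 1 "-1"] by simp

lemma Ck_mfd_seminorms_cases:
  assumes "q \<in> Ck_mfd_seminorms r m (M::'a::euclidean_space set) (enat k)"
  obtains H U V \<phi> \<psi> K bs where "q = (\<lambda>f. SUP x\<in>K. norm (partials (V \<inter> H) bs (f \<circ> \<psi>) x))"
    "model_space m H" "chart r M H U V \<phi> \<psi>" "compact K" "K \<noteq> {}" "K \<subseteq> V \<inter> H"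
    "set bs \<subseteq> ebasis ` {..<m}" "length bs \<le> k"
  using assms unfolding Ck_mfd_seminorms_def enat_ord_simps(1) by blast

lemma Ck_mfd_seminorm_zero:
  assumes m: "m \<le> DIM('a)" and q: "q \<in> Ck_mfd_seminorms r m (M::'a::euclidean_space set) (enat k)"
  shows "q (\<lambda>x. 0) = 0"
  using q
proof (rule Ck_mfd_seminorms_cases)
  fix H U V \<phi> \<psi> K bs
  assume q: "q = (\<lambda>f. SUP x\<in>K. norm (partials (V \<inter> H) bs (f \<circ> \<psi>) x))"
    and c: "model_space m H" "chart r M H U V \<phi> \<psi>" and K: "compact K" "K \<noteq> {}" "K \<subseteq> V \<inter> H"
    and bs: "set bs \<subseteq> ebasis ` {..<m}" "length bs \<le> k"
  have R: "ray_set (V \<inter> H) (ebasis ` {..<m})" using m c by (intro ray_set_chart) (auto simp: chart_def)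
  have "norm (partials (V \<inter> H) bs ((\<lambda>x. 0) \<circ> \<psi>) x) = 0" if "x \<in> K" for x
    using partials_zero[OF R bs(1), of x] K that by (auto simp: o_def)
  then have "(SUP x\<in>K. norm (partials (V \<inter> H) bs ((\<lambda>x. 0) \<circ> \<psi>) x)) = (SUP x\<in>K. 0)"
    by (intro SUP_cong refl)
  also have "\<dots> = 0" by (rule cSUP_const[OF K(2)])
  finally show "q (\<lambda>x. 0) = 0" unfolding q .
qed

text \<open>Compactness of \<open>K\<close> bounds the values, so that the real-valued
  \<open>SUP\<close> really is an upper bound.\<close>

lemma Ck_mfd_seminorm_upper:
  fixes f :: "'a::euclidean_space \<Rightarrow> 'b::real_normed_vector"
  assumes f: "f \<in> Ck_mfd r m M (enat k)" and c: "model_space m H" "chart r M H U V \<phi> \<psi>"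
    and K: "compact K" "K \<subseteq> V \<inter> H" and bs: "set bs \<subseteq> ebasis ` {..<m}" "length bs \<le> k" and x: "x \<in> K"
  shows "norm (partials (V \<inter> H) bs (f \<circ> \<psi>) x) \<le> (SUP x\<in>K. norm (partials (V \<inter> H) bs (f \<circ> \<psi>) x))"
proof (rule cSUP_upper[OF x])
  have "continuous_on (V \<inter> H) (partials (V \<inter> H) bs (f \<circ> \<psi>))"
    using Ck_mfd_chartD[OF f c] bs by (simp add: Ck_on_def)
  then have "compact ((\<lambda>x. norm (partials (V \<inter> H) bs (f \<circ> \<psi>) x)) ` K)"
    by (intro compact_continuous_image K continuous_on_norm) (rule continuous_on_subset[OF _ K(2)])
  then show "bdd_above ((\<lambda>x. norm (partials (V \<inter> H) bs (f \<circ> \<psi>) x)) ` K)"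
    by (intro bounded_imp_bdd_above compact_imp_bounded)
qed

lemma Ck_mfd_seminorm_nonneg:
  fixes f :: "'a::euclidean_space \<Rightarrow> 'b::real_normed_vector"
  assumes f: "f \<in> Ck_mfd r m M (enat k)" and q: "q \<in> Ck_mfd_seminorms r m M (enat k)"
  shows "0 \<le> q f"
  using q
proof (rule Ck_mfd_seminorms_cases)
  fix H U V \<phi> \<psi> K bs
  assume q: "q = (\<lambda>f. SUP x\<in>K. norm (partials (V \<inter> H) bs (f \<circ> \<psi>) x))"
    and c: "model_space m H" "chart r M H U V \<phi> \<psi>" and K: "compact K" "K \<noteq> {}" "K \<subseteq> V \<inter> H"
    and bs: "set bs \<subseteq> ebasis ` {..<m}" "length bs \<le> k"
  obtain x where x: "x \<in> K" using K by blast
  show "0 \<le> q f" unfolding q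
    using Ck_mfd_seminorm_upper[OF f c K(1,3) bs x] norm_ge_zero order_trans by blast
qed

section \<open>Bounded linear operators into compactly supported fields\<close>

text \<open>Boundedness is stated as one estimate of the jet at all points by finitely many
  seminorms, the form in which \<open>Ckc_functional_bound\<close> can consume it.\<close>

definition jet_bounded_op ::
    "('a \<Rightarrow> 'b::real_normed_vector) set \<Rightarrow> (('a \<Rightarrow> 'b) \<Rightarrow> real) set \<Rightarrow> 'a::euclidean_space set \<Rightarrow> nat \<Rightarrow>
      (('a \<Rightarrow> 'b) \<Rightarrow> 'a \<Rightarrow> 'a) \<Rightarrow> bool"
  where "jet_bounded_op F P D k E \<longleftrightarrow>
    (\<forall>f\<in>F. E f \<in> Ckc D (enat k)) \<and>
    (\<forall>f\<in>F. \<forall>g\<in>F. \<forall>a b. E (\<lambda>x. a *\<^sub>R f x + b *\<^sub>R g x) = (\<lambda>x. a *\<^sub>R E f x + b *\<^sub>R E g x)) \<and>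
    (\<exists>C\<ge>0. \<exists>Q. finite Q \<and> Q \<subseteq> P \<and> (\<forall>f\<in>F. \<forall>x. jet UNIV Basis k (E f) x \<le> C * (\<Sum>q\<in>Q. q f)))"

lemma jet_bounded_op_zero: "jet_bounded_op F P D k (\<lambda>f x. 0)"
  unfolding jet_bounded_op_def
  by (auto simp: Ckc_zero jet_zero[OF ray_set_open[OF open_UNIV] UNIV_I] intro!: exI[of _ 0] exI[of _ "{}"])

lemma jet_bounded_op_add:
  assumes E1: "jet_bounded_op F P D k E1" and E2: "jet_bounded_op F P D k E2"
    and nn: "\<And>q f. q \<in> P \<Longrightarrow> f \<in> F \<Longrightarrow> 0 \<le> q f"
  shows "jet_bounded_op F P D k (\<lambda>f x. E1 f x + E2 f x)"
proof -
  obtain C1 Q1 where 1: "C1 \<ge> 0" "finite Q1" "Q1 \<subseteq> P" "\<And>f x. f \<in> F \<Longrightarrow> jet UNIV Basis k (E1 f) x \<le> C1 * (\<Sum>q\<in>Q1. q f)"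
    using E1 unfolding jet_bounded_op_def by blast
  obtain C2 Q2 where 2: "C2 \<ge> 0" "finite Q2" "Q2 \<subseteq> P" "\<And>f x. f \<in> F \<Longrightarrow> jet UNIV Basis k (E2 f) x \<le> C2 * (\<Sum>q\<in>Q2. q f)"
    using E2 unfolding jet_bounded_op_def by blast
  have m1: "E1 f \<in> Ckc D (enat k)" "E2 f \<in> Ckc D (enat k)" if "f \<in> F" for f
    using E1 E2 that unfolding jet_bounded_op_def by blast+
  have l: "E1 (\<lambda>x. a *\<^sub>R f x + b *\<^sub>R g x) = (\<lambda>x. a *\<^sub>R E1 f x + b *\<^sub>R E1 g x)"
      "E2 (\<lambda>x. a *\<^sub>R f x + b *\<^sub>R g x) = (\<lambda>x. a *\<^sub>R E2 f x + b *\<^sub>R E2 g x)" if "f \<in> F" "g \<in> F" for f g a b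
    using E1 E2 that unfolding jet_bounded_op_def by blast+
  show ?thesis unfolding jet_bounded_op_def
  proof (intro conjI ballI allI exI[of _ "C1 + C2"] exI[of _ "Q1 \<union> Q2"])
    show "(\<lambda>x. E1 f x + E2 f x) \<in> Ckc D (enat k)" if "f \<in> F" for f
      using Ckc_lincomb[OF m1[OF that], of 1 1] by simp
    show "(\<lambda>x. E1 (\<lambda>x. a *\<^sub>R f x + b *\<^sub>R g x) x + E2 (\<lambda>x. a *\<^sub>R f x + b *\<^sub>R g x) x) =
      (\<lambda>x. a *\<^sub>R (E1 f x + E2 f x) + b *\<^sub>R (E1 g x + E2 g x))" if "f \<in> F" "g \<in> F" for f g a b
      unfolding l[OF that] by (simp add: fun_eq_iff algebra_simps)
    show "0 \<le> C1 + C2" "finite (Q1 \<union> Q2)" "Q1 \<union> Q2 \<subseteq> P" using 1 2 by auto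
    fix f x assume f: "f \<in> F"
    have s1: "(\<Sum>q\<in>Q1. q f) \<le> (\<Sum>q\<in>Q1 \<union> Q2. q f)" "(\<Sum>q\<in>Q2. q f) \<le> (\<Sum>q\<in>Q1 \<union> Q2. q f)"
      using 1 2 nn f by (auto intro!: sum_mono2)
    have "jet UNIV Basis k (\<lambda>x. E1 f x + E2 f x) x \<le> jet UNIV Basis k (E1 f) x + jet UNIV Basis k (E2 f) x"
      by (rule jet_add_le[OF finite_Basis ray_set_open[OF open_UNIV] Ckc_Ck_on[OF m1(1)[OF f]] Ckc_Ck_on[OF m1(2)[OF f]] UNIV_I])
    also have "\<dots> \<le> C1 * (\<Sum>q\<in>Q1 \<union> Q2. q f) + C2 * (\<Sum>q\<in>Q1 \<union> Q2. q f)"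
      by (intro add_mono order_trans[OF 1(4)[OF f]] order_trans[OF 2(4)[OF f]] mult_left_mono s1 1 2)
    finally show "jet UNIV Basis k (\<lambda>x. E1 f x + E2 f x) x \<le> (C1 + C2) * (\<Sum>q\<in>Q1 \<union> Q2. q f)"
      by (simp add: distrib_right)
  qed
qed

lemma jet_zero_outside:
  assumes "closed K" "\<And>x. x \<notin> K \<Longrightarrow> f x = 0" "x \<notin> K"
  shows "jet UNIV Basis k f x = 0"
  unfolding jet_def using assms by (intro sum.neutral ballI) (simp add: partials_zero_outside[OF assms])

lemma Ckc_scaleR:
  assumes "Ck_on (enat k) Basis UNIV \<theta>" "X \<in> Ckc D (enat k)"
  shows "(\<lambda>x. \<theta> x *\<^sub>R X x) \<in> Ckc D (enat k)"
proof -
  have "Ck_on (enat k) Basis UNIV (\<lambda>x. \<theta> x *\<^sub>R X x)"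
    by (rule Ck_on_scaleR[OF ray_set_open[OF open_UNIV] assms(1) Ckc_Ck_on[OF assms(2)]])
  moreover obtain K where "compact K" "K \<subseteq> D" "\<forall>x. x \<notin> K \<longrightarrow> X x = 0" using assms(2) by (auto simp: Ckc_def)
  ultimately show ?thesis unfolding Ckc_def by auto
qed

text \<open>The derivatives of \<open>\<theta>\<close> are bounded on the compact closure of
  \<open>D\<close>, and outside that closure the fields vanish.\<close>

lemma jet_bounded_op_scaleR:
  fixes E :: "('a \<Rightarrow> 'b::real_normed_vector) \<Rightarrow> 'a::euclidean_space \<Rightarrow> 'a"
  assumes E: "jet_bounded_op F P D k E" and \<theta>: "Ck_on (enat k) Basis UNIV \<theta>" and D: "bounded D"
  shows "jet_bounded_op F P D k (\<lambda>f x. \<theta> x *\<^sub>R E f x)"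
proof -
  obtain C Q where 1: "C \<ge> 0" "finite Q" "Q \<subseteq> P" "\<And>f x. f \<in> F \<Longrightarrow> jet UNIV Basis k (E f) x \<le> C * (\<Sum>q\<in>Q. q f)"
    using E unfolding jet_bounded_op_def by blast
  have m1: "E f \<in> Ckc D (enat k)" if "f \<in> F" for f
    using E that unfolding jet_bounded_op_def by blast
  have l: "E (\<lambda>x. a *\<^sub>R f x + b *\<^sub>R g x) = (\<lambda>x. a *\<^sub>R E f x + b *\<^sub>R E g x)" if "f \<in> F" "g \<in> F" for f g a b
    using E that unfolding jet_bounded_op_def by blast
  have cD: "compact (closure D)" using D bounded_closure closed_closure compact_eq_bounded_closed by blast
  have "\<exists>C'\<ge>0. \<forall>f::'a \<Rightarrow> 'a. Ck_on (enat k) Basis UNIV f \<longrightarrow>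
    (\<forall>x\<in>closure D. jet UNIV Basis k (\<lambda>x. \<theta> x *\<^sub>R f x) x \<le> C' * jet UNIV Basis k f x)"
    by (rule jet_bilinear_le[OF bounded_bilinear.flip[OF bounded_bilinear_scaleR] ray_set_open[OF open_UNIV] finite_Basis \<theta> cD subset_UNIV])
  then obtain C' where C': "C' \<ge> 0" "\<And>f::'a \<Rightarrow> 'a. \<And>x. Ck_on (enat k) Basis UNIV f \<Longrightarrow> x \<in> closure D \<Longrightarrow>
    jet UNIV Basis k (\<lambda>x. \<theta> x *\<^sub>R f x) x \<le> C' * jet UNIV Basis k f x" by blast
  show ?thesis unfolding jet_bounded_op_def
  proof (intro conjI ballI allI exI[of _ "C' * C"] exI[of _ Q])
    show "(\<lambda>x. \<theta> x *\<^sub>R E f x) \<in> Ckc D (enat k)" if "f \<in> F" for f by (rule Ckc_scaleR[OF \<theta> m1[OF that]])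
    show "(\<lambda>x. \<theta> x *\<^sub>R E (\<lambda>x. a *\<^sub>R f x + b *\<^sub>R g x) x) = (\<lambda>x. a *\<^sub>R \<theta> x *\<^sub>R E f x + b *\<^sub>R \<theta> x *\<^sub>R E g x)"
      if "f \<in> F" "g \<in> F" for f g a b
      unfolding l[OF that] by (simp add: fun_eq_iff algebra_simps)
    show "0 \<le> C' * C" "finite Q" "Q \<subseteq> P" using 1 C' by auto
    fix f x assume f: "f \<in> F"
    have le: "jet UNIV Basis k (E f) x \<le> C * (\<Sum>q\<in>Q. q f)" by (rule 1(4)[OF f])
    show "jet UNIV Basis k (\<lambda>x. \<theta> x *\<^sub>R E f x) x \<le> C' * C * (\<Sum>q\<in>Q. q f)"
    proof (cases "x \<in> closure D")
      case True
      show ?thesis using C'(2)[OF Ckc_Ck_on[OF m1[OF f]] True] mult_left_mono[OF le C'(1)] by (simp add: mult.assoc)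
    next
      case False
      obtain K where K: "K \<subseteq> D" "\<And>x. x \<notin> K \<Longrightarrow> E f x = 0" using m1[OF f] by (auto simp: Ckc_def)
      have "jet UNIV Basis k (\<lambda>x. \<theta> x *\<^sub>R E f x) x = 0"
      proof (rule jet_zero_outside[OF closed_closure _ False])
        fix y assume "y \<notin> closure D"
        then have "y \<notin> K" using K(1) closure_subset by blast
        then show "\<theta> y *\<^sub>R E f y = 0" using K(2) by simp
      qed
      moreover have "0 \<le> C * (\<Sum>q\<in>Q. q f)" using le jet_nonneg order_trans by blast
      ultimately show ?thesis using C'(1) by (simp add: mult.assoc)
    qed
  qed
qed

text \<open>The source of continuity for \<open>h\<close> and \<open>g\<close>: the jet estimate of
  the operator is chained with the bound of \<open>L\<close> by uniform jets.\<close>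

lemma jet_bounded_op_functional:
  fixes E :: "('a \<Rightarrow> 'b::real_normed_vector) \<Rightarrow> 'a::euclidean_space \<Rightarrow> 'a"
  assumes E: "jet_bounded_op F P D k E"
    and F: "\<And>f g. f \<in> F \<Longrightarrow> g \<in> F \<Longrightarrow> (\<lambda>x. f x - g x) \<in> F" and P: "\<And>q. q \<in> P \<Longrightarrow> q (\<lambda>x. 0) = 0"
    and lin: "linear_functional_on (Ckc D (enat k)) L"
    and L: "continuous_functional_on (Ckc D (enat k)) (Ckc_seminorms D (enat k)) L"
  shows "linear_functional_on F (\<lambda>f. L (E f))" and "continuous_functional_on F P (\<lambda>f. L (E f))"
proof -
  obtain C Q where 1: "C \<ge> 0" "finite Q" "Q \<subseteq> P" "\<And>f x. f \<in> F \<Longrightarrow> jet UNIV Basis k (E f) x \<le> C * (\<Sum>q\<in>Q. q f)"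
    using E unfolding jet_bounded_op_def by blast
  have m1: "E f \<in> Ckc D (enat k)" if "f \<in> F" for f
    using E that unfolding jet_bounded_op_def by blast
  have l: "E (\<lambda>x. a *\<^sub>R f x + b *\<^sub>R g x) = (\<lambda>x. a *\<^sub>R E f x + b *\<^sub>R E g x)" if "f \<in> F" "g \<in> F" for f g a b
    using E that unfolding jet_bounded_op_def by blast
  show lf: "linear_functional_on F (\<lambda>f. L (E f))"
    unfolding linear_functional_on_def
  proof (intro ballI allI)
    fix f g a b assume fg: "f \<in> F" "g \<in> F"
    show "L (E (\<lambda>x. a *\<^sub>R f x + b *\<^sub>R g x)) = a * L (E f) + b * L (E g)"
      unfolding l[OF fg] using lin m1[OF fg(1)] m1[OF fg(2)] by (simp add: linear_functional_on_def)
  qed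
  show "continuous_functional_on F P (\<lambda>f. L (E f))"
  proof (rule Ckc_functional_bound[OF lin L])
    fix C' assume C': "0 \<le> C'" "\<And>X s. X \<in> Ckc D (enat k) \<Longrightarrow> (\<And>x. jet UNIV Basis k X x \<le> s) \<Longrightarrow> \<bar>L X\<bar> \<le> C' * s"
    show ?thesis
    proof (rule continuous_functional_onI[OF F lf 1(2,3), where C = "C' * C"])
      show "q (\<lambda>x. 0) = 0" if "q \<in> Q" for q using P 1(3) that by blast
      show "\<bar>L (E f)\<bar> \<le> C' * C * (\<Sum>q\<in>Q. q f)" if "f \<in> F" for f
        using C'(2)[OF m1[OF that] 1(4)[OF that]] by (simp add: mult.assoc)
    qed (use 1 C' in auto)
  qed
qed

context mfd_chart begin

text \<open>Straighten by \<open>\<phi>\<close>, extend by reflection, pull back. \<open>Ext\<close>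
  is linear on all functions because it is a finite combination of point evaluations; regularity and
  bounds are then claimed for C^k functions.\<close>

lemma local_extension:
  assumes kr: "enat k \<le> r" and p: "p \<in> U" "p \<in> M"
  shows "\<exists>W Ext. open W \<and> p \<in> W \<and> W \<subseteq> U \<and>
    (\<forall>f g a b x. Ext (\<lambda>x. a *\<^sub>R f x + b *\<^sub>R g x) x = a *\<^sub>R Ext f x + b *\<^sub>R (Ext g x :: 'b::real_normed_vector)) \<and>
    (\<forall>f \<in> Ck_mfd r m M (enat k). Ck_on (enat k) Basis W (Ext f) \<and> (\<forall>x\<in>W \<inter> M. Ext f x = f x)) \<and>
    (\<exists>C\<ge>0. \<exists>Q. finite Q \<and> Q \<subseteq> Ck_mfd_seminorms r m M (enat k) \<and>
      (\<forall>f \<in> Ck_mfd r m M (enat k). \<forall>x\<in>W. jet W Basis k (Ext f) x \<le> C * (\<Sum>q\<in>Q. q f)))"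
proof -
  let ?H = "hspace m e"
  let ?Bm = "ebasis ` {..<m} :: 'a set"
  define y0 where "y0 = \<phi> p"
  have y0: "y0 \<in> V" "y0 \<in> ?H" using phi_in mem_M_iff p by (auto simp: y0_def)
  obtain R where R: "R > 0" "cball y0 R \<subseteq> V" using y0 open_V by (meson open_contains_cball)
  define K where "K = cball y0 R \<inter> ?H"
  define B where "B = ball y0 (R / (real k + 3))"
  interpret x: extension_domain m k e V B K
    unfolding B_def K_def by (rule extension_domain_ball[OF m e open_V y0(2) R])
  \<comment> \<open>\<open>k + 1\<close> samples are enough to satisfy the moment conditions of
    order 0 to \<open>k\<close>.\<close>
  define a where "a j = (-1) ^ j * real (Suc k choose Suc j)" for j
  have a: "moments k k a" unfolding a_def by (rule moments_exist)
  define Oo where "Oo = U \<inter> \<phi> -` B"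
  have openO: "open Oo" unfolding Oo_def
    using continuous_open_preimage[OF Ck_on_continuous[OF Ck_phi] open_U x.B] .
  have "p \<in> Oo" using p R by (simp add: Oo_def B_def y0_def)
  \<comment> \<open>A closed ball inside \<open>Oo\<close> provides the compact set on which
    composition with \<open>\<phi>\<close> has a uniform constant; \<open>W\<close> is its open
    version.\<close>
  then obtain s where s: "s > 0" "cball p s \<subseteq> Oo" using openO by (meson open_contains_cball)
  define W where "W = ball p s"
  have WO: "W \<subseteq> Oo" using s(2) by (auto simp: W_def)
  define Ext where "Ext f x = hestenes m e k a (f \<circ> \<psi>) (\<phi> x)" for f :: "'a \<Rightarrow> 'b" and x
  have RO: "ray_set Oo Basis" by (rule ray_set_open[OF openO])
  have phiB: "\<phi> ` Oo \<subseteq> B" by (auto simp: Oo_def)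
  have Ckphi: "Ck_on (enat k) Basis Oo \<phi>"
    by (rule Ck_on_open_subset[OF Ck_on_mono[OF Ck_phi kr order_refl] openO]) (auto simp: Oo_def)
  have Kc: "compact K" unfolding K_def
  proof (intro compact_Int_closed compact_cball)
    have "closed (\<Inter>i\<in>{i. m \<le> i \<and> i < DIM('a)}. {x::'a. x \<bullet> ebasis i = 0})"
      by (intro closed_INT ballI closed_Collect_eq continuous_intros)
    moreover have "closed {x::'a. 0 \<le> x \<bullet> e}" by (intro closed_Collect_le continuous_intros)
    ultimately have "closed ((\<Inter>i\<in>{i. m \<le> i \<and> i < DIM('a)}. {x::'a. x \<bullet> ebasis i = 0}) \<inter> {x. 0 \<le> x \<bullet> e})" by (rule closed_Int)
    also have "((\<Inter>i\<in>{i. m \<le> i \<and> i < DIM('a)}. {x::'a. x \<bullet> ebasis i = 0}) \<inter> {x. 0 \<le> x \<bullet> e}) = ?H"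
      by (auto simp: hspace_def coord_plane_def)
    finally show "closed ?H" .
  qed
  have "y0 \<in> K" using y0(2) R by (simp add: K_def)
  then have Kne: "K \<noteq> {}" by blast
  obtain A where A: "A \<ge> 0" "\<And>v::'a \<Rightarrow> 'b. Ck_on (enat k) ?Bm (V \<inter> ?H) v \<Longrightarrow> Ck_on (enat k) Basis B (hestenes m e k a v)"
    "\<And>v::'a \<Rightarrow> 'b. \<And>s y. Ck_on (enat k) ?Bm (V \<inter> ?H) v \<Longrightarrow> y \<in> B \<Longrightarrow> (\<forall>z\<in>K. jet (V \<inter> ?H) ?Bm k v z \<le> s) \<Longrightarrow>
      jet B Basis k (hestenes m e k a v) y \<le> A * s"
    using x.hestenes_Ck[OF a, where ?'b = 'b] by blast
  have "\<exists>C\<ge>0. \<forall>F::'a \<Rightarrow> 'b. Ck_on (enat k) Basis B F \<longrightarrow>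
    (\<forall>x\<in>cball p s. jet Oo Basis k (\<lambda>x. F (\<phi> x)) x \<le> C * jet B Basis k F (\<phi> x))"
    by (rule jet_compose_le[OF RO finite_Basis x.B phiB Ckphi compact_cball s(2)])
  then obtain C where C: "C \<ge> 0" "\<And>F::'a \<Rightarrow> 'b. \<And>x. Ck_on (enat k) Basis B F \<Longrightarrow> x \<in> cball p s \<Longrightarrow>
      jet Oo Basis k (\<lambda>x. F (\<phi> x)) x \<le> C * jet B Basis k F (\<phi> x)" by blast
  define q where "q bs = (\<lambda>f::'a \<Rightarrow> 'b. SUP x\<in>K. norm (partials (V \<inter> ?H) bs (f \<circ> \<psi>) x))" for bs
  define Ls where "Ls = {bs. set bs \<subseteq> ?Bm \<and> length bs \<le> k}"
  have finL: "finite Ls" unfolding Ls_def by (rule finite_lists_length_le) simp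
  have qP: "q ` Ls \<subseteq> Ck_mfd_seminorms r m M (enat k)"
  proof
    fix g assume "g \<in> q ` Ls"
    then obtain bs where bs: "g = q bs" "bs \<in> Ls" by blast
    show "g \<in> Ck_mfd_seminorms r m M (enat k)"
      unfolding bs(1) q_def Ck_mfd_seminorms_def
      apply (rule CollectI, rule exI[of _ ?H], rule exI[of _ U], rule exI[of _ V], rule exI[of _ \<phi>], rule exI[of _ \<psi>],
          rule exI[of _ K], rule exI[of _ bs])
      using bs(2) Kc Kne x.K model chart by (auto simp: Ls_def)
  qed
  \<comment> \<open>Different direction lists may define the same seminorm, which the sum over the
    image counts once. Each of the \<open>card Ls\<close> terms is therefore estimated by the entire
    sum.\<close>
  define Csum where "Csum f = real (card Ls) * (\<Sum>g\<in>q ` Ls. g f)" for f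
  have jetK: "jet (V \<inter> ?H) ?Bm k (f \<circ> \<psi>) z \<le> Csum f" if f: "f \<in> Ck_mfd r m M (enat k)" and z: "z \<in> K" for f z
  proof -
    have "jet (V \<inter> ?H) ?Bm k (f \<circ> \<psi>) z \<le> (\<Sum>bs\<in>Ls. \<Sum>g\<in>q ` Ls. g f)"
      unfolding jet_def Ls_def[symmetric]
    proof (rule sum_mono)
      fix bs assume bs: "bs \<in> Ls"
      have "norm (partials (V \<inter> ?H) bs (f \<circ> \<psi>) z) \<le> q bs f"
        unfolding q_def using bs
        by (intro Ck_mfd_seminorm_upper[OF f model chart Kc x.K _ _ z]) (auto simp: Ls_def)
      also have "\<dots> \<le> (\<Sum>g\<in>q ` Ls. g f)"
        by (rule member_le_sum) (use bs finL qP Ck_mfd_seminorm_nonneg[OF f] in auto)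
      finally show "norm (partials (V \<inter> ?H) bs (f \<circ> \<psi>) z) \<le> (\<Sum>g\<in>q ` Ls. g f)" .
    qed
    then show ?thesis by (simp add: Csum_def)
  qed
  have Ckv: "Ck_on (enat k) ?Bm (V \<inter> ?H) (f \<circ> \<psi>)" if "f \<in> Ck_mfd r m M (enat k)" for f :: "'a \<Rightarrow> 'b"
    by (rule Ck_mfd_chartD[OF that model chart])
  have CkO: "Ck_on (enat k) Basis Oo (Ext f)" if "f \<in> Ck_mfd r m M (enat k)" for f
    unfolding Ext_def by (rule Ck_on_compose[OF RO x.B phiB Ckphi A(2)[OF Ckv[OF that]]])
  show ?thesis
  proof (intro exI[of _ W] exI[of _ Ext] conjI allI ballI exI[of _ "C * A * real (card Ls)"] exI[of _ "q ` Ls"])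
    show "open W" "p \<in> W" using s by (auto simp: W_def)
    show "W \<subseteq> U" using WO by (auto simp: Oo_def)
    show "Ext (\<lambda>x. a *\<^sub>R f x + b *\<^sub>R g x) x = a *\<^sub>R Ext f x + b *\<^sub>R Ext g x" for f g a b x
      unfolding Ext_def hestenes_def
      by (simp add: scaleR_add_right sum.distrib scaleR_sum_right mult.commute)
    show "0 \<le> C * A * real (card Ls)" using C A by simp
    show "finite (q ` Ls)" using finL by simp
    show "q ` Ls \<subseteq> Ck_mfd_seminorms r m M (enat k)" by (rule qP)
    fix f :: "'a \<Rightarrow> 'b" assume f: "f \<in> Ck_mfd r m M (enat k)"
    show "Ck_on (enat k) Basis W (Ext f)"
      by (rule Ck_on_open_subset[OF CkO[OF f] _ WO]) (simp add: W_def)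
    show "Ext f x = f x" if x: "x \<in> W \<inter> M" for x
    proof -
      have xU: "x \<in> U" using x WO by (auto simp: Oo_def)
      then have h: "\<phi> x \<in> ?H" using mem_M_iff x by blast
      then show ?thesis using proj_fix[OF m, of "\<phi> x"] psi_phi[OF xU] by (simp add: Ext_def hestenes_def hspace_def)
    qed
    fix x assume x: "x \<in> W"
    then have xO: "x \<in> Oo" using WO by blast
    have "jet W Basis k (Ext f) x = jet UNIV Basis k (Ext f) x" using x by (intro jet_open) (auto simp: W_def)
    also have "\<dots> = jet Oo Basis k (\<lambda>x. hestenes m e k a (f \<circ> \<psi>) (\<phi> x)) x"
      unfolding Ext_def using jet_open[OF openO xO] by metis
    also have "\<dots> \<le> C * jet B Basis k (hestenes m e k a (f \<circ> \<psi>)) (\<phi> x)"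
      by (rule C(2)[OF A(2)[OF Ckv[OF f]]]) (use x in \<open>simp add: W_def\<close>)
    also have "\<dots> \<le> C * (A * Csum f)"
      by (intro mult_left_mono C A(3)[OF Ckv[OF f]]) (use phiB xO jetK[OF f] in auto)
    finally show "jet W Basis k (Ext f) x \<le> C * A * real (card Ls) * (\<Sum>g\<in>q ` Ls. g f)"
      by (simp add: Csum_def mult.assoc)
  qed
qed

end

text \<open>The product \<open>pr\<close> covers both applications: an extended vector times a
  scalar cut-off, and an extended scalar times a cut-off vector field. The compact \<open>K\<close>
  inside \<open>W\<close> makes extension by zero C^k and gives a uniform product bound.\<close>

lemma jet_bounded_op_cut:
  fixes pr :: "'b::real_normed_vector \<Rightarrow> 'c::real_normed_vector \<Rightarrow> 'a::euclidean_space"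
    and c :: "'a \<Rightarrow> 'c" and Ext :: "('a \<Rightarrow> 'b) \<Rightarrow> 'a \<Rightarrow> 'b"
  assumes W: "open W" and lin: "\<And>f g a b x. Ext (\<lambda>x. a *\<^sub>R f x + b *\<^sub>R g x) x = a *\<^sub>R Ext f x + b *\<^sub>R Ext g x"
    and Ck: "\<And>f. f \<in> F \<Longrightarrow> Ck_on (enat k) Basis W (Ext f)"
    and C: "C \<ge> 0" and Q: "finite Q" "Q \<subseteq> P"
    and bd: "\<And>f x. f \<in> F \<Longrightarrow> x \<in> W \<Longrightarrow> jet W Basis k (Ext f) x \<le> C * (\<Sum>q\<in>Q. q f)"
    and nn: "\<And>q f. q \<in> P \<Longrightarrow> f \<in> F \<Longrightarrow> 0 \<le> q f"
    and pr: "bounded_bilinear pr" and c: "Ck_on (enat k) Basis W c"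
    and K: "compact K" "K \<subseteq> W" "K \<subseteq> D" "\<And>x. x \<notin> K \<Longrightarrow> c x = 0"
  shows "jet_bounded_op F P D k (\<lambda>f x. if x \<in> W then pr (Ext f x) (c x) else 0)"
proof -
  interpret pr: bounded_bilinear pr by fact
  define E where "E f x = (if x \<in> W then pr (Ext f x) (c x) else 0)" for f x
  have RW: "ray_set W Basis" by (rule ray_set_open[OF W])
  have E0: "E f x = 0" if "x \<notin> K" for f x using K(4)[OF that] by (simp add: E_def pr.zero_right)
  have prod: "Ck_on (enat k) Basis W (\<lambda>x. pr (Ext f x) (c x))" if "f \<in> F" for f
    by (rule Ck_on_bilinear[OF pr RW Ck[OF that] c])
  have EC: "Ck_on (enat k) Basis UNIV (E f)" if f: "f \<in> F" for f
  proof (rule Ck_on_local)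
    fix x
    show "\<exists>T g. open T \<and> x \<in> T \<and> (\<forall>y\<in>UNIV \<inter> T. E f y = g y) \<and> Ck_on (enat k) Basis (UNIV \<inter> T) g"
    proof (cases "x \<in> W")
      case True
      then show ?thesis using W prod[OF f]
        by (intro exI[of _ W] exI[of _ "\<lambda>x. pr (Ext f x) (c x)"]) (auto simp: E_def)
    next
      case False
      have "open (- K)" using K(1) by (simp add: compact_imp_closed open_Compl)
      then show ?thesis using False K(2) E0
        by (intro exI[of _ "- K"] exI[of _ "\<lambda>x. 0"]) (auto intro: Ck_on_const ray_set_open)
    qed
  qed
  obtain C' where C': "C' \<ge> 0" "\<And>f::'a \<Rightarrow> 'b. \<And>x. Ck_on (enat k) Basis W f \<Longrightarrow> x \<in> K \<Longrightarrow>
      jet W Basis k (\<lambda>x. pr (f x) (c x)) x \<le> C' * jet W Basis k f x"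
    using jet_bilinear_le[OF pr RW finite_Basis c K(1,2)] by blast
  have "jet_bounded_op F P D k E" unfolding jet_bounded_op_def
  proof (intro conjI ballI allI exI[of _ "C' * C"] exI[of _ Q])
    show "E f \<in> Ckc D (enat k)" if "f \<in> F" for f
      unfolding Ckc_def using EC[OF that] K E0 by blast
    show "E (\<lambda>x. a *\<^sub>R f x + b *\<^sub>R g x) = (\<lambda>x. a *\<^sub>R E f x + b *\<^sub>R E g x)" for f g a b
      by (rule ext) (simp add: E_def lin pr.add_left pr.scaleR_left)
    show "0 \<le> C' * C" "finite Q" "Q \<subseteq> P" using C C' Q by auto
    fix f x assume f: "f \<in> F"
    show "jet UNIV Basis k (E f) x \<le> C' * C * (\<Sum>q\<in>Q. q f)"
    proof (cases "x \<in> K")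
      case True
      then have xW: "x \<in> W" using K by blast
      have "jet UNIV Basis k (E f) x = jet (UNIV \<inter> W) Basis k (\<lambda>x. pr (Ext f x) (c x)) x"
        by (rule jet_local[OF W]) (use xW in \<open>auto simp: E_def\<close>)
      also have "\<dots> \<le> C' * jet W Basis k (Ext f) x" using C'(2)[OF Ck[OF f] True] by simp
      also have "\<dots> \<le> C' * (C * (\<Sum>q\<in>Q. q f))" by (rule mult_left_mono[OF bd[OF f xW] C'(1)])
      finally show ?thesis by (simp add: mult.assoc)
    next
      case False
      have "jet UNIV Basis k (E f) x = 0"
        by (rule jet_zero_outside[OF compact_imp_closed[OF K(1)] E0 False])
      moreover have "0 \<le> (\<Sum>q\<in>Q. q f)" using Q nn f by (intro sum_nonneg) auto
      ultimately show ?thesis using C C' by simp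
    qed
  qed
  then show ?thesis by (simp add: E_def[abs_def])
qed

text \<open>The combination is 1 - (1 - \<theta>)(1 - \<eta>), which is 1 wherever one of the two
  weights is. Running through a finite cover thus reaches weight 1 on \<open>M\<close>, and
  \<open>P\<close> only has to survive this one combination.\<close>

lemma smooth_gluing_induct:
  fixes M :: "'a::euclidean_space set" and P :: "('a \<Rightarrow> real) \<Rightarrow> bool"
  assumes M: "compact M" and P0: "P (\<lambda>x. 0)"
    and step: "\<And>\<theta> \<eta>. Ck_on k Basis UNIV \<theta> \<Longrightarrow> P \<theta> \<Longrightarrow> P \<eta> \<Longrightarrow> P (\<lambda>x. \<theta> x + (1 - \<theta> x) * \<eta> x)"
    and loc: "\<And>p. p \<in> M \<Longrightarrow> \<exists>\<rho>>0. \<exists>\<eta>. Ck_on k Basis UNIV \<eta> \<and> (\<forall>x\<in>ball p \<rho>. \<eta> x = 1) \<and> P \<eta>"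
  shows "\<exists>\<theta>. (\<forall>x\<in>M. \<theta> x = 1) \<and> P \<theta>"
proof -
  have R: "ray_set (UNIV :: 'a set) Basis" by (rule ray_set_open) simp
  have "\<forall>p\<in>M. \<exists>\<rho>. \<rho> > 0 \<and> (\<exists>\<eta>. Ck_on k Basis UNIV \<eta> \<and> (\<forall>x\<in>ball p \<rho>. \<eta> x = 1) \<and> P \<eta>)"
    using loc by blast
  from bchoice[OF this] obtain \<rho> where \<rho>: "\<And>p. p \<in> M \<Longrightarrow> \<rho> p > 0"
    "\<And>p. p \<in> M \<Longrightarrow> \<exists>\<eta>. Ck_on k Basis UNIV \<eta> \<and> (\<forall>x\<in>ball p (\<rho> p). \<eta> x = 1) \<and> P \<eta>" by blast
  have "M \<subseteq> (\<Union>p\<in>M. ball p (\<rho> p))" using \<rho>(1) by force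
  then obtain A where A: "A \<subseteq> M" "finite A" "M \<subseteq> (\<Union>p\<in>A. ball p (\<rho> p))"
    using compactE_image[OF M, of M "\<lambda>p. ball p (\<rho> p)"] by auto
  from A(2,1) have "\<exists>\<theta>. Ck_on k Basis UNIV \<theta> \<and> (\<forall>x\<in>(\<Union>p\<in>A. ball p (\<rho> p)). \<theta> x = 1) \<and> P \<theta>"
  proof (induction A rule: finite_induct)
    case empty
    show ?case using P0 Ck_on_const[OF R] by (intro exI[of _ "\<lambda>x. 0"]) auto
  next
    case (insert p A)
    then obtain \<theta> where \<theta>: "Ck_on k Basis UNIV \<theta>" "\<forall>x\<in>(\<Union>p\<in>A. ball p (\<rho> p)). \<theta> x = 1" "P \<theta>" by blast
    obtain \<eta> where \<eta>: "Ck_on k Basis UNIV \<eta>" "\<forall>x\<in>ball p (\<rho> p). \<eta> x = 1" "P \<eta>" using \<rho>(2)[of p] insert by blast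
    have "Ck_on k Basis UNIV (\<lambda>x. \<theta> x + (1 - \<theta> x) * \<eta> x)"
      by (rule Ck_on_add[OF R \<theta>(1) Ck_on_mult[OF R Ck_on_diff[OF R Ck_on_const[OF R] \<theta>(1)] \<eta>(1)]])
    moreover have "\<theta> x + (1 - \<theta> x) * \<eta> x = 1" if "x \<in> (\<Union>p\<in>insert p A. ball p (\<rho> p))" for x
    proof (cases "x \<in> ball p (\<rho> p)")
      case True then show ?thesis using \<eta>(2) by simp
    next
      case False
      then have "x \<in> (\<Union>p\<in>A. ball p (\<rho> p))" using that by blast
      then have "\<theta> x = 1" by (rule bspec[OF \<theta>(2)])
      then show ?thesis by simp
    qed
    moreover have "P (\<lambda>x. \<theta> x + (1 - \<theta> x) * \<eta> x)" by (rule step[OF \<theta>(1,3) \<eta>(3)])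
    ultimately show ?case by (intro exI[of _ "\<lambda>x. \<theta> x + (1 - \<theta> x) * \<eta> x"]) blast
  qed
  then show ?thesis using A(3) by blast
qed

lemma plateau_in_open:
  fixes p :: "'a::euclidean_space"
  assumes "open Oo" "p \<in> Oo"
  obtains \<rho> \<eta> where "\<rho> > 0" "cball p (2 * \<rho>) \<subseteq> Oo" "\<And>k. Ck_on k Basis UNIV \<eta>"
    "\<And>x. x \<in> ball p \<rho> \<Longrightarrow> \<eta> x = 1" "\<And>x. x \<notin> cball p (2 * \<rho>) \<Longrightarrow> \<eta> x = (0::real)"
proof -
  obtain s where s: "s > 0" "cball p s \<subseteq> Oo" using assms by (meson open_contains_cball)
  have "s / 2 > 0" using s by simp
  then show ?thesis
  proof (rule smooth_plateau[of "s / 2" p])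
    fix \<eta> :: "'a \<Rightarrow> real" assume "\<And>k. Ck_on k Basis UNIV \<eta>" "\<And>x. dist p x \<le> s / 2 \<Longrightarrow> \<eta> x = 1" "\<And>x. 2 * (s / 2) \<le> dist p x \<Longrightarrow> \<eta> x = 0"
    then show ?thesis using s by (intro that[of "s / 2" \<eta>]) auto
  qed
qed

section \<open>Global extension operators on a compact submanifold\<close>

locale compact_submanifold =
  fixes r :: enat and k m :: nat and D M :: "'a::euclidean_space set"
  assumes rk: "r = enat (Suc k)" and k1: "1 \<le> k" and m1: "1 \<le> m" and m: "m \<le> DIM('a)"
    and D: "open D" "bounded D" and M: "compact M" "M \<subseteq> D" "submanifold r m M"
begin

lemma r1: "1 \<le> r" and kr: "enat k \<le> r"
  using rk by (auto simp: one_enat_def)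

abbreviation "bM \<equiv> mfd_boundary r m M"
abbreviation "FM \<equiv> Ck_mfd r m M (enat k) :: ('a \<Rightarrow> 'a) set"
abbreviation "PM \<equiv> Ck_mfd_seminorms r m M (enat k) :: (('a \<Rightarrow> 'a) \<Rightarrow> real) set"
abbreviation "FB \<equiv> Ck_mfd r (m - 1) bM (enat k) :: ('a \<Rightarrow> real) set"
abbreviation "PB \<equiv> Ck_mfd_seminorms r (m - 1) bM (enat k) :: (('a \<Rightarrow> real) \<Rightarrow> real) set"

lemma chart_at:
  assumes "p \<in> M" obtains e U V \<phi> \<psi> where "mfd_chart r m M U V \<phi> \<psi> e" "p \<in> U"
  by (rule submanifold_chart[OF M(3) assms m r1])

lemma bM_subset: "bM \<subseteq> M" by (auto simp: mfd_boundary_def)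

text \<open>In a chart domain \<open>X - tang X\<close> is an ambient C^k function that agrees with
  the normal part on \<open>M\<close>.\<close>

lemma normal_part_in_Ck_mfd:
  assumes X: "X \<in> Ckc D (enat k)"
  shows "normal_part r m M X \<in> FM"
proof (rule Ck_mfdI[OF m r1 kr])
  show "normal_part r m M X x = 0" if "x \<notin> M" for x using that by (simp add: normal_part_def)
  fix p assume p: "p \<in> M"
  obtain e U V \<phi> \<psi> where c: "mfd_chart r m M U V \<phi> \<psi> e" "p \<in> U" by (rule chart_at[OF p])
  interpret mfd_chart r m M U V \<phi> \<psi> e by (rule c(1))
  have XU: "Ck_on (enat k) Basis U X" by (rule Ck_on_open_subset[OF Ckc_Ck_on[OF X] open_U]) simp
  have "Ck_on (enat k) Basis U (\<lambda>x. X x - tang X x)"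
    by (rule Ck_on_diff[OF ray_set_open[OF open_U] XU Ck_tang[OF rk XU]])
  then show "\<exists>W F. open W \<and> p \<in> W \<and> Ck_on (enat k) Basis W F \<and> (\<forall>x\<in>W \<inter> M. normal_part r m M X x = F x)"
    using open_U c(2) normal_part_eq by (intro exI[of _ U] exI[of _ "\<lambda>x. X x - tang X x"]) auto
qed

lemma boundary_chart_at:
  assumes "p \<in> bM" obtains e U V \<phi> \<psi> where "mfd_chart r m M U V \<phi> \<psi> e" "p \<in> U" "e \<noteq> 0"
proof -
  have p: "p \<in> M" using assms bM_subset by blast
  obtain e U V \<phi> \<psi> where c: "mfd_chart r m M U V \<phi> \<psi> e" "p \<in> U" by (rule chart_at[OF p])
  show ?thesis using that[OF c] mfd_chart.mem_boundary_iff[OF c p m1] assms by blast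
qed

lemma boundary_flux_in_Ck_mfd:
  assumes X: "X \<in> Ckc D (enat k)"
  shows "boundary_flux r m M X \<in> FB"
proof (rule Ck_mfdI[OF _ r1 kr])
  show "m - 1 \<le> DIM('a)" using m by simp
  show "boundary_flux r m M X x = 0" if "x \<notin> bM" for x using that by (simp add: boundary_flux_def)
  fix p assume p: "p \<in> bM"
  obtain e U V \<phi> \<psi> where c: "mfd_chart r m M U V \<phi> \<psi> e" "p \<in> U" "e \<noteq> 0" by (rule boundary_chart_at[OF p])
  interpret mfd_chart r m M U V \<phi> \<psi> e by (rule c(1))
  have XU: "Ck_on (enat k) Basis U X" by (rule Ck_on_open_subset[OF Ckc_Ck_on[OF X] open_U]) simp
  have mm: "m - 1 < DIM('a)" using m m1 by simp
  have "Ck_on (enat k) Basis U (\<lambda>x. X x \<bullet> \<nu> x)"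
    by (rule Ck_on_inner[OF ray_set_open[OF open_U] XU Ck_\<nu>[OF rk mm]])
  then show "\<exists>W F. open W \<and> p \<in> W \<and> Ck_on (enat k) Basis W F \<and> (\<forall>x\<in>W \<inter> bM. boundary_flux r m M X x = F x)"
    using open_U c outward_normal_eq by (intro exI[of _ U] exI[of _ "\<lambda>x. X x \<bullet> \<nu> x"]) (auto simp: boundary_flux_def)
qed

lemma tangent_space_subspace:
  assumes "p \<in> M" shows "subspace (tangent_space r m M p)"
proof -
  obtain e U V \<phi> \<psi> where c: "mfd_chart r m M U V \<phi> \<psi> e" "p \<in> U" by (rule chart_at[OF assms])
  show ?thesis using mfd_chart.subspace_T[OF c] mfd_chart.tangent_space_eq[OF c assms] by simp
qed

lemma diff_normal_part_tangent:
  assumes "p \<in> M" shows "X p - normal_part r m M X p \<in> tangent_space r m M p"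
proof -
  obtain e U V \<phi> \<psi> where c: "mfd_chart r m M U V \<phi> \<psi> e" "p \<in> U" by (rule chart_at[OF assms])
  show ?thesis
    using mfd_chart.tang_in_T[OF c] mfd_chart.tangent_space_eq[OF c assms] mfd_chart.normal_part_eq[OF c assms] by simp
qed

text \<open>The outward normal is itself tangent to \<open>M\<close>. Subtracting an extension of
  the normal part therefore leaves the boundary flux unchanged, which decouples \<open>h\<close>
  from \<open>g\<close>.\<close>

lemma normal_part_flux_zero:
  assumes p: "p \<in> bM" shows "normal_part r m M X p \<bullet> outward_normal r m M p = 0"
proof -
  have pM: "p \<in> M" using p bM_subset by blast
  obtain e U V \<phi> \<psi> where c: "mfd_chart r m M U V \<phi> \<psi> e" "p \<in> U" "e \<noteq> 0" by (rule boundary_chart_at[OF p])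
  interpret mfd_chart r m M U V \<phi> \<psi> e by (rule c(1))
  have "G (m - 1) p \<in> T p" unfolding T_span[OF c(2)] using m1 by (intro span_base) auto
  then have "\<nu> p \<in> T p" unfolding \<nu>_def by (intro subspace_neg subspace_scale subspace_T c)
  then show ?thesis
    using outward_normal_eq[OF c(2) p c(3)] normal_part_eq[OF c(2) pM] diff_tang_orthogonal[OF c(2)] by simp
qed

text \<open>\<open>\<theta>\<close> is the weight with which an operator reproduces its argument on
  \<open>M\<close>. Local operators have cut-off weights; gluing raises the weight to 1 on all of
  \<open>M\<close>.\<close>

definition extends_normal :: "('a \<Rightarrow> real) \<Rightarrow> bool" where
  "extends_normal \<theta> \<longleftrightarrow> (\<exists>E. jet_bounded_op FM PM D k E \<and> (\<forall>f\<in>FM. \<forall>x\<in>M. E f x = \<theta> x *\<^sub>R f x))"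

definition extends_flux :: "('a \<Rightarrow> real) \<Rightarrow> bool" where
  "extends_flux \<theta> \<longleftrightarrow> (\<exists>E. jet_bounded_op FB PB D k E \<and>
    (\<forall>f\<in>FB. (\<forall>x\<in>M. E f x \<in> tangent_space r m M x) \<and> (\<forall>x\<in>bM. E f x \<bullet> outward_normal r m M x = \<theta> x * f x)))"

lemma extends_normal_local:
  assumes p: "p \<in> M"
  shows "\<exists>\<rho>>0. \<exists>\<eta>. Ck_on (enat k) Basis UNIV \<eta> \<and> (\<forall>x\<in>ball p \<rho>. \<eta> x = 1) \<and> extends_normal \<eta>"
proof -
  obtain e U V \<phi> \<psi> where c: "mfd_chart r m M U V \<phi> \<psi> e" "p \<in> U" by (rule chart_at[OF p])
  interpret mfd_chart r m M U V \<phi> \<psi> e by (rule c(1))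
  from local_extension[OF kr c(2) p, where ?'b = 'a]
  obtain W and Ext :: "('a \<Rightarrow> 'a) \<Rightarrow> 'a \<Rightarrow> 'a" and C Q where W: "open W" "p \<in> W" "W \<subseteq> U" and
    lin: "\<forall>f g a b x. Ext (\<lambda>x. a *\<^sub>R f x + b *\<^sub>R g x) x = a *\<^sub>R Ext f x + b *\<^sub>R Ext g x" and
    Ck: "\<forall>f \<in> FM. Ck_on (enat k) Basis W (Ext f) \<and> (\<forall>x\<in>W \<inter> M. Ext f x = f x)" and
    CQ: "C \<ge> 0" "finite Q" "Q \<subseteq> PM" and bd: "\<forall>f \<in> FM. \<forall>x\<in>W. jet W Basis k (Ext f) x \<le> C * (\<Sum>q\<in>Q. q f)"
    by (elim exE conjE) (rule that)
  have "open (W \<inter> D)" "p \<in> W \<inter> D" using W D p M by auto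
  then obtain \<rho> \<eta> where \<rho>: "\<rho> > 0" "cball p (2 * \<rho>) \<subseteq> W \<inter> D" and \<eta>: "\<And>k. Ck_on k Basis UNIV \<eta>"
    "\<And>x. x \<in> ball p \<rho> \<Longrightarrow> \<eta> x = 1" "\<And>x. x \<notin> cball p (2 * \<rho>) \<Longrightarrow> \<eta> x = (0::real)"
    by (rule plateau_in_open) blast
  define E where "E f x = (if x \<in> W then \<eta> x *\<^sub>R Ext f x else 0)" for f x
  have "jet_bounded_op FM PM D k E" unfolding E_def[abs_def]
  proof (rule jet_bounded_op_cut[where pr = "\<lambda>v c. c *\<^sub>R v" and c = \<eta>, OF W(1) _ _ CQ bd[rule_format] _ bounded_bilinear.flip[OF bounded_bilinear_scaleR] _ compact_cball])
    show "Ck_on (enat k) Basis W \<eta>" by (rule Ck_on_open_subset[OF \<eta>(1) W(1)]) simp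
    show "0 \<le> q f" if "q \<in> PM" "f \<in> FM" for q f by (rule Ck_mfd_seminorm_nonneg[OF that(2,1)])
    show "cball p (2 * \<rho>) \<subseteq> W" "cball p (2 * \<rho>) \<subseteq> D" using \<rho> by auto
  qed (use lin Ck \<eta>(3) in auto)
  moreover have "E f x = \<eta> x *\<^sub>R f x" if "f \<in> FM" "x \<in> M" for f x
  proof (cases "x \<in> W")
    case True then show ?thesis using Ck that by (simp add: E_def)
  next
    case False then have "\<eta> x = 0" using \<rho> by (intro \<eta>(3)) blast
    then show ?thesis using False by (simp add: E_def)
  qed
  ultimately have "extends_normal \<eta>" unfolding extends_normal_def by blast
  then show ?thesis using \<rho>(1) \<eta> by blast
qed

text \<open>Away from the boundary the zero operator serves, with a weight vanishing on the
  boundary. Near it the scalar is extended by means of the boundary chart and multiplied by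
  \<open>\<nu>\<close>, which is tangent to \<open>M\<close> and of unit length.\<close>

lemma extends_flux_local:
  assumes p: "p \<in> M"
  shows "\<exists>\<rho>>0. \<exists>\<eta>. Ck_on (enat k) Basis UNIV \<eta> \<and> (\<forall>x\<in>ball p \<rho>. \<eta> x = 1) \<and> extends_flux \<eta>"
proof (cases "p \<in> bM")
  case False
  obtain e U V \<phi> \<psi> where c: "mfd_chart r m M U V \<phi> \<psi> e" "p \<in> U" by (rule chart_at[OF p])
  interpret mfd_chart r m M U V \<phi> \<psi> e by (rule c(1))
  \<comment> \<open>Avoids the boundary: a plane chart has no edge, and in a half-plane chart the
    height is kept positive.\<close>
  define Oo where "Oo = U \<inter> \<phi> -` {y. e = 0 \<or> 0 < y \<bullet> e}"
  have "open {y. 0 < y \<bullet> e}" by (intro open_Collect_less continuous_intros)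
  then have "open {y. e = 0 \<or> 0 < y \<bullet> e}" by (cases "e = 0") auto
  then have "open Oo" unfolding Oo_def
    using continuous_open_preimage[OF Ck_on_continuous[OF Ck_phi] open_U] by blast
  moreover have "p \<in> Oo"
    using False mem_boundary_iff[OF c(2) p m1] mem_M_iff[OF c(2)] p c(2) by (auto simp: Oo_def hspace_def)
  ultimately obtain \<rho> \<eta> where \<rho>: "\<rho> > 0" "cball p (2 * \<rho>) \<subseteq> Oo" and \<eta>: "\<And>k. Ck_on k Basis UNIV \<eta>"
    "\<And>x. x \<in> ball p \<rho> \<Longrightarrow> \<eta> x = 1" "\<And>x. x \<notin> cball p (2 * \<rho>) \<Longrightarrow> \<eta> x = (0::real)"
    by (rule plateau_in_open) blast
  have "\<eta> x = 0" if x: "x \<in> bM" for x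
  proof (rule \<eta>(3), rule)
    assume "x \<in> cball p (2 * \<rho>)"
    then have "x \<in> Oo" using \<rho> by blast
    then show False using x mem_boundary_iff[of x] bM_subset m1 by (auto simp: Oo_def)
  qed
  then have "extends_flux \<eta>" unfolding extends_flux_def
    using jet_bounded_op_zero[of FB PB D k] subspace_0[OF tangent_space_subspace]
    by (intro exI[of _ "\<lambda>f x. 0"]) auto
  then show ?thesis using \<rho>(1) \<eta> by blast
next
  case True
  obtain e U V \<phi> \<psi> where c: "mfd_chart r m M U V \<phi> \<psi> e" "p \<in> U" "e \<noteq> 0" by (rule boundary_chart_at[OF True])
  interpret mfd_chart r m M U V \<phi> \<psi> e by (rule c(1))
  interpret b: mfd_chart r "m - 1" bM U V \<phi> \<psi> 0 by (rule boundary_chart[OF c(3)])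
  have mm: "m - 1 < DIM('a)" using m m1 by simp
  from b.local_extension[OF kr c(2) True, where ?'b = real]
  obtain W and Ext :: "('a \<Rightarrow> real) \<Rightarrow> 'a \<Rightarrow> real" and C Q where W: "open W" "p \<in> W" "W \<subseteq> U" and
    lin: "\<forall>f g a b x. Ext (\<lambda>x. a *\<^sub>R f x + b *\<^sub>R g x) x = a *\<^sub>R Ext f x + b *\<^sub>R Ext g x" and
    Ck: "\<forall>f \<in> FB. Ck_on (enat k) Basis W (Ext f) \<and> (\<forall>x\<in>W \<inter> bM. Ext f x = f x)" and
    CQ: "C \<ge> 0" "finite Q" "Q \<subseteq> PB" and bd: "\<forall>f \<in> FB. \<forall>x\<in>W. jet W Basis k (Ext f) x \<le> C * (\<Sum>q\<in>Q. q f)"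
    by (elim exE conjE) (rule that)
  have "open (W \<inter> D)" "p \<in> W \<inter> D" using W D p M by auto
  then obtain \<rho> \<eta> where \<rho>: "\<rho> > 0" "cball p (2 * \<rho>) \<subseteq> W \<inter> D" and \<eta>: "\<And>k. Ck_on k Basis UNIV \<eta>"
    "\<And>x. x \<in> ball p \<rho> \<Longrightarrow> \<eta> x = 1" "\<And>x. x \<notin> cball p (2 * \<rho>) \<Longrightarrow> \<eta> x = (0::real)"
    by (rule plateau_in_open) blast
  define E where "E f x = (if x \<in> W then Ext f x *\<^sub>R (\<eta> x *\<^sub>R \<nu> x) else 0)" for f x
  have "jet_bounded_op FB PB D k E" unfolding E_def[abs_def]
  proof (rule jet_bounded_op_cut[where pr = scaleR and c = "\<lambda>x. \<eta> x *\<^sub>R \<nu> x", OF W(1) _ _ CQ bd[rule_format] _ bounded_bilinear_scaleR _ compact_cball])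
    show "Ck_on (enat k) Basis W (\<lambda>x. \<eta> x *\<^sub>R \<nu> x)"
      by (rule Ck_on_scaleR[OF ray_set_open[OF W(1)] Ck_on_open_subset[OF \<eta>(1) W(1)] Ck_on_open_subset[OF Ck_\<nu>[OF rk mm] W(1,3)]]) simp
    show "0 \<le> q f" if "q \<in> PB" "f \<in> FB" for q f by (rule Ck_mfd_seminorm_nonneg[OF that(2,1)])
    show "cball p (2 * \<rho>) \<subseteq> W" "cball p (2 * \<rho>) \<subseteq> D" using \<rho> by auto
  qed (use lin Ck \<eta>(3) in auto)
  moreover have "E f x \<in> tangent_space r m M x" if "x \<in> M" for f x
  proof (cases "x \<in> W")
    case xW: True
    then have xU: "x \<in> U" using W by blast
    have "G (m - 1) x \<in> T x" unfolding T_span[OF xU] using m1 by (intro span_base) auto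
    then have "\<nu> x \<in> T x" unfolding \<nu>_def by (intro subspace_neg subspace_scale subspace_T xU)
    then have "Ext f x *\<^sub>R (\<eta> x *\<^sub>R \<nu> x) \<in> T x" by (intro subspace_scale subspace_T xU)
    then show ?thesis using xW tangent_space_eq[OF xU that] by (simp add: E_def)
  next
    case False
    then show ?thesis using subspace_0[OF tangent_space_subspace[OF that]] by (simp add: E_def)
  qed
  moreover have "E f x \<bullet> outward_normal r m M x = \<eta> x * f x" if f: "f \<in> FB" and x: "x \<in> bM" for f x
  proof (cases "x \<in> W")
    case xW: True
    then have xU: "x \<in> U" using W by blast
    have "\<nu> x \<bullet> \<nu> x = 1" using norm_\<nu>[OF xU mm] by (simp add: norm_eq_1)
    then show ?thesis using xW Ck f x outward_normal_eq[OF xU x c(3)] by (simp add: E_def)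
  next
    case False
    then have "\<eta> x = 0" using \<rho> by (intro \<eta>(3)) blast
    then show ?thesis using False by (simp add: E_def)
  qed
  ultimately have "extends_flux \<eta>" unfolding extends_flux_def by blast
  then show ?thesis using \<rho>(1) \<eta> by blast
qed

lemma Ck_one_minus: "Ck_on (enat k) Basis UNIV \<theta> \<Longrightarrow> Ck_on (enat k) Basis UNIV (\<lambda>x::'a. 1 - \<theta> x :: real)"
  by (rule Ck_on_diff[OF ray_set_open[OF open_UNIV] Ck_on_const[OF ray_set_open[OF open_UNIV]]])

lemma extension_normal:
  obtains E where "jet_bounded_op FM PM D k E" "\<And>f x. f \<in> FM \<Longrightarrow> x \<in> M \<Longrightarrow> E f x = f x"
proof -
  have "\<exists>\<theta>. (\<forall>x\<in>M. \<theta> x = 1) \<and> extends_normal \<theta>"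
  proof (rule smooth_gluing_induct[OF M(1) _ _ extends_normal_local])
    show "extends_normal (\<lambda>x. 0)" unfolding extends_normal_def
      using jet_bounded_op_zero[of FM PM D k] by (intro exI[of _ "\<lambda>f x. 0"]) auto
    fix \<theta> \<eta> assume \<theta>: "Ck_on (enat k) Basis UNIV \<theta>" and "extends_normal \<theta>" "extends_normal \<eta>"
    then obtain E1 E2 where E: "jet_bounded_op FM PM D k E1" "\<forall>f\<in>FM. \<forall>x\<in>M. E1 f x = \<theta> x *\<^sub>R f x"
      "jet_bounded_op FM PM D k E2" "\<forall>f\<in>FM. \<forall>x\<in>M. E2 f x = \<eta> x *\<^sub>R f x"
      unfolding extends_normal_def by blast
    have "jet_bounded_op FM PM D k (\<lambda>f x. E1 f x + (1 - \<theta> x) *\<^sub>R E2 f x)"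
      by (rule jet_bounded_op_add[OF E(1) jet_bounded_op_scaleR[OF E(3) Ck_one_minus[OF \<theta>] D(2)]]) (rule Ck_mfd_seminorm_nonneg)
    then show "extends_normal (\<lambda>x. \<theta> x + (1 - \<theta> x) * \<eta> x)"
      unfolding extends_normal_def using E(2,4)
      by (intro exI[of _ "\<lambda>f x. E1 f x + (1 - \<theta> x) *\<^sub>R E2 f x"]) (auto simp: scaleR_left_distrib)
  qed
  then obtain \<theta> E where "\<forall>x\<in>M. \<theta> x = 1" "jet_bounded_op FM PM D k E" "\<forall>f\<in>FM. \<forall>x\<in>M. E f x = \<theta> x *\<^sub>R f x"
    unfolding extends_normal_def by blast
  then show ?thesis using that[of E] by simp
qed

lemma extension_flux:
  obtains E where "jet_bounded_op FB PB D k E" "\<And>f x. f \<in> FB \<Longrightarrow> x \<in> M \<Longrightarrow> E f x \<in> tangent_space r m M x"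
    "\<And>f x. f \<in> FB \<Longrightarrow> x \<in> bM \<Longrightarrow> E f x \<bullet> outward_normal r m M x = f x"
proof -
  have "\<exists>\<theta>. (\<forall>x\<in>M. \<theta> x = 1) \<and> extends_flux \<theta>"
  proof (rule smooth_gluing_induct[OF M(1) _ _ extends_flux_local])
    show "extends_flux (\<lambda>x. 0)" unfolding extends_flux_def
      using jet_bounded_op_zero[of FB PB D k] subspace_0[OF tangent_space_subspace]
      by (intro exI[of _ "\<lambda>f x. 0"]) auto
    fix \<theta> \<eta> assume \<theta>: "Ck_on (enat k) Basis UNIV \<theta>" and "extends_flux \<theta>" "extends_flux \<eta>"
    then obtain E1 E2 where E: "jet_bounded_op FB PB D k E1"
      "\<forall>f\<in>FB. (\<forall>x\<in>M. E1 f x \<in> tangent_space r m M x) \<and> (\<forall>x\<in>bM. E1 f x \<bullet> outward_normal r m M x = \<theta> x * f x)"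
      "jet_bounded_op FB PB D k E2"
      "\<forall>f\<in>FB. (\<forall>x\<in>M. E2 f x \<in> tangent_space r m M x) \<and> (\<forall>x\<in>bM. E2 f x \<bullet> outward_normal r m M x = \<eta> x * f x)"
      unfolding extends_flux_def by blast
    have "jet_bounded_op FB PB D k (\<lambda>f x. E1 f x + (1 - \<theta> x) *\<^sub>R E2 f x)"
      by (rule jet_bounded_op_add[OF E(1) jet_bounded_op_scaleR[OF E(3) Ck_one_minus[OF \<theta>] D(2)]]) (rule Ck_mfd_seminorm_nonneg)
    moreover have "E1 f x + (1 - \<theta> x) *\<^sub>R E2 f x \<in> tangent_space r m M x" if "f \<in> FB" "x \<in> M" for f x
      using E(2,4) that by (intro subspace_add subspace_scale tangent_space_subspace) auto
    moreover have "(E1 f x + (1 - \<theta> x) *\<^sub>R E2 f x) \<bullet> outward_normal r m M x = (\<theta> x + (1 - \<theta> x) * \<eta> x) * f x"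
      if "f \<in> FB" "x \<in> bM" for f x
      using E(2,4) that by (simp add: inner_add_left distrib_right)
    ultimately show "extends_flux (\<lambda>x. \<theta> x + (1 - \<theta> x) * \<eta> x)"
      unfolding extends_flux_def by (intro exI[of _ "\<lambda>f x. E1 f x + (1 - \<theta> x) *\<^sub>R E2 f x"]) auto
  qed
  then obtain \<theta> E where E: "\<forall>x\<in>M. \<theta> x = 1" "jet_bounded_op FB PB D k E"
    "\<forall>f\<in>FB. (\<forall>x\<in>M. E f x \<in> tangent_space r m M x) \<and> (\<forall>x\<in>bM. E f x \<bullet> outward_normal r m M x = \<theta> x * f x)"
    unfolding extends_flux_def by blast
  show ?thesis
  proof (rule that[OF E(2)])
    fix f x assume f: "f \<in> FB"
    show "E f x \<in> tangent_space r m M x" if "x \<in> M" using E(3) f that by blast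
    show "E f x \<bullet> outward_normal r m M x = f x" if "x \<in> bM"
    proof -
      have "\<theta> x = 1" using E(1) bM_subset that by blast
      then show ?thesis using E(3) f that by simp
    qed
  qed
qed

end

section \<open>Uniqueness of the semi-derivative and the representation formula\<close>

text \<open>The definition asks for some flow with the stated limit. Uniqueness of solutions makes
  it the same flow in both cases, hence one limit, so the \<open>THE\<close> in
  \<open>eulerian_semiderivative\<close> is justified.\<close>

lemma has_eulerian_semiderivative_unique:
  fixes X :: "'a::euclidean_space \<Rightarrow> 'a"
  assumes X: "Ck_on 1 Basis UNIV X"
    and L: "has_eulerian_semiderivative \<Xi> J \<Omega> X L" "has_eulerian_semiderivative \<Xi> J \<Omega> X L'"
  shows "L = L'"
proof -
  obtain \<Phi> where \<Phi>: "is_flow X \<Phi>" "((\<lambda>t. (J (\<Phi> t ` \<Omega>) - J \<Omega>) / t) \<longlongrightarrow> L) (at_right 0)"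
    using L(1) unfolding has_eulerian_semiderivative_def by blast
  obtain \<Psi> where \<Psi>: "is_flow X \<Psi>" "((\<lambda>t. (J (\<Psi> t ` \<Omega>) - J \<Omega>) / t) \<longlongrightarrow> L') (at_right 0)"
    using L(2) unfolding has_eulerian_semiderivative_def by blast
  have "\<Phi> t x = \<Psi> t x" for t x
    by (rule ode_unique[where y = "\<lambda>t. \<Phi> t x" and z = "\<lambda>t. \<Psi> t x", OF X]) (use \<Phi>(1) \<Psi>(1) in \<open>auto simp: is_flow_def\<close>)
  then have "\<Phi> = \<Psi>" by (intro ext)
  then show ?thesis using \<Phi>(2) \<Psi>(2) tendsto_unique[OF trivial_limit_at_right_real] by blast
qed

lemma eulerian_semiderivative_eqI:
  assumes "Ck_on 1 Basis UNIV X" "has_eulerian_semiderivative \<Xi> J \<Omega> X L"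
  shows "eulerian_semiderivative \<Xi> J \<Omega> X = L"
  unfolding eulerian_semiderivative_def
proof (rule the_equality)
  show "L' = L" if "has_eulerian_semiderivative \<Xi> J \<Omega> X L'" for L'
    by (rule has_eulerian_semiderivative_unique[OF assms(1) that assms(2)])
qed (rule assms(2))

theorem theorem5p5:
  fixes D M :: "'a::euclidean_space set" and \<Xi> :: "'a set set" and J :: "'a set \<Rightarrow> real"
    and k m :: nat
  assumes "1 \<le> k" and "1 \<le> m" and "m \<le> DIM('a)"
    and "open D" and "bounded D"
    and "M \<subseteq> D" and "bounded M" and "closed M" and "submanifold (enat (k + 1)) m M"
    and "\<And>N. N \<in> \<Xi> \<Longrightarrow> closed N \<and> bounded N \<and> submanifold (enat k) m N \<and> N \<subseteq> D"
    and "M \<in> \<Xi>"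
    and "shape_differentiable D \<Xi> J M"
    and "shape_derivative_of_order D \<Xi> J M k"
  shows "\<exists>(h :: ('a \<Rightarrow> 'a) \<Rightarrow> real) (g :: ('a \<Rightarrow> real) \<Rightarrow> real).
    linear_functional_on (Ck_mfd (enat (k + 1)) m M (enat k)) h \<and>
    continuous_functional_on (Ck_mfd (enat (k + 1)) m M (enat k))
      (Ck_mfd_seminorms (enat (k + 1)) m M (enat k)) h \<and>
    linear_functional_on
      (Ck_mfd (enat (k + 1)) (m - 1) (mfd_boundary (enat (k + 1)) m M) (enat k)) g \<and>
    continuous_functional_on
      (Ck_mfd (enat (k + 1)) (m - 1) (mfd_boundary (enat (k + 1)) m M) (enat k))
      (Ck_mfd_seminorms (enat (k + 1)) (m - 1) (mfd_boundary (enat (k + 1)) m M) (enat k)) g \<and>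
    (\<forall>X \<in> Ckc D (enat k).
      normal_part (enat (k + 1)) m M X \<in> Ck_mfd (enat (k + 1)) m M (enat k) \<and>
      boundary_flux (enat (k + 1)) m M X
        \<in> Ck_mfd (enat (k + 1)) (m - 1) (mfd_boundary (enat (k + 1)) m M) (enat k) \<and>
      has_eulerian_semiderivative \<Xi> J M X
        (h (normal_part (enat (k + 1)) m M X) + g (boundary_flux (enat (k + 1)) m M X)))"
proof -
  define r where "r = enat (k + 1)"
  have rk: "r = enat (Suc k)" by (simp add: r_def)
  have cM: "compact M" using assms(7,8) by (simp add: compact_eq_bounded_closed)
  interpret compact_submanifold r k m D M
    by unfold_locales (use assms(1-9) cM rk in \<open>auto simp: r_def\<close>)
  define L where "L = eulerian_semiderivative \<Xi> J M"
  have ex: "\<exists>l. has_eulerian_semiderivative \<Xi> J M X l" if "X \<in> Ckc D (enat k)" for X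
    using assms(13) that unfolding shape_derivative_of_order_def by blast
  have C1: "Ck_on 1 Basis UNIV X" if "X \<in> Ckc D (enat k)" for X
    by (rule Ck_on_mono[OF Ckc_Ck_on[OF that]]) (use assms(1) in \<open>auto simp: one_enat_def\<close>)
  have has: "has_eulerian_semiderivative \<Xi> J M X (L X)" if X: "X \<in> Ckc D (enat k)" for X
    using ex[OF X] eulerian_semiderivative_eqI[OF C1[OF X]] unfolding L_def by blast
  have contL: "continuous_functional_on (Ckc D (enat k)) (Ckc_seminorms D (enat k)) L"
    using assms(13) unfolding shape_derivative_of_order_def L_def by blast
  have "linear_functional_on (Ckc D \<infinity>) L"
    using assms(12) unfolding shape_differentiable_def L_def by blast
  \<comment> \<open>Linearity is given for smooth fields only, whereas normal parts, fluxes and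
    their extensions are merely C^k.\<close>
  then have linL: "linear_functional_on (Ckc D (enat k)) L"
    by (rule linear_functional_on_Ckc_extend[OF assms(4) _ contL])
  have L0: "L Z = 0" if Z: "Z \<in> Ckc D (enat k)"
    and tan: "\<And>p. p \<in> M \<Longrightarrow> Z p \<in> tangent_space r m M p"
    and bd: "\<And>p. p \<in> bM \<Longrightarrow> Z p \<bullet> outward_normal r m M p = 0" for Z
  proof -
    obtain \<Phi> where \<Phi>: "is_flow Z \<Phi>" "((\<lambda>t. (J (\<Phi> t ` M) - J M) / t) \<longlongrightarrow> L Z) (at_right 0)"
      using has[OF Z] unfolding has_eulerian_semiderivative_def by blast
    have "\<Phi> t ` M = M" for t
      by (rule tangential_flow_invariant[OF rk k1 m1 m assms(8) M(3) C1[OF Z] tan bd \<Phi>(1)])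
    then have "((\<lambda>t::real. 0::real) \<longlongrightarrow> L Z) (at_right 0)" using \<Phi>(2) by simp
    then show ?thesis using tendsto_unique[OF trivial_limit_at_right_real _ tendsto_const] by blast
  qed
  obtain E where E: "jet_bounded_op FM PM D k E" "\<And>f x. f \<in> FM \<Longrightarrow> x \<in> M \<Longrightarrow> E f x = f x"
    by (rule extension_normal) blast
  obtain G where G: "jet_bounded_op FB PB D k G" "\<And>f x. f \<in> FB \<Longrightarrow> x \<in> M \<Longrightarrow> G f x \<in> tangent_space r m M x"
    "\<And>f x. f \<in> FB \<Longrightarrow> x \<in> bM \<Longrightarrow> G f x \<bullet> outward_normal r m M x = f x"
    by (rule extension_flux) blast
  have m': "m - 1 \<le> DIM('a)" using m by simp
  have dM: "(\<lambda>x. f x - g x) \<in> FM" if "f \<in> FM" "g \<in> FM" for f g by (rule Ck_mfd_diff[OF m that])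
  have zM: "q (\<lambda>x. 0) = 0" if "q \<in> PM" for q by (rule Ck_mfd_seminorm_zero[OF m that])
  have hE: "linear_functional_on FM (\<lambda>f. L (E f))" "continuous_functional_on FM PM (\<lambda>f. L (E f))"
    by (rule jet_bounded_op_functional[OF E(1) _ _ linL contL], erule (1) dM, erule zM)+
  have dB: "(\<lambda>x. f x - g x) \<in> FB" if "f \<in> FB" "g \<in> FB" for f g by (rule Ck_mfd_diff[OF m' that])
  have zB: "q (\<lambda>x. 0) = 0" if "q \<in> PB" for q by (rule Ck_mfd_seminorm_zero[OF m' that])
  have gG: "linear_functional_on FB (\<lambda>f. L (G f))" "continuous_functional_on FB PB (\<lambda>f. L (G f))"
    by (rule jet_bounded_op_functional[OF G(1) _ _ linL contL], erule (1) dB, erule zB)+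
  have main: "normal_part r m M X \<in> FM \<and> boundary_flux r m M X \<in> FB \<and>
    has_eulerian_semiderivative \<Xi> J M X (L (E (normal_part r m M X)) + L (G (boundary_flux r m M X)))"
    if X: "X \<in> Ckc D (enat k)" for X
  proof -
    let ?n = "normal_part r m M X" and ?f = "boundary_flux r m M X"
    have n: "?n \<in> FM" and f: "?f \<in> FB" by (rule normal_part_in_Ck_mfd[OF X], rule boundary_flux_in_Ck_mfd[OF X])
    have En: "E ?n \<in> Ckc D (enat k)" and Gf: "G ?f \<in> Ckc D (enat k)"
      using E(1) G(1) n f unfolding jet_bounded_op_def by blast+
    define Y where "Y = (\<lambda>x. X x - E ?n x)"
    define Z where "Z = (\<lambda>x. Y x - G ?f x)"
    have Y: "Y \<in> Ckc D (enat k)" unfolding Y_def by (rule Ckc_diff[OF X En])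
    have Z: "Z \<in> Ckc D (enat k)" unfolding Z_def by (rule Ckc_diff[OF Y Gf])
    have "L Z = 0"
    proof (rule L0[OF Z])
      fix p assume p: "p \<in> M"
      have "Z p = (X p - ?n p) - G ?f p" by (simp add: Z_def Y_def E(2)[OF n p])
      then show "Z p \<in> tangent_space r m M p"
        using diff_normal_part_tangent[OF p, of X] G(2)[OF f p] subspace_diff[OF tangent_space_subspace[OF p]] by simp
    next
      fix p assume p: "p \<in> bM"
      then have pM: "p \<in> M" using bM_subset by blast
      have "Z p = (X p - ?n p) - G ?f p" by (simp add: Z_def Y_def E(2)[OF n pM])
      \<comment> \<open>The normal part is orthogonal to the outward normal and drops out; what
        remains is the flux of \<open>X\<close> minus the flux reproduced by
        \<open>G\<close>.\<close>
      then have "Z p \<bullet> outward_normal r m M p = X p \<bullet> outward_normal r m M p - ?f p"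
        using normal_part_flux_zero[OF p, of X] G(3)[OF f p] by (simp add: inner_diff_left)
      also have "\<dots> = 0" using p by (simp add: boundary_flux_def)
      finally show "Z p \<bullet> outward_normal r m M p = 0" .
    qed
    moreover have lsub: "L (\<lambda>x. A x - B x) = L A - L B" if "A \<in> Ckc D (enat k)" "B \<in> Ckc D (enat k)" for A B
    proof -
      have "L (\<lambda>x. 1 *\<^sub>R A x + (-1) *\<^sub>R B x) = 1 * L A + (-1) * L B"
        using linL that unfolding linear_functional_on_def by blast
      then show ?thesis by simp
    qed
    have "L Z = L X - L (E ?n) - L (G ?f)"
      unfolding Z_def lsub[OF Y Gf] unfolding Y_def lsub[OF X En] ..
    ultimately have "L X = L (E ?n) + L (G ?f)" by simp
    then show ?thesis using has[OF X] n f by simp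
  qed
  show ?thesis unfolding r_def[symmetric]
    by (rule exI[of _ "\<lambda>f. L (E f)"], rule exI[of _ "\<lambda>f. L (G f)"])
      (use hE gG main in blast)
qed

end
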